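(* There exist an integer $N_0\ge 30$ and a number $\delta_0\in(0,10^{-9}]$ such that for every $\delta\in(0,\delta_0]$ there is $\bar\epsilon>0$ with the following property. Let $a(v)=v$ or $a(v)=\hat v:=v/\sqrt{1+|v|^2}$, let $\mu\in\{+1,-1\}$, let $0<\epsilon_0\le\bar\epsilon$, and let $f_0:\mathbb{R}^3_x\times\mathbb{R}^3_v\to\mathbb{R}$ satisfy $$\sum_{|\alpha|+|\beta|\le N_0}\big\|(1+|v|+|x|)^{10N_0-8(|\alpha|+|\beta|)}\nabla_x^\alpha\nabla_v^\beta f_0(x,v)\big\|_{L^2_{x,v}}\le \epsilon_0 .$$ Then the global solution $f$ of the three-dimensional Vlasov-Poisson system $$\partial_t f+a(v)\cdot\nabla_x f+\mu\nabla_x\phi\cdot\nabla_v f=0,\qquad \Delta\phi=\int_{\mathbb{R}^3}f(t,x,v)\,dv,\qquad f(0)=f_0,$$ scatters to a linear solution in the following sense: there exist scattering data $\tilde f_{+\infty}(x,v)$ and $\tilde f_{-\infty}(x,v)$ such that for every $v\in\mathbb{R}^3$, $$\int_{\mathbb{R}^3}f(t,x,v)\,dx\ \longrightarrow\ \int_{\mathbb{R}^3}\tilde f_{\pm\infty}(x-ta(v),v)\,dx=\int_{\mathbb{R}^3}\tilde f_{\pm\infty}(x,v)\,dx\qquad\text{as } t\to\pm\infty .$$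
   Context: $\alpha,\beta\in\mathbb{N}^3$ are multi-indices. The global solution $f$ is the one that exists for such small data and satisfies, for all $t$, $$\sum_{|\alpha|+|\beta|\le N_0}\big\|(1+|v|+|x|)^{10N_0-8(|\alpha|+|\beta|)}\nabla_x^\alpha\nabla_v^\beta\big(f(t,x+ta(v),v)\big)\big\|_{L^2_{x,v}}\le (1+|t|)^{\delta}\epsilon_0 .$$ The potential $\phi(t,\cdot)$ is the Newtonian-potential solution of the Poisson equation, i.e. $\widehat{\phi}(t,\xi)=-|\xi|^{-2}\widehat{\rho}(t,\xi)$ with $\rho(t,x)=\int_{\mathbb{R}^3} f(t,x,v)\,dv$. A linear solution is a function of the form $\tilde f(x-ta(v),v)$. *)

theory Defs
  imports "HOL-Analysis.Analysis"
begin

type_synonym R3 = "real ^ 3"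
type_synonym mindex = "(nat, 3) vec"

section \<open>Classical derivatives\<close>

definition pd :: "'a::euclidean_space \<Rightarrow> ('a \<Rightarrow> real) \<Rightarrow> 'a \<Rightarrow> real" where
  "pd b u z = frechet_derivative u (at z) b"

definition grad :: "('a::euclidean_space \<Rightarrow> real) \<Rightarrow> 'a \<Rightarrow> 'a" where
  "grad u z = (\<Sum>b\<in>Basis. pd b u z *\<^sub>R b)"

definition laplacian :: "('a::euclidean_space \<Rightarrow> real) \<Rightarrow> 'a \<Rightarrow> real" where
  "laplacian u z = (\<Sum>b\<in>Basis. pd b (pd b u) z)"

definition C1 :: "('a::euclidean_space \<Rightarrow> real) \<Rightarrow> bool" where
  "C1 u \<longleftrightarrow> u differentiable_on UNIV \<and> (\<forall>b\<in>Basis. continuous_on UNIV (pd b u))"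

definition twice_differentiable :: "('a::euclidean_space \<Rightarrow> real) \<Rightarrow> bool" where
  "twice_differentiable u \<longleftrightarrow>
     u differentiable_on UNIV \<and> (\<forall>b\<in>Basis. pd b u differentiable_on UNIV)"

text \<open>All iterated partial derivatives exist and are differentiable (hence continuous).\<close>

definition smooth :: "('a::euclidean_space \<Rightarrow> real) \<Rightarrow> bool" where
  "smooth u \<longleftrightarrow> (\<forall>bs. set bs \<subseteq> Basis \<longrightarrow> fold pd bs u differentiable_on UNIV)"

definition test_function :: "('a::euclidean_space \<Rightarrow> real) \<Rightarrow> bool" where
  "test_function \<psi> \<longleftrightarrow> smooth \<psi> \<and> compact (closure {z. \<psi> z \<noteq> 0})"

section \<open>Multi-indices and weak derivatives on phase space\<close>

definition mi_length :: "mindex \<Rightarrow> nat" where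
  "mi_length \<alpha> = (\<Sum>i\<in>UNIV. \<alpha> $ i)"

definition mi_pairs :: "nat \<Rightarrow> (mindex \<times> mindex) set" where
  "mi_pairs N = {(\<alpha>, \<beta>). mi_length \<alpha> + mi_length \<beta> \<le> N}"

lemma finite_mi_pairs: "finite (mi_pairs N)"
proof -
  have component_le: "\<alpha> $ i \<le> mi_length \<alpha>" for \<alpha> :: "mindex" and i
    unfolding mi_length_def by (rule member_le_sum) auto
  let ?A = "{\<alpha> :: mindex. \<forall>i. \<alpha> $ i \<in> {..N}}"
  have "finite ((\<lambda>f. \<chi> i. f i) ` (UNIV \<rightarrow>\<^sub>E {..N}) :: (mindex) set)"
    by (intro finite_imageI finite_PiE) auto
  moreover have "?A \<subseteq> (\<lambda>f. \<chi> i. f i) ` (UNIV \<rightarrow>\<^sub>E {..N})"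
  proof
    fix \<alpha> :: "mindex"
    assume "\<alpha> \<in> ?A"
    then have "(\<lambda>i. \<alpha> $ i) \<in> UNIV \<rightarrow>\<^sub>E {..N}" by auto
    moreover have "\<alpha> = (\<chi> i. \<alpha> $ i)" by (simp add: vec_eq_iff)
    ultimately show "\<alpha> \<in> (\<lambda>f. \<chi> i. f i) ` (UNIV \<rightarrow>\<^sub>E {..N})" by blast
  qed
  ultimately have "finite (?A \<times> ?A)" by (meson finite_SigmaI finite_subset)
  moreover have "mi_pairs N \<subseteq> ?A \<times> ?A"
    using component_le by (fastforce simp: mi_pairs_def intro: order_trans)
  ultimately show ?thesis by (rule finite_subset[rotated])
qed

definition mixed_pd :: "mindex \<Rightarrow> mindex \<Rightarrow> (R3 \<times> R3 \<Rightarrow> real) \<Rightarrow> R3 \<times> R3 \<Rightarrow> real" where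
  "mixed_pd \<alpha> \<beta> u =
     (pd (axis 1 1, 0) ^^ (\<alpha> $ 1)) ((pd (axis 2 1, 0) ^^ (\<alpha> $ 2)) ((pd (axis 3 1, 0) ^^ (\<alpha> $ 3))
     ((pd (0, axis 1 1) ^^ (\<beta> $ 1)) ((pd (0, axis 2 1) ^^ (\<beta> $ 2)) ((pd (0, axis 3 1) ^^ (\<beta> $ 3)) u)))))"

definition locally_integrable :: "('a::euclidean_space \<Rightarrow> real) \<Rightarrow> bool" where
  "locally_integrable u \<longleftrightarrow> (\<forall>K. compact K \<longrightarrow> set_integrable lborel K u)"

definition has_weak_deriv ::
  "mindex \<Rightarrow> mindex \<Rightarrow> (R3 \<times> R3 \<Rightarrow> real) \<Rightarrow> (R3 \<times> R3 \<Rightarrow> real) \<Rightarrow> bool" where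
  "has_weak_deriv \<alpha> \<beta> u w \<longleftrightarrow>
     locally_integrable u \<and> locally_integrable w \<and>
     (\<forall>\<psi>. test_function \<psi> \<longrightarrow>
        (LINT z|lborel. u z * mixed_pd \<alpha> \<beta> \<psi> z) =
        (-1) ^ (mi_length \<alpha> + mi_length \<beta>) * (LINT z|lborel. w z * \<psi> z))"

text \<open>The weak derivative is unique only up to null sets; the norm below does not depend on
  the representative.\<close>

definition weak_deriv :: "mindex \<Rightarrow> mindex \<Rightarrow> (R3 \<times> R3 \<Rightarrow> real) \<Rightarrow> R3 \<times> R3 \<Rightarrow> real" where
  "weak_deriv \<alpha> \<beta> u = (SOME w. has_weak_deriv \<alpha> \<beta> u w)"

section \<open>The weighted Sobolev norm\<close>

text \<open>The subtraction in the exponent does not truncate on \<^term>\<open>mi_pairs N\<close>, where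
  the exponent is at least \<^term>\<open>2 * N\<close>.\<close>

definition weighted_deriv :: "nat \<Rightarrow> (R3 \<times> R3 \<Rightarrow> real) \<Rightarrow> mindex \<Rightarrow> mindex \<Rightarrow> R3 \<times> R3 \<Rightarrow> real" where
  "weighted_deriv N u \<alpha> \<beta> = (\<lambda>(x, v).
     (1 + norm v + norm x) ^ (10 * N - 8 * (mi_length \<alpha> + mi_length \<beta>)) * weak_deriv \<alpha> \<beta> u (x, v))"

definition weighted_sobolev :: "nat \<Rightarrow> (R3 \<times> R3 \<Rightarrow> real) set" where
  "weighted_sobolev N = {u. \<forall>(\<alpha>, \<beta>) \<in> mi_pairs N.
     (\<exists>w. has_weak_deriv \<alpha> \<beta> u w) \<and> integrable lborel (\<lambda>z. (weighted_deriv N u \<alpha> \<beta> z)\<^sup>2)}"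

definition weighted_norm :: "nat \<Rightarrow> (R3 \<times> R3 \<Rightarrow> real) \<Rightarrow> real" where
  "weighted_norm N u =
     (\<Sum>(\<alpha>, \<beta>) \<in> mi_pairs N. sqrt (LINT z|lborel. (weighted_deriv N u \<alpha> \<beta> z)\<^sup>2))"

section \<open>The Vlasov-Poisson system\<close>

definition fourier :: "(R3 \<Rightarrow> real) \<Rightarrow> R3 \<Rightarrow> complex" where
  "fourier u \<xi> = (LINT x|lborel. cis (- (\<xi> \<bullet> x)) * of_real (u x))"

text \<open>The potential with Fourier transform \<open>-|\<xi>|\<^sup>-\<^sup>2 \<rho>^\<close>. It is in general not integrable, so
  this is expressed by Fourier inversion; its transform is integrable.\<close>

definition newtonian_potential :: "(R3 \<Rightarrow> real) \<Rightarrow> (R3 \<Rightarrow> real) \<Rightarrow> bool" where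
  "newtonian_potential \<rho> \<phi> \<longleftrightarrow>
     integrable lborel \<rho> \<and>
     integrable lborel (\<lambda>\<xi>. - fourier \<rho> \<xi> / of_real ((norm \<xi>)\<^sup>2)) \<and>
     (\<forall>x. of_real (\<phi> x) = of_real (1 / (2 * pi) ^ 3) *
        (LINT \<xi>|lborel. cis (\<xi> \<bullet> x) * (- fourier \<rho> \<xi> / of_real ((norm \<xi>)\<^sup>2))))"

definition density :: "(real \<Rightarrow> R3 \<Rightarrow> R3 \<Rightarrow> real) \<Rightarrow> real \<Rightarrow> R3 \<Rightarrow> real" where
  "density f t x = (LINT v|lborel. f t x v)"

definition vlasov_poisson ::
  "(R3 \<Rightarrow> R3) \<Rightarrow> real \<Rightarrow> (real \<Rightarrow> R3 \<Rightarrow> R3 \<Rightarrow> real) \<Rightarrow> (real \<Rightarrow> R3 \<Rightarrow> real) \<Rightarrow> bool" where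
  "vlasov_poisson a \<mu> f \<phi> \<longleftrightarrow>
     C1 (\<lambda>(t, x, v). f t x v) \<and>
     (\<forall>t. twice_differentiable (\<phi> t)) \<and>
     (\<forall>t x. integrable lborel (\<lambda>v. f t x v)) \<and>
     (\<forall>t x v. deriv (\<lambda>s. f s x v) t + a v \<bullet> grad (\<lambda>y. f t y v) x
               + \<mu> * (grad (\<phi> t) x \<bullet> grad (\<lambda>w. f t x w) v) = 0) \<and>
     (\<forall>t x. laplacian (\<phi> t) x = density f t x) \<and>
     (\<forall>t. newtonian_potential (density f t) (\<phi> t))"

definition profile ::
  "(R3 \<Rightarrow> R3) \<Rightarrow> (real \<Rightarrow> R3 \<Rightarrow> R3 \<Rightarrow> real) \<Rightarrow> real \<Rightarrow> R3 \<times> R3 \<Rightarrow> real" where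
  "profile a f t = (\<lambda>(x, v). f t (x + t *\<^sub>R a v) v)"

definition global_solution ::
  "nat \<Rightarrow> real \<Rightarrow> real \<Rightarrow> (R3 \<Rightarrow> R3) \<Rightarrow> real \<Rightarrow> (R3 \<Rightarrow> R3 \<Rightarrow> real) \<Rightarrow>
   (real \<Rightarrow> R3 \<Rightarrow> R3 \<Rightarrow> real) \<Rightarrow> (real \<Rightarrow> R3 \<Rightarrow> real) \<Rightarrow> bool" where
  "global_solution N \<delta> \<epsilon> a \<mu> f0 f \<phi> \<longleftrightarrow>
     vlasov_poisson a \<mu> f \<phi> \<and> f 0 = f0 \<and>
     (\<forall>t. profile a f t \<in> weighted_sobolev N \<and>
          weighted_norm N (profile a f t) \<le> (1 + \<bar>t\<bar>) powr \<delta> * \<epsilon>)"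

section \<open>Scattering to linear solutions\<close>

definition linear_solution :: "(R3 \<Rightarrow> R3) \<Rightarrow> (R3 \<Rightarrow> R3 \<Rightarrow> real) \<Rightarrow> real \<Rightarrow> R3 \<Rightarrow> R3 \<Rightarrow> real" where
  "linear_solution a h t x v = h (x - t *\<^sub>R a v) v"

definition scatters_to ::
  "(R3 \<Rightarrow> R3) \<Rightarrow> (real \<Rightarrow> R3 \<Rightarrow> R3 \<Rightarrow> real) \<Rightarrow> (R3 \<Rightarrow> R3 \<Rightarrow> real) \<Rightarrow> real filter \<Rightarrow> bool" where
  "scatters_to a f h F \<longleftrightarrow>
     (\<forall>v. integrable lborel (\<lambda>x. h x v) \<and>
          (\<forall>t. integrable lborel (\<lambda>x. f t x v)) \<and>
          (\<forall>t. (LINT x|lborel. linear_solution a h t x v) = (LINT x|lborel. h x v)) \<and>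
          ((\<lambda>t. LINT x|lborel. f t x v) \<longlongrightarrow> (LINT x|lborel. h x v)) F)"

end

(*
  Write f(t,x,v) = g(t, x - t a(v), v).  The weighted Sobolev bound gives, by a pointwise Sobolev
  inequality, decay of the profile g and of its first derivatives in (x,v).  On the Fourier side
  the density is an oscillatory integral of g with phase xi.(x + t a(v)); integrating by parts in
  v along the inverse of the Jacobian of a gives |rho^(t,xi)| <= C (1+|t|)^(1/4) (1+|t||xi|)^(-7).
  The mass M(t,v) = int f(t,x,v) dx has time derivative -mu int grad phi . grad_v f dx.  Here
  grad_v f contains the growing term -t Da(v)^T grad_x g, but after Fourier inversion of grad phi
  the x-derivative becomes a factor xi, so t enters only through |t||xi| and
  |dM/dt| <= C (1+|t|)^(1/2) int |xi|^(-1) (1+|t||xi|)^(-6) dxi <= C' |t|^(-3/2).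
  Hence M(t,v) converges, and data with the limiting mass in x scatter.
*)
theory Submission
  imports Defs "HOL-Library.Multiset"
begin

section \<open>Iterated partial derivatives\<close>

text \<open>The hypothesis controls weak derivatives, picked by choice, in L^2; the argument needs
  pointwise decay of a C^1 profile and repeated integration by parts. Both are drawn from one
  interface, \<open>weak_family\<close>: functions indexed by lists of directions, bounded in
  weighted L^1 and linked by one integration by parts at a time.

  The constants form a budget. Eight derivatives cover the six that a pointwise bound in phase space
  costs plus one for the gradient, and also the seven integrations by parts against the phase. With
  N_0 = 30, eight derivatives still carry the weight 300 - 64 = 236, of which 200 is kept. Seven
  powers of 1 + |t||\<xi>| are wanted because the velocity gradient takes one back, and six still
  make |\<xi>|^(-1) (1 + |\<xi>|)^(-6) integrable. Young's inequality squares the norm, so \<delta>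
  \<le> 1/8 gives the growth (1 + |t|)^(1/4). The mass equation is quadratic in the profile, so this
  growth enters squared against the force decay t^(-2).

  The obstacle is that the inverse Jacobian of the relativistic velocity grows in v; the polynomial
  weights pay for it.\<close>

lemma pd_eqI: "(u has_derivative D) (at z) \<Longrightarrow> pd b u z = D b"
  unfolding pd_def by (simp add: frechet_derivative_at[symmetric])

lemma differentiable_has_derivative_pd:
  fixes u :: "'a::euclidean_space \<Rightarrow> real"
  assumes "u differentiable (at z)"
  shows "(u has_derivative (\<lambda>h. pd h u z)) (at z)"
  using assms unfolding pd_def by (simp add: frechet_derivative_works[symmetric])

text \<open>One recursion serves two purposes: with a trivially true \<open>P\<close> it is
  differentiability up to a finite order, with a growth bound as \<open>P\<close> it is a symbol
  estimate. Recursing on the order, rather than quantifying over lists as \<open>smooth\<close>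
  does, lets the product and chain rules be proved by induction.\<close>

primrec nder :: "(('a::euclidean_space \<Rightarrow> real) \<Rightarrow> bool) \<Rightarrow> nat \<Rightarrow> ('a \<Rightarrow> real) \<Rightarrow> bool" where
  "nder P 0 u \<longleftrightarrow> (\<forall>z. u differentiable (at z)) \<and> P u"
| "nder P (Suc n) u \<longleftrightarrow> (\<forall>z. u differentiable (at z)) \<and> P u \<and> (\<forall>b\<in>Basis. nder P n (pd b u))"

abbreviation nsmooth :: "nat \<Rightarrow> ('a::euclidean_space \<Rightarrow> real) \<Rightarrow> bool" where
  "nsmooth \<equiv> nder (\<lambda>_. True)"

lemma nder_differentiable: "nder P n u \<Longrightarrow> u differentiable (at z)"
  by (cases n) auto

lemma nder_pred: "nder P n u \<Longrightarrow> P u"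
  by (cases n) auto

lemma nder_pred_Suc: "nder P (Suc n) u \<Longrightarrow> nder P n u"
  by (induction n arbitrary: u) auto

lemma nder_mono: "nder P n u \<Longrightarrow> (\<And>u. P u \<Longrightarrow> Q u) \<Longrightarrow> nder Q n u"
  by (induction n arbitrary: u) auto

lemma nder_const:
  assumes "\<And>c. P (\<lambda>_. c)"
  shows "nder P n (\<lambda>_. c)"
proof (induction n arbitrary: c)
  case (Suc n)
  have "pd b (\<lambda>_. c) = (\<lambda>_. 0)" for b :: 'a
    by (rule ext, rule pd_eqI) simp
  then show ?case using assms Suc by simp
qed (use assms in simp)

lemma pd_add:
  assumes "u differentiable (at z)" "w differentiable (at z)"
  shows "pd b (\<lambda>z. u z + w z) z = pd b u z + pd b w z"
  by (rule pd_eqI) (intro has_derivative_add differentiable_has_derivative_pd assms)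

lemma pd_mult:
  assumes "u differentiable (at z)" "w differentiable (at z)"
  shows "pd b (\<lambda>z. u z * w z) z = u z * pd b w z + pd b u z * w z"
  by (rule pd_eqI) (intro has_derivative_mult differentiable_has_derivative_pd assms)

lemma pd_compose:
  fixes h :: "real \<Rightarrow> real"
  assumes "h differentiable (at (u z))" "u differentiable (at z)"
  shows "pd b (\<lambda>z. h (u z)) z = pd 1 h (u z) * pd b u z"
proof (rule pd_eqI)
  have D: "(h has_derivative (\<lambda>y. pd y h (u z))) (at (u z))"
    by (rule differentiable_has_derivative_pd) fact
  have "(\<lambda>y. pd y h (u z)) = (\<lambda>y. pd 1 h (u z) * y)"
  proof
    fix y
    show "pd y h (u z) = pd 1 h (u z) * y"
      using linear.scaleR[OF has_derivative_linear[OF D], of y 1] by simp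
  qed
  with D have "(h has_derivative (\<lambda>y. pd 1 h (u z) * y)) (at (u z))" by argo
  from has_derivative_compose[OF differentiable_has_derivative_pd[OF assms(2)] this]
  show "((\<lambda>z. h (u z)) has_derivative (\<lambda>b. pd 1 h (u z) * pd b u z)) (at z)" .
qed

lemma pd_linear: "bounded_linear u \<Longrightarrow> pd b u = (\<lambda>_. u b)"
  by (rule ext, rule pd_eqI, rule bounded_linear_imp_has_derivative)

lemma nder_add:
  assumes P: "\<And>u w. P u \<Longrightarrow> P w \<Longrightarrow> P (\<lambda>z. u z + w z)"
  shows "nder P n u \<Longrightarrow> nder P n w \<Longrightarrow> nder P n (\<lambda>z. u z + w z)"
proof (induction n arbitrary: u w)
  case 0
  then show ?case using P[of u w] by simp
next
  case (Suc n)
  have d: "u differentiable (at z)" "w differentiable (at z)" for z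
    using Suc.prems by auto
  have "pd b (\<lambda>z. u z + w z) = (\<lambda>z. pd b u z + pd b w z)" for b
    by (rule ext, rule pd_add) (rule d)+
  moreover have "nder P n (\<lambda>z. pd b u z + pd b w z)" if "b \<in> Basis" for b
    by (rule Suc.IH) (use Suc.prems that in simp_all)
  moreover have "P (\<lambda>z. u z + w z)"
    by (rule P) (use Suc.prems in simp_all)
  ultimately show ?case using d by simp
qed

text \<open>Three predicates are kept apart so that growth exponents can add under multiplication.
  The Leibniz rule pairs a derivative of one factor with the other factor undifferentiated, so the
  latter is lowered by \<open>nder_pred_Suc\<close> before the induction hypothesis applies.\<close>

lemma nder_mult:
  assumes R: "\<And>u w. R u \<Longrightarrow> R w \<Longrightarrow> R (\<lambda>z. u z + w z)"
    and PQ: "\<And>u w. P u \<Longrightarrow> Q w \<Longrightarrow> R (\<lambda>z. u z * w z)"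
  shows "nder P n u \<Longrightarrow> nder Q n w \<Longrightarrow> nder R n (\<lambda>z. u z * w z)"
proof (induction n arbitrary: u w)
  case (Suc n)
  have pd: "pd b (\<lambda>z. u z * w z) = (\<lambda>z. u z * pd b w z + pd b u z * w z)" for b
    by (rule ext, rule pd_mult) (use Suc.prems in auto)
  have "nder R n (pd b (\<lambda>z. u z * w z))" if "b \<in> Basis" for b
    unfolding pd
    by (intro nder_add[of R] R Suc.IH nder_pred_Suc[OF Suc.prems(1)] nder_pred_Suc[OF Suc.prems(2)])
      (use Suc.prems that in auto)
  moreover have "(\<lambda>z. u z * w z) differentiable (at z)" for z
    using Suc.prems by simp
  moreover have "R (\<lambda>z. u z * w z)"
    by (rule PQ) (use Suc.prems in simp_all)
  ultimately show ?case by simp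
next
  case 0
  then show ?case using PQ[of u w] by simp
qed

lemma nsmooth_compose:
  fixes h :: "real \<Rightarrow> real"
  shows "nsmooth n h \<Longrightarrow> nsmooth n u \<Longrightarrow> nsmooth n (\<lambda>z. h (u z))"
proof (induction n arbitrary: h u)
  case 0
  then show ?case by (metis differentiable_compose nder.simps(1))
next
  case (Suc n)
  have d: "h differentiable (at z)" "u differentiable (at y)" for z y
    using Suc.prems by auto
  have pd: "pd b (\<lambda>z. h (u z)) = (\<lambda>z. pd 1 h (u z) * pd b u z)" for b
    by (rule ext, rule pd_compose[OF d])
  have "nsmooth n (pd b (\<lambda>z. h (u z)))" if "b \<in> Basis" for b
    unfolding pd
    by (rule nder_mult) (use Suc.prems that nder_pred_Suc[OF Suc.prems(2)] in \<open>auto intro!: Suc.IH\<close>)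
  moreover have "(\<lambda>z. h (u z)) differentiable (at z)" for z
    using differentiable_compose[OF d] .
  ultimately show ?case by auto
qed

text \<open>The derivative of 1/u is - u' / u^2, a product that contains 1/u itself, so the
  induction hypothesis on the order already covers both reciprocal factors.\<close>

lemma nsmooth_inverse:
  fixes u :: "'a::euclidean_space \<Rightarrow> real"
  assumes "\<And>z. u z \<noteq> 0"
  shows "nsmooth n u \<Longrightarrow> nsmooth n (\<lambda>z. inverse (u z))"
proof (induction n)
  case (Suc n)
  have d: "u differentiable (at z)" for z
    using Suc.prems by auto
  have "((\<lambda>z. inverse (u z)) has_derivative
      (\<lambda>h. - (inverse (u z) * pd h u z * inverse (u z)))) (at z)" for z
    by (rule Deriv.has_derivative_inverse[OF assms differentiable_has_derivative_pd[OF d]])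
  then have "pd b (\<lambda>z. inverse (u z)) = (\<lambda>z. (- 1) * (inverse (u z) * pd b u z * inverse (u z)))" for b
    by (auto intro!: pd_eqI)
  moreover have "nsmooth n (\<lambda>z. (- 1) * (inverse (u z) * pd b u z * inverse (u z)))" if "b \<in> Basis" for b
    using Suc that by (intro nder_mult[where P="\<lambda>_. True" and Q="\<lambda>_. True"] nder_const Suc.IH
        nder_pred_Suc[OF Suc.prems]) auto
  ultimately show ?case using d assms by auto
qed (use assms in auto)

lemma nsmooth_imp_fold_pd:
  "nsmooth (length bs + n) u \<Longrightarrow> set bs \<subseteq> Basis \<Longrightarrow> nsmooth n (fold pd bs u)"
  by (induction bs arbitrary: u) auto

text \<open>In the forward direction the list grows at its end: \<open>fold\<close> applies the last
  entry last, so \<open>bs @ [b]\<close> is one more derivative on top of those along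
  \<open>bs\<close>.\<close>

lemma smooth_iff_nsmooth: "smooth u \<longleftrightarrow> (\<forall>n. nsmooth n u)"
proof
  assume u: "smooth u"
  have "nsmooth n (fold pd bs u)" if "set bs \<subseteq> Basis" for bs n
    using that
  proof (induction n arbitrary: bs)
    case 0
    then show ?case using u by (auto simp: smooth_def differentiable_on_def)
  next
    case (Suc n)
    have "nsmooth n (pd b (fold pd bs u))" if "b \<in> Basis" for b
      using Suc.IH[of "bs @ [b]"] that Suc.prems by simp
    moreover have "fold pd bs u differentiable (at z)" for z
      using u Suc.prems by (auto simp: smooth_def differentiable_on_def)
    ultimately show ?case by simp
  qed
  from this[of "[]"] show "\<forall>n. nsmooth n u" by simp
next
  assume "\<forall>n. nsmooth n u"
  then show "smooth u" unfolding smooth_def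
    by (metis UNIV_I differentiable_on_def nder_differentiable nsmooth_imp_fold_pd
        differentiable_at_imp_differentiable_on)
qed

lemma smooth_differentiable: "smooth u \<Longrightarrow> u differentiable (at z)"
  using nder_differentiable smooth_iff_nsmooth by blast

lemma smooth_continuous: "smooth u \<Longrightarrow> continuous_on S u"
  by (meson smooth_differentiable continuous_at_imp_continuous_on differentiable_imp_continuous_within)

lemma smooth_pd: "smooth u \<Longrightarrow> b \<in> Basis \<Longrightarrow> smooth (pd b u)"
  unfolding smooth_iff_nsmooth by (metis nder.simps(2))

lemma smooth_const [intro]: "smooth (\<lambda>_. c)"
  unfolding smooth_iff_nsmooth by (auto intro: nder_const)

lemma smooth_add [intro]: "smooth u \<Longrightarrow> smooth w \<Longrightarrow> smooth (\<lambda>z. u z + w z)"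
  unfolding smooth_iff_nsmooth by (auto intro: nder_add)

lemma smooth_mult [intro]: "smooth u \<Longrightarrow> smooth w \<Longrightarrow> smooth (\<lambda>z. u z * w z)"
  unfolding smooth_iff_nsmooth by (auto intro: nder_mult)

lemma smooth_compose:
  fixes h :: "real \<Rightarrow> real"
  shows "smooth h \<Longrightarrow> smooth u \<Longrightarrow> smooth (\<lambda>z. h (u z))"
  unfolding smooth_iff_nsmooth by (auto intro: nsmooth_compose)

lemma smooth_linear: "bounded_linear u \<Longrightarrow> smooth u"
  unfolding smooth_iff_nsmooth
proof
  fix n assume u: "bounded_linear u"
  have "nsmooth m (\<lambda>_::'a. c)" for m c
    by (simp add: nder_const)
  then show "nsmooth n u"
    using pd_linear[OF u] bounded_linear_imp_differentiable[OF u] by (cases n) auto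
qed

lemma smooth_prod [intro]: "(\<And>i. i \<in> I \<Longrightarrow> smooth (u i)) \<Longrightarrow> smooth (\<lambda>z. \<Prod>i\<in>I. u i z)"
  by (induction I rule: infinite_finite_induct) auto

text \<open>Differentiation maps the span of sine and cosine into itself, so the coefficients are
  generalised and one induction suffices.\<close>

lemma nsmooth_sin_cos: "nsmooth n (\<lambda>x::real. c * sin x + d * cos x)"
proof -
  have D: "((\<lambda>x. c * sin x + d * cos x) has_derivative
      (\<lambda>h. h * ((- d) * sin x + c * cos x))) (at x)" for x c d :: real
    by (auto intro!: derivative_eq_intros simp: algebra_simps)
  show ?thesis
  proof (induction n arbitrary: c d)
    case 0
    show ?case using D unfolding nder.simps differentiable_def by blast
  next
    case (Suc n)
    have "pd 1 (\<lambda>x. c * sin x + d * cos x) = (\<lambda>x. (- d) * sin x + c * cos x)"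
      by (rule ext) (use pd_eqI[OF D] in simp)
    moreover have "(\<lambda>x. c * sin x + d * cos x) differentiable (at z)" for z
      using D unfolding differentiable_def by blast
    ultimately show ?case using Suc[of "- d" c] by simp
  qed
qed

lemma smooth_cos: "smooth u \<Longrightarrow> smooth (\<lambda>z. cos (u z))"
proof (rule smooth_compose[of cos u])
  show "smooth (cos :: real \<Rightarrow> real)"
    unfolding smooth_iff_nsmooth using nsmooth_sin_cos[of _ 0 1] by simp
qed

section \<open>Directional derivatives and the symmetry of mixed derivatives\<close>

lemma pd_linear_combination:
  fixes u :: "'a::euclidean_space \<Rightarrow> real"
  assumes "u differentiable (at z)"
  shows "pd h u z = (\<Sum>b\<in>Basis. (h \<bullet> b) * pd b u z)"
proof -
  have lin: "linear (\<lambda>h. pd h u z)"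
    by (rule has_derivative_linear[OF differentiable_has_derivative_pd[OF assms]])
  have "pd (\<Sum>b\<in>Basis. (h \<bullet> b) *\<^sub>R b) u z = (\<Sum>b\<in>Basis. (h \<bullet> b) * pd b u z)"
    by (simp add: linear_sum[OF lin] linear_cmul[OF lin])
  then show ?thesis by (simp add: euclidean_representation)
qed

lemma has_real_derivative_line:
  assumes "u differentiable (at (z + s *\<^sub>R h))"
  shows "((\<lambda>s. u (z + s *\<^sub>R h)) has_real_derivative pd h u (z + s *\<^sub>R h)) (at s)"
proof -
  let ?D = "\<lambda>k. pd k u (z + s *\<^sub>R h)"
  have D: "(u has_derivative ?D) (at (z + s *\<^sub>R h))"
    by (rule differentiable_has_derivative_pd[OF assms])
  have "((\<lambda>s. z + s *\<^sub>R h) has_derivative (\<lambda>r. r *\<^sub>R h)) (at s)"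
    by (auto intro!: derivative_eq_intros)
  from has_derivative_compose[OF this D]
  have "((\<lambda>s. u (z + s *\<^sub>R h)) has_derivative (\<lambda>r. pd (r *\<^sub>R h) u (z + s *\<^sub>R h))) (at s)" .
  moreover have "pd (r *\<^sub>R h) u (z + s *\<^sub>R h) = pd h u (z + s *\<^sub>R h) * r" for r
    using linear_cmul[OF has_derivative_linear[OF D], of r h] by simp
  ultimately show ?thesis by (simp add: has_field_derivative_def)
qed

text \<open>The second difference quotient in the directions \<open>b\<close>, \<open>c\<close> is a value of
  \<open>\<partial>\<^sub>c \<partial>\<^sub>b u\<close> near \<open>z\<close>; being symmetric in \<open>b\<close>, \<open>c\<close> it forces the two mixed derivatives to agree.\<close>

lemma second_difference_mvt:
  assumes u: "smooth u" and b: "b \<in> Basis" and h: "h > 0"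
  obtains s r where "0 < s" "s < h" "0 < r" "r < h"
    "u (z + h *\<^sub>R b + h *\<^sub>R c) - u (z + h *\<^sub>R b) - u (z + h *\<^sub>R c) + u z
      = h * h * pd c (pd b u) (z + s *\<^sub>R b + r *\<^sub>R c)"
proof -
  let ?g = "\<lambda>s. u (z + h *\<^sub>R c + s *\<^sub>R b) - u (z + s *\<^sub>R b)"
  have "\<exists>s>0. s < h \<and> ?g h - ?g 0 = (h - 0) * (pd b u (z + h *\<^sub>R c + s *\<^sub>R b) - pd b u (z + s *\<^sub>R b))"
    by (rule MVT2) (use h in \<open>auto intro!: DERIV_diff has_real_derivative_line smooth_differentiable[OF u]\<close>)
  then obtain s where s: "0 < s" "s < h"
    "?g h - ?g 0 = h * (pd b u (z + h *\<^sub>R c + s *\<^sub>R b) - pd b u (z + s *\<^sub>R b))" by auto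
  let ?k = "\<lambda>r. pd b u (z + s *\<^sub>R b + r *\<^sub>R c)"
  have "\<exists>r>0. r < h \<and> ?k h - ?k 0 = (h - 0) * pd c (pd b u) (z + s *\<^sub>R b + r *\<^sub>R c)"
    by (rule MVT2) (use h in \<open>auto intro!: has_real_derivative_line smooth_differentiable[OF smooth_pd[OF u b]]\<close>)
  then obtain r where r: "0 < r" "r < h"
    "?k h - ?k 0 = h * pd c (pd b u) (z + s *\<^sub>R b + r *\<^sub>R c)" by auto
  show ?thesis
    by (rule that[OF s(1,2) r(1,2)]) (use s(3) r(3) in \<open>simp add: algebra_simps\<close>)
qed

lemma pd_commute:
  assumes u: "smooth u" and b: "b \<in> Basis" and c: "c \<in> Basis"
  shows "pd b (pd c u) = pd c (pd b u)"
proof (rule ext, rule ccontr)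
  fix z
  let ?B = "pd b (pd c u)" and ?C = "pd c (pd b u)"
  assume ne: "?B z \<noteq> ?C z"
  \<comment> \<open>Half the gap. The same second difference is h^2 times a value of each mixed
    derivative near \<open>z\<close>, so both values at \<open>z\<close> lie within \<open>e\<close>
    of one common number, which is too close.\<close>
  define e where "e = \<bar>?B z - ?C z\<bar> / 2"
  have e: "e > 0" using ne by (simp add: e_def)
  have "isCont ?B z" "isCont ?C z"
    using smooth_continuous[OF smooth_pd[OF smooth_pd[OF u c] b], of UNIV]
      smooth_continuous[OF smooth_pd[OF smooth_pd[OF u b] c], of UNIV]
    by (auto simp: continuous_on_eq_continuous_at)
  then obtain d1 d2 where d: "d1 > 0" "d2 > 0"
    "\<And>y. dist y z < d1 \<Longrightarrow> dist (?B y) (?B z) < e"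
    "\<And>y. dist y z < d2 \<Longrightarrow> dist (?C y) (?C z) < e"
    using e unfolding continuous_at_eps_delta by metis
  define h where "h = min d1 d2 / 3"
  have h: "h > 0" "2 * h < d1" "2 * h < d2" using d by (auto simp: h_def)
  have near: "dist (z + s *\<^sub>R i + r *\<^sub>R j) z < 2 * h" if "0 < s" "s < h" "0 < r" "r < h" "i \<in> Basis" "j \<in> Basis" for s r i j
  proof -
    have "norm (s *\<^sub>R i + r *\<^sub>R j) \<le> s + r"
      using norm_triangle_ineq[of "s *\<^sub>R i" "r *\<^sub>R j"] that by simp
    then show ?thesis using that by (simp add: dist_norm add.assoc)
  qed
  let ?\<Delta> = "u (z + h *\<^sub>R b + h *\<^sub>R c) - u (z + h *\<^sub>R b) - u (z + h *\<^sub>R c) + u z"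
  obtain s r where 1: "0 < s" "s < h" "0 < r" "r < h" "?\<Delta> = h * h * ?C (z + s *\<^sub>R b + r *\<^sub>R c)"
    using second_difference_mvt[OF u b h(1)] by metis
  obtain s' r' where 2: "0 < s'" "s' < h" "0 < r'" "r' < h"
      "u (z + h *\<^sub>R c + h *\<^sub>R b) - u (z + h *\<^sub>R c) - u (z + h *\<^sub>R b) + u z = h * h * ?B (z + s' *\<^sub>R c + r' *\<^sub>R b)"
    using second_difference_mvt[OF u c h(1)] by metis
  have "h * h * ?C (z + s *\<^sub>R b + r *\<^sub>R c) = h * h * ?B (z + s' *\<^sub>R c + r' *\<^sub>R b)"
    unfolding 1(5)[symmetric] 2(5)[symmetric] by (simp add: algebra_simps)
  then have "?C (z + s *\<^sub>R b + r *\<^sub>R c) = ?B (z + s' *\<^sub>R c + r' *\<^sub>R b)"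
    using h(1) by simp
  moreover have "dist (?C (z + s *\<^sub>R b + r *\<^sub>R c)) (?C z) < e"
    using near[OF 1(1-4) b c] h by (intro d) auto
  moreover have "dist (?B (z + s' *\<^sub>R c + r' *\<^sub>R b)) (?B z) < e"
    using near[OF 2(1-4) c b] h by (intro d) auto
  ultimately show False unfolding e_def dist_real_def by (auto simp: abs_if split: if_splits)
qed

lemma fold_pd_commute:
  assumes "smooth u" "set bs \<subseteq> Basis" "b \<in> Basis"
  shows "fold pd bs (pd b u) = pd b (fold pd bs u)"
  using assms
proof (induction bs arbitrary: u)
  case (Cons c bs)
  then show ?case by (simp add: pd_commute[of u c b] smooth_pd)
qed simp

section \<open>Symbols\<close>

definition poly_bounded :: "nat \<Rightarrow> ('a::euclidean_space \<Rightarrow> real) \<Rightarrow> bool" where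
  "poly_bounded d u \<longleftrightarrow> (\<exists>C. \<forall>z. \<bar>u z\<bar> \<le> C * (1 + norm z) ^ d)"

definition symb :: "nat \<Rightarrow> ('a::euclidean_space \<Rightarrow> real) \<Rightarrow> bool" where
  "symb d u \<longleftrightarrow> (\<forall>n. nder (poly_bounded d) n u)"

lemma poly_bounded_add: "poly_bounded d u \<Longrightarrow> poly_bounded d w \<Longrightarrow> poly_bounded d (\<lambda>z. u z + w z)"
proof -
  assume "poly_bounded d u" "poly_bounded d w"
  then obtain C D where "\<And>z. \<bar>u z\<bar> \<le> C * (1 + norm z) ^ d" "\<And>z. \<bar>w z\<bar> \<le> D * (1 + norm z) ^ d"
    unfolding poly_bounded_def by auto
  then have "\<bar>u z + w z\<bar> \<le> (C + D) * (1 + norm z) ^ d" for z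
    unfolding distrib_right by (rule order_trans[OF abs_triangle_ineq add_mono])
  then show ?thesis unfolding poly_bounded_def by blast
qed

lemma poly_bounded_mult:
  "poly_bounded d u \<Longrightarrow> poly_bounded e w \<Longrightarrow> poly_bounded (d + e) (\<lambda>z. u z * w z)"
proof -
  assume "poly_bounded d u" "poly_bounded e w"
  then obtain C D where *: "\<And>z. \<bar>u z\<bar> \<le> C * (1 + norm z) ^ d" "\<And>z. \<bar>w z\<bar> \<le> D * (1 + norm z) ^ e"
    unfolding poly_bounded_def by auto
  have "\<bar>u z * w z\<bar> \<le> (C * D) * (1 + norm z) ^ (d + e)" for z
    using mult_mono'[OF *(1)[of z] *(2)[of z]] by (simp add: abs_mult power_add mult_ac)
  then show ?thesis unfolding poly_bounded_def by blast
qed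

lemma poly_bounded_mono: "poly_bounded d u \<Longrightarrow> d \<le> e \<Longrightarrow> poly_bounded e u"
proof -
  assume "poly_bounded d u" and de: "d \<le> e"
  then obtain C where C: "\<And>z. \<bar>u z\<bar> \<le> C * (1 + norm z) ^ d"
    unfolding poly_bounded_def by auto
  have "\<bar>u z\<bar> \<le> \<bar>C\<bar> * (1 + norm z) ^ e" for z
  proof -
    have "\<bar>u z\<bar> \<le> \<bar>C\<bar> * (1 + norm z) ^ d"
      by (rule order_trans[OF C]) (simp add: mult_right_mono)
    also have "\<dots> \<le> \<bar>C\<bar> * (1 + norm z) ^ e"
      by (intro mult_left_mono power_increasing de) auto
    finally show ?thesis .
  qed
  then show ?thesis unfolding poly_bounded_def by blast
qed

lemma symb_smooth: "symb d u \<Longrightarrow> smooth u"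
  unfolding symb_def smooth_iff_nsmooth by (metis nder_mono)

lemma symb_poly_bounded: "symb d u \<Longrightarrow> poly_bounded d u"
  unfolding symb_def using nder_pred by blast

lemma symb_pd: "symb d u \<Longrightarrow> b \<in> Basis \<Longrightarrow> symb d (pd b u)"
  unfolding symb_def by (metis nder.simps(2))

lemma symb_mono: "symb d u \<Longrightarrow> d \<le> e \<Longrightarrow> symb e u"
  unfolding symb_def by (meson nder_mono[of "poly_bounded d" _ _ "poly_bounded e"] poly_bounded_mono)

lemma symb_const: "symb d (\<lambda>_. c)"
proof -
  have "poly_bounded 0 (\<lambda>_. c)" for c unfolding poly_bounded_def by auto
  then show ?thesis unfolding symb_def by (intro allI nder_const) (rule poly_bounded_mono, auto)
qed

lemma symb_add: "symb d u \<Longrightarrow> symb d w \<Longrightarrow> symb d (\<lambda>z. u z + w z)"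
  unfolding symb_def using nder_add[of "poly_bounded d", OF poly_bounded_add] by blast

lemma symb_mult: "symb d u \<Longrightarrow> symb e w \<Longrightarrow> symb (d + e) (\<lambda>z. u z * w z)"
  unfolding symb_def
  using nder_mult[of "poly_bounded (d + e)" "poly_bounded d" "poly_bounded e",
      OF poly_bounded_add poly_bounded_mult] by blast

lemma symb_linear:
  assumes u: "bounded_linear u"
  shows "symb 1 u"
proof -
  obtain K where K: "\<And>z. norm (u z) \<le> norm z * K" "K > 0"
    using bounded_linear.pos_bounded[OF u] by blast
  have "\<bar>u z\<bar> \<le> K * (1 + norm z) ^ 1" for z
  proof -
    have "\<bar>u z\<bar> \<le> norm z * K" using K(1)[of z] by simp
    also have "\<dots> \<le> K * (1 + norm z)" using K(2) by (simp add: distrib_left)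
    finally show ?thesis by simp
  qed
  then have pb: "poly_bounded 1 u" unfolding poly_bounded_def by blast
  have d: "\<forall>z. u differentiable (at z)"
    using bounded_linear_imp_differentiable[OF u] by blast
  have "nder (poly_bounded 1) n u" for n
  proof (cases n)
    case 0
    then show ?thesis using pb d by simp
  next
    case (Suc m)
    have "nder (poly_bounded 1) m (pd b u)" for b
      unfolding pd_linear[OF u] using symb_const[of 1 "u b"] unfolding symb_def by blast
    then show ?thesis using pb d Suc by simp
  qed
  then show ?thesis unfolding symb_def by blast
qed

section \<open>Smooth cutoffs\<close>

text \<open>Dividing exp(-1/x) by powers of x gives a family whose derivatives are combinations of
  its own members, so smoothness across 0 is one induction over all \<open>k\<close>.\<close>

definition flat_exp :: "nat \<Rightarrow> real \<Rightarrow> real" where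
  "flat_exp k x = (if x \<le> 0 then 0 else exp (- (1 / x)) / x ^ k)"

lemma flat_exp_tendsto_0: "(flat_exp k \<longlongrightarrow> 0) (at 0)"
proof -
  have "((\<lambda>y::real. y ^ k / exp y) \<longlongrightarrow> 0) at_top"
    by (rule tendsto_power_div_exp_0)
  then have "((\<lambda>x::real. inverse x ^ k / exp (inverse x)) \<longlongrightarrow> 0) (at_right 0)"
    by (rule filterlim_compose[OF _ filterlim_inverse_at_top_right])
  then have r: "(flat_exp k \<longlongrightarrow> 0) (at_right 0)"
    by (rule Lim_transform_eventually)
      (auto simp: eventually_at_right_less flat_exp_def exp_minus field_simps
        intro!: eventually_mono[OF eventually_at_right_less[of 0]])
  have l: "(flat_exp k \<longlongrightarrow> 0) (at_left 0)"
    by (rule tendsto_eventually)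
      (auto simp: flat_exp_def eventually_at intro!: exI[of _ 1])
  show ?thesis using r l by (simp add: filterlim_at_split)
qed

lemma flat_exp_deriv:
  "(flat_exp k has_real_derivative flat_exp (k + 2) x - k * flat_exp (k + 1) x) (at x)"
proof (cases x "0::real" rule: linorder_cases)
  case less
  have "((\<lambda>_. 0) has_real_derivative 0) (at x)" by simp
  then have "(flat_exp k has_real_derivative 0) (at x)"
    by (rule has_field_derivative_transform_within_open[of _ _ _ "{..<0}"])
      (use less in \<open>auto simp: flat_exp_def\<close>)
  then show ?thesis using less by (simp add: flat_exp_def)
next
  case equal
  \<comment> \<open>At the origin the difference quotient of the k-th function is exactly the
    (k+1)-st function, whose limit is already known.\<close>
  have "((\<lambda>h. (flat_exp k (0 + h) - flat_exp k 0) / h) \<longlongrightarrow> 0) (at 0)"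
  proof (rule Lim_transform_eventually[OF flat_exp_tendsto_0[of "k + 1"]])
    show "\<forall>\<^sub>F h in at 0. flat_exp (k + 1) h = (flat_exp k (0 + h) - flat_exp k 0) / h"
      by (auto simp: flat_exp_def eventually_at intro!: exI[of _ 1])
  qed
  then show ?thesis using equal by (simp add: DERIV_def flat_exp_def)
next
  case greater
  have "((\<lambda>x. exp (- (1 / x)) / x ^ k) has_real_derivative
      flat_exp (k + 2) x - k * flat_exp (k + 1) x) (at x)"
  proof -
    have "((\<lambda>x. exp (- (1 / x)) / x ^ k) has_real_derivative
      (exp (- (1 / x)) * (1 / (x * x)) * x ^ k - exp (- (1 / x)) * (k * x ^ (k - 1))) / (x ^ k * x ^ k)) (at x)"
      using greater by (auto intro!: derivative_eq_intros simp: field_simps)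
    moreover have "(exp (- (1 / x)) * (1 / (x * x)) * x ^ k - exp (- (1 / x)) * (k * x ^ (k - 1))) / (x ^ k * x ^ k)
       = flat_exp (k + 2) x - k * flat_exp (k + 1) x"
      \<comment> \<open>The case split is for \<open>x ^ (k - 1)\<close>: at \<open>k = 0\<close>
        the exponent truncates, but the factor \<open>k\<close> kills the term.\<close>
      using greater by (cases k) (simp_all add: flat_exp_def field_simps power_add power2_eq_square)
    ultimately show ?thesis by simp
  qed
  then show ?thesis
    by (rule has_field_derivative_transform_within_open[of _ _ _ "{0<..}"])
      (use greater in \<open>auto simp: flat_exp_def\<close>)
qed

lemma pd_real_eqI: "(f has_real_derivative d) (at x) \<Longrightarrow> pd 1 f x = d"
  using pd_eqI[of f "\<lambda>h. d * h" x 1] by (simp add: has_field_derivative_def)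

lemma differentiable_realI: "(f has_real_derivative d) (at x) \<Longrightarrow> f differentiable (at x)"
  using real_differentiable_def by blast

lemma nsmooth_flat_exp: "nsmooth n (flat_exp k)"
proof (induction n arbitrary: k)
  case 0
  show ?case using differentiable_realI[OF flat_exp_deriv] by simp
next
  case (Suc n)
  have "pd 1 (flat_exp k) = (\<lambda>x. flat_exp (k + 2) x + (- real k) * flat_exp (k + 1) x)"
    by (rule ext) (use pd_real_eqI[OF flat_exp_deriv] in simp)
  moreover have "nsmooth n (\<lambda>x. flat_exp (k + 2) x + (- real k) * flat_exp (k + 1) x)"
    by (intro nder_add nder_mult[where P="\<lambda>_. True" and Q="\<lambda>_. True"] nder_const Suc.IH) simp_all
  ultimately show ?case using differentiable_realI[OF flat_exp_deriv] by simp
qed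

lemma smooth_flat_exp: "smooth (flat_exp k)"
  by (simp add: smooth_iff_nsmooth nsmooth_flat_exp)

lemma flat_exp_nonneg: "flat_exp k x \<ge> 0"
  by (simp add: flat_exp_def)

lemma smooth_real_linear: "smooth (\<lambda>x::real. c * x + d)"
  by (intro smooth_add smooth_mult smooth_const) (rule smooth_linear, rule bounded_linear_ident)

lemma smooth_inverse:
  fixes u :: "'a::euclidean_space \<Rightarrow> real"
  assumes "\<And>z. u z \<noteq> 0" "smooth u"
  shows "smooth (\<lambda>z. inverse (u z))"
  using nsmooth_inverse[of u] assms unfolding smooth_iff_nsmooth by blast

definition step :: "real \<Rightarrow> real" where
  "step s = flat_exp 0 (1 + s) * inverse (flat_exp 0 (1 + s) + flat_exp 0 (1 - s))"

text \<open>Taking the derivative of \<open>step\<close> as the bump fixes its total mass at 1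
  through the fundamental theorem and provides an explicit bounded primitive, which the pointwise
  Sobolev bound exploits.\<close>

definition bump :: "real \<Rightarrow> real" where
  "bump = pd 1 step"

lemma step_denominator: "flat_exp 0 (1 + s) + flat_exp 0 (1 - s) > 0"
  by (cases "s > -1") (auto simp: flat_exp_def intro: add_pos_nonneg add_nonneg_pos)

lemma smooth_step: "smooth step"
proof -
  have 1: "smooth (\<lambda>s. flat_exp 0 (1 + s))"
    using smooth_compose[OF smooth_flat_exp smooth_real_linear[of 1 1], of 0] by (simp add: add.commute)
  have 2: "smooth (\<lambda>s. flat_exp 0 (1 - s))"
    using smooth_compose[OF smooth_flat_exp smooth_real_linear[of "-1" 1], of 0] by simp
  have "smooth (\<lambda>s. flat_exp 0 (1 + s) * inverse (flat_exp 0 (1 + s) + flat_exp 0 (1 - s)))"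
    by (intro smooth_mult 1 smooth_inverse smooth_add 2) (use step_denominator less_irrefl in metis)
  then show ?thesis unfolding step_def[abs_def] .
qed

lemma step_eq_0: "s \<le> -1 \<Longrightarrow> step s = 0"
  by (simp add: step_def flat_exp_def)

lemma step_eq_1: "s \<ge> 1 \<Longrightarrow> step s = 1"
  by (simp add: step_def flat_exp_def)

lemma step_nonneg: "step s \<ge> 0"
  unfolding step_def using step_denominator[of s] flat_exp_nonneg[of 0] by simp

lemma step_le_1: "step s \<le> 1"
  unfolding step_def using step_denominator[of s] flat_exp_nonneg[of 0 "1 - s"] by (simp add: field_simps)

lemma smooth_bump: "smooth bump"
  unfolding bump_def by (rule smooth_pd[OF smooth_step]) simp

lemma step_deriv: "(step has_real_derivative bump s) (at s)"
  using has_real_derivative_line[of step 0 s 1] smooth_differentiable[OF smooth_step]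
  by (simp add: bump_def)

lemma flat_exp_0_deriv: "(flat_exp 0 has_real_derivative flat_exp 2 x) (at x)"
  using flat_exp_deriv[of 0 x] by (simp add: numeral_2_eq_2)

text \<open>With p rising and q falling, the quotient rule for p / (p + q) leaves p' q - p q' over a
  square: the terms p p' cancel and both remaining ones are nonnegative.\<close>

lemma bump_nonneg: "bump s \<ge> 0"
proof -
  let ?p = "flat_exp 0 (1 + s)" and ?q = "flat_exp 0 (1 - s)"
  have p: "((\<lambda>s. flat_exp 0 (1 + s)) has_real_derivative flat_exp 2 (1 + s)) (at s)"
    by (rule DERIV_chain2[OF flat_exp_0_deriv, THEN DERIV_cong]) (auto intro!: derivative_eq_intros)
  have q: "((\<lambda>s. flat_exp 0 (1 - s)) has_real_derivative - flat_exp 2 (1 - s)) (at s)"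
    by (rule DERIV_chain2[OF flat_exp_0_deriv, THEN DERIV_cong]) (auto intro!: derivative_eq_intros)
  have "(step has_real_derivative
     (flat_exp 2 (1 + s) * (?p + ?q) - ?p * (flat_exp 2 (1 + s) + - flat_exp 2 (1 - s))) / ((?p + ?q) * (?p + ?q))) (at s)"
    unfolding step_def[abs_def] divide_inverse[symmetric]
    by (intro DERIV_divide DERIV_add p q) (use step_denominator[of s] in simp)
  then have "bump s = (flat_exp 2 (1 + s) * (?p + ?q) - ?p * (flat_exp 2 (1 + s) + - flat_exp 2 (1 - s))) / ((?p + ?q) * (?p + ?q))"
    using step_deriv DERIV_unique by blast
  also have "\<dots> = (flat_exp 2 (1 + s) * ?q + ?p * flat_exp 2 (1 - s)) / ((?p + ?q) * (?p + ?q))"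
    by (simp add: algebra_simps)
  also have "\<dots> \<ge> 0"
    by (intro divide_nonneg_nonneg add_nonneg_nonneg mult_nonneg_nonneg flat_exp_nonneg)
  finally show ?thesis .
qed

lemma bump_eq_0: "\<bar>s\<bar> > 1 \<Longrightarrow> bump s = 0"
proof -
  assume s: "\<bar>s\<bar> > 1"
  have "(step has_real_derivative 0) (at s)"
  proof (cases "s > 0")
    case True
    have "((\<lambda>_. 1) has_real_derivative 0) (at s)" by simp
    then show ?thesis
      by (rule has_field_derivative_transform_within_open[of _ _ _ "{1<..}"])
        (use True s in \<open>auto simp: step_eq_1\<close>)
  next
    case False
    have "((\<lambda>_. 0) has_real_derivative 0) (at s)" by simp
    then show ?thesis
      by (rule has_field_derivative_transform_within_open[of _ _ _ "{..<-1}"])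
        (use False s in \<open>auto simp: step_eq_0\<close>)
  qed
  then show ?thesis using step_deriv DERIV_unique by blast
qed

lemma bump_continuous: "continuous_on S bump"
  by (rule smooth_continuous[OF smooth_bump])

lemma bump_bounded: obtains C where "C \<ge> 1" "\<And>s. bump s \<le> C"
proof -
  have "compact (bump ` {-1..1})"
    by (intro compact_continuous_image bump_continuous) simp
  then obtain B where B: "\<And>s. s \<in> {-1..1} \<Longrightarrow> norm (bump s) \<le> B"
    by (meson bounded_iff compact_imp_bounded imageI)
  have "bump s \<le> max 1 B" for s
  proof (cases "\<bar>s\<bar> \<le> 1")
    case True
    then show ?thesis using B[of s] by (simp add: abs_le_iff) linarith
  qed (use bump_eq_0[of s] in simp)
  then show thesis using that[of "max 1 B"] by simp
qed

section \<open>Plateaus and box cutoffs\<close>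

definition plateau :: "real \<Rightarrow> real" where
  "plateau s = step (s + 2) * step (2 - s)"

lemma smooth_plateau: "smooth plateau"
proof -
  have "smooth (\<lambda>s. step (s + 2))" "smooth (\<lambda>s. step (2 - s))"
    using smooth_compose[OF smooth_step smooth_real_linear[of 1 2]]
      smooth_compose[OF smooth_step smooth_real_linear[of "-1" 2]] by simp_all
  then show ?thesis unfolding plateau_def[abs_def] by (rule smooth_mult)
qed

lemma plateau_range: "0 \<le> plateau s" "plateau s \<le> 1"
  unfolding plateau_def by (auto simp: step_nonneg step_le_1 mult_le_one)

lemma plateau_eq_1: "\<bar>s\<bar> \<le> 1 \<Longrightarrow> plateau s = 1"
  unfolding plateau_def by (simp add: step_eq_1)

lemma plateau_eq_0: "\<bar>s\<bar> \<ge> 3 \<Longrightarrow> plateau s = 0"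
  unfolding plateau_def by (cases "s \<ge> 0") (simp_all add: step_eq_0)

lemma pd_plateau_bounded: obtains C where "C \<ge> 0" "\<And>s. \<bar>pd 1 plateau s\<bar> \<le> C"
proof -
  have "compact (pd 1 plateau ` {-3..3})"
    by (intro compact_continuous_image smooth_continuous smooth_pd smooth_plateau) simp_all
  then obtain B where B: "\<And>s. s \<in> {-3..3} \<Longrightarrow> norm (pd 1 plateau s) \<le> B"
    by (meson bounded_iff compact_imp_bounded imageI)
  have "\<bar>pd 1 plateau s\<bar> \<le> max 0 B" for s
  proof (cases "\<bar>s\<bar> \<le> 3")
    case True
    then show ?thesis using B[of s] by (simp add: abs_le_iff)
  next
    case False
    have "((\<lambda>_. 0) has_real_derivative 0) (at s)" by simp
    then have "(plateau has_real_derivative 0) (at s)"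
      by (rule has_field_derivative_transform_within_open[of _ _ _ "- {-3..3}"])
        (use False in \<open>auto simp: plateau_eq_0\<close>)
    then show ?thesis by (simp add: pd_real_eqI)
  qed
  then show thesis using that[of "max 0 B"] by simp
qed

text \<open>The value at \<open>R = 0\<close> is irrelevant; \<open>R\<close> tends to infinity in all applications.\<close>

definition cutoff :: "real \<Rightarrow> 'a::euclidean_space \<Rightarrow> real" where
  "cutoff R z = (\<Prod>b\<in>Basis. plateau ((z \<bullet> b) / R))"

lemma smooth_coordinate: "smooth (\<lambda>z::'a::euclidean_space. z \<bullet> b)"
  by (rule smooth_linear) (rule bounded_linear_inner_left)

lemma smooth_coordinate_compose:
  assumes "smooth h"
  shows "smooth (\<lambda>z::'a::euclidean_space. h ((z \<bullet> b - c) / R))"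
proof -
  have "smooth (\<lambda>z::'a. (1 / R) * (z \<bullet> b) + (- c / R))"
    by (intro smooth_add smooth_mult smooth_const smooth_coordinate)
  from smooth_compose[OF assms this] show ?thesis
    by (simp add: diff_divide_distrib)
qed

lemma smooth_cutoff: "smooth (cutoff R)"
  unfolding cutoff_def[abs_def]
  using smooth_coordinate_compose[OF smooth_plateau, of _ 0 R] by (intro smooth_prod) simp

lemma cutoff_range: "0 \<le> cutoff R z" "cutoff R z \<le> 1"
  unfolding cutoff_def by (auto intro!: prod_nonneg prod_le_1 simp: plateau_range)

lemma cutoff_eq_1: "R \<ge> norm z \<Longrightarrow> R > 0 \<Longrightarrow> cutoff R z = 1"
  unfolding cutoff_def
  by (intro prod.neutral ballI plateau_eq_1)
    (auto simp: divide_le_eq_1 dest: Basis_le_norm[of _ z])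

lemma cutoff_eq_0: "R > 0 \<Longrightarrow> b \<in> Basis \<Longrightarrow> \<bar>z \<bullet> b\<bar> \<ge> 3 * R \<Longrightarrow> cutoff R z = 0"
  unfolding cutoff_def by (rule prod_zero) (auto intro!: bexI[of _ b] plateau_eq_0 simp: field_simps)

lemma pd_coordinate_compose:
  fixes h :: "real \<Rightarrow> real"
  assumes h: "h differentiable (at ((z \<bullet> b - c) / R))" and R: "R \<noteq> 0"
  shows "pd k (\<lambda>z::'a::euclidean_space. h ((z \<bullet> b - c) / R)) z = pd 1 h ((z \<bullet> b - c) / R) * (k \<bullet> b) / R"
proof -
  have D: "((\<lambda>z::'a. (z \<bullet> b - c) / R) has_derivative (\<lambda>k. (k \<bullet> b) / R)) (at z)" for z
    using R by (auto intro!: derivative_eq_intros simp: divide_inverse)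
  have d: "(\<lambda>z::'a. (z \<bullet> b - c) / R) differentiable (at z)"
    using D unfolding differentiable_def by blast
  show ?thesis using pd_compose[of h "\<lambda>z. (z \<bullet> b - c) / R", OF h d] pd_eqI[OF D] by simp
qed

text \<open>Only one factor of the cutoff varies in direction \<open>b\<close>; the others are
  constant along it. So the derivative is the slope of one plateau divided by \<open>R\<close>,
  times a product of size at most 1. The decay in \<open>R\<close> is what removes the cutoff error
  in \<open>weak_family_ibp\<close>.\<close>

lemma pd_cutoff_bounded:
  obtains C where "C \<ge> 0"
    "\<And>R b z. R > 0 \<Longrightarrow> b \<in> Basis \<Longrightarrow> \<bar>pd b (cutoff R) (z::'a::euclidean_space)\<bar> \<le> C / R"
proof -
  obtain C where C: "C \<ge> 0" "\<And>s. \<bar>pd 1 plateau s\<bar> \<le> C"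
    using pd_plateau_bounded by blast
  have "\<bar>pd b (cutoff R) z\<bar> \<le> C / R" if R: "R > 0" and b: "b \<in> Basis" for R b and z :: 'a
  proof -
    let ?u = "\<lambda>z::'a. plateau ((z \<bullet> b - 0) / R)"
    let ?w = "\<lambda>z::'a. \<Prod>c\<in>Basis - {b}. plateau ((z \<bullet> c - 0) / R)"
    have eq: "cutoff R = (\<lambda>z. ?u z * ?w z)"
      unfolding cutoff_def[abs_def] by (rule ext) (use b in \<open>simp add: prod.remove\<close>)
    have w: "smooth ?w" and u: "smooth ?u"
      by (intro smooth_prod smooth_coordinate_compose smooth_plateau)+
    have "(?w has_derivative (\<lambda>h. pd h ?w z)) (at z)"
      by (rule differentiable_has_derivative_pd[OF smooth_differentiable[OF w]])
    have "pd b ?w z = 0"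
    proof -
      have const: "(\<lambda>s. ?w (z + s *\<^sub>R b)) = (\<lambda>_. ?w z)"
        by (intro ext prod.cong) (use b in \<open>auto simp: inner_add_left inner_Basis\<close>)
      have "((\<lambda>s. ?w (z + s *\<^sub>R b)) has_real_derivative pd b ?w (z + 0 *\<^sub>R b)) (at 0)"
        by (rule has_real_derivative_line[OF smooth_differentiable[OF w]])
      then show ?thesis unfolding const using DERIV_unique[OF DERIV_const] by fastforce
    qed
    then have "pd b (cutoff R) z = pd 1 plateau ((z \<bullet> b - 0) / R) / R * ?w z"
      unfolding eq using R b
      by (simp add: pd_mult[OF smooth_differentiable[OF u] smooth_differentiable[OF w], simplified]
          pd_coordinate_compose[OF smooth_differentiable[OF smooth_plateau], where c=0, simplified])
    moreover have "\<bar>?w z\<bar> \<le> 1"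
      by (simp add: abs_prod plateau_range prod_le_1)
    moreover have "\<bar>pd 1 plateau ((z \<bullet> b - 0) / R) / R\<bar> \<le> C / R"
      using R C(2) by (simp add: divide_right_mono)
    ultimately have "\<bar>pd b (cutoff R) z\<bar> \<le> C / R * 1"
      using mult_mono[of "\<bar>pd 1 plateau ((z \<bullet> b - 0) / R) / R\<bar>" "C / R" "\<bar>?w z\<bar>" 1] C(1) R
      by (simp add: abs_mult)
    then show ?thesis by simp
  qed
  then show thesis using that C(1) by blast
qed

lemma test_functionI:
  fixes \<psi> :: "'a::euclidean_space \<Rightarrow> real"
  assumes "smooth \<psi>" "\<And>z. \<psi> z \<noteq> 0 \<Longrightarrow> norm z \<le> R"
  shows "test_function \<psi>"
  unfolding test_function_def
proof
  have "{z. \<psi> z \<noteq> 0} \<subseteq> cball 0 R" using assms(2) by auto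
  then have "bounded {z. \<psi> z \<noteq> 0}" using bounded_subset bounded_cball by blast
  then show "compact (closure {z. \<psi> z \<noteq> 0})" by simp
qed fact

lemma test_function_cutoff_mult:
  fixes u :: "'a::euclidean_space \<Rightarrow> real"
  assumes "smooth u" "R > 0"
  shows "test_function (\<lambda>z. u z * cutoff R z)"
proof (rule test_functionI[where R="DIM('a) * (3 * R)"])
  show "smooth (\<lambda>z. u z * cutoff R z)" by (intro smooth_mult assms smooth_cutoff)
  fix z assume "u z * cutoff R z \<noteq> 0"
  then have "\<bar>z \<bullet> b\<bar> \<le> 3 * R" if "b \<in> Basis" for b
    using cutoff_eq_0[OF assms(2) that, of z] by fastforce
  then have "(\<Sum>b\<in>Basis. \<bar>z \<bullet> b\<bar>) \<le> (\<Sum>b\<in>(Basis::'a set). 3 * R)" by (intro sum_mono)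
  then show "norm z \<le> DIM('a) * (3 * R)" using norm_le_l1[of z] by simp
qed

section \<open>Integration over Euclidean space\<close>

lemma nn_integral_lborel_affine:
  fixes f :: "'a::euclidean_space \<Rightarrow> ennreal"
  assumes [measurable]: "f \<in> borel_measurable borel" and c: "c \<noteq> 0"
  shows "(\<integral>\<^sup>+x. f x \<partial>lborel) = ennreal (\<bar>c\<bar> ^ DIM('a)) * (\<integral>\<^sup>+x. f (t + c *\<^sub>R x) \<partial>lborel)"
  by (subst lborel_affine[OF c, of t])
    (simp add: nn_integral_density nn_integral_distr nn_integral_cmult ennreal_power)

lemma integrable_lborel_affine:
  fixes f :: "'a::euclidean_space \<Rightarrow> 'b::{banach, second_countable_topology}"
  assumes f: "integrable lborel f" and c: "c \<noteq> 0"
  shows "integrable lborel (\<lambda>x. f (t + c *\<^sub>R x))"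
proof -
  have [measurable]: "f \<in> borel_measurable borel"
    using borel_measurable_integrable[OF f] by simp
  have "(\<integral>\<^sup>+x. norm (f x) \<partial>lborel) = \<bar>c\<bar> ^ DIM('a) * (\<integral>\<^sup>+x. norm (f (t + c *\<^sub>R x)) \<partial>lborel)"
    by (rule nn_integral_lborel_affine[of "\<lambda>x. ennreal (norm (f x))", OF _ c]) measurable
  moreover have "(\<integral>\<^sup>+x. norm (f x) \<partial>lborel) < \<infinity>"
    using f unfolding integrable_iff_bounded by simp
  ultimately have "(\<integral>\<^sup>+x. norm (f (t + c *\<^sub>R x)) \<partial>lborel) < \<infinity>"
    using c by (auto simp: ennreal_mult_less_top)
  then show ?thesis unfolding integrable_iff_bounded by simp
qed

lemma integral_lborel_affine:
  fixes f :: "'a::euclidean_space \<Rightarrow> 'b::{banach, second_countable_topology}"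
  assumes f: "integrable lborel f" and c: "c \<noteq> 0"
  shows "(LINT x|lborel. f x) = \<bar>c\<bar> ^ DIM('a) *\<^sub>R (LINT x|lborel. f (t + c *\<^sub>R x))"
proof -
  have [measurable]: "f \<in> borel_measurable borel"
    using borel_measurable_integrable[OF f] by simp
  show ?thesis
    by (subst lborel_affine[OF c, of t])
      (simp add: integral_density integral_distr)
qed

lemma integrable_translate:
  fixes f :: "'a::euclidean_space \<Rightarrow> 'b::{banach, second_countable_topology}"
  shows "integrable lborel f \<Longrightarrow> integrable lborel (\<lambda>x. f (x + t))"
  using integrable_lborel_affine[of f 1 t] by (simp add: add.commute)

text \<open>Holds without integrability: a translate is integrable exactly when the function is, and
  otherwise both integrals have the default value 0.\<close>

lemma integral_translate:
  fixes f :: "'a::euclidean_space \<Rightarrow> 'b::{banach, second_countable_topology}"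
  shows "(LINT x|lborel. f (x + t)) = (LINT x|lborel. f x)"
proof (cases "integrable lborel f")
  case True
  then show ?thesis using integral_lborel_affine[OF True, of 1 t] by (simp add: add.commute)
next
  case False
  then have "\<not> integrable lborel (\<lambda>x. f (x + t))"
    using integrable_translate[of "\<lambda>x. f (x + t)" "- t"] by auto
  with False show ?thesis by (simp add: not_integrable_integral_eq)
qed

text \<open>The increment F(z + h) - F(z) is the average over s in [0,1] of the derivative at z + s
  h. Integrated in z, Fubini and translation invariance turn that average into the integral of the
  derivative, while the increment integrates to 0. No boundary terms and no decay rate at infinity
  have to be discussed.\<close>

lemma integral_pd_eq_0:
  fixes F :: "'a::euclidean_space \<Rightarrow> real"
  assumes d: "\<And>z. F differentiable (at z)"
    and c: "continuous_on UNIV (pd h F)"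
    and F: "integrable lborel F" and D: "integrable lborel (pd h F)"
  shows "(LINT z|lborel. pd h F z) = 0"
proof -
  let ?g = "\<lambda>s z. indicator {0..1} s * pd h F (z + s *\<^sub>R h)"
  have [measurable]: "pd h F \<in> borel_measurable borel"
    by (rule borel_measurable_continuous_onI[OF c])
  have meas: "case_prod ?g \<in> borel_measurable (lborel \<Otimes>\<^sub>M lborel)"
  proof -
    have "(\<lambda>(s, z). indicator {0..1} s * pd h F (z + s *\<^sub>R h)) \<in> borel_measurable (borel \<Otimes>\<^sub>M borel)"
      by measurable
    then show ?thesis by simp
  qed
  have norm_eq: "(LINT z|lborel. norm (?g s z)) = indicator {0..1} s * (LINT z|lborel. norm (pd h F z))" for s
    using integral_translate[of "\<lambda>z. norm (pd h F z)" "s *\<^sub>R h"] by (simp add: abs_mult)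
  have "integrable (lborel \<Otimes>\<^sub>M lborel) (case_prod ?g)"
  proof (rule lborel_pair.Fubini_integrable[OF meas])
    show "integrable lborel (\<lambda>s. LINT z|lborel. norm (case (s, z) of (s, z) \<Rightarrow> ?g s z))"
      unfolding prod.case norm_eq by (intro integrable_mult_left integrable_real_indicator) auto
    show "AE s in lborel. integrable lborel (\<lambda>z. case (s, z) of (s, z) \<Rightarrow> ?g s z)"
      unfolding prod.case by (intro AE_I2 integrable_mult_right integrable_translate D)
  qed
  then have "(LINT z|lborel. LINT s|lborel. ?g s z) = (LINT s|lborel. LINT z|lborel. ?g s z)"
    by (rule lborel_pair.Fubini_integral)
  also have "(LINT s|lborel. LINT z|lborel. ?g s z)
      = (LINT (s::real)|lborel. indicator {0..1} s * (LINT z|lborel. pd h F z))"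
    using integral_translate[of "pd h F"] by simp
  also have "\<dots> = (LINT z|lborel. pd h F z)"
    by (simp add: content_real)
  finally have "(LINT z|lborel. pd h F z) = (LINT z|lborel. LINT s|lborel. ?g s z)" by simp
  also have "(LINT s|lborel. ?g s z) = F (z + h) - F z" for z
  proof -
    have "(LINT s|lborel. pd h F (z + s *\<^sub>R h) * indicator {0..1} s) = F (z + 1 *\<^sub>R h) - F (z + 0 *\<^sub>R h)"
    proof (rule integral_FTC_Icc_real)
      show "isCont (\<lambda>s. pd h F (z + s *\<^sub>R h)) s" for s
      proof -
        have "isCont (pd h F) (z + s *\<^sub>R h)" using c by (simp add: continuous_on_eq_continuous_at)
        moreover have "isCont (\<lambda>s. z + s *\<^sub>R h) s" by (intro continuous_intros)
        ultimately show ?thesis by (rule isCont_o2[rotated])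
      qed
      show "((\<lambda>s. F (z + s *\<^sub>R h)) has_real_derivative pd h F (z + s *\<^sub>R h)) (at s)" for s
        by (rule has_real_derivative_line[OF d])
    qed simp
    then show ?thesis by (simp add: mult.commute)
  qed
  then have "(LINT z|lborel. LINT s|lborel. ?g s z) = (LINT z|lborel. F (z + h) - F z)" by simp
  also have "\<dots> = 0"
    using integral_translate[of F h] integrable_translate[OF F, of h] F by simp
  finally show ?thesis .
qed

lemma integral_by_parts_pd:
  fixes u w :: "'a::euclidean_space \<Rightarrow> real"
  assumes u: "\<And>z. u differentiable (at z)" "continuous_on UNIV (pd h u)"
    and w: "\<And>z. w differentiable (at z)" "continuous_on UNIV (pd h w)"
    and i: "integrable lborel (\<lambda>z. u z * w z)" "integrable lborel (\<lambda>z. u z * pd h w z)"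
      "integrable lborel (\<lambda>z. pd h u z * w z)"
  shows "(LINT z|lborel. u z * pd h w z) = - (LINT z|lborel. pd h u z * w z)"
proof -
  have pd: "pd h (\<lambda>z. u z * w z) = (\<lambda>z. u z * pd h w z + pd h u z * w z)"
    by (rule ext, rule pd_mult) (rule u w)+
  have "continuous_on UNIV u" "continuous_on UNIV w"
    using u w by (simp_all add: differentiable_imp_continuous_within continuous_at_imp_continuous_on)
  then have "(LINT z|lborel. pd h (\<lambda>z. u z * w z) z) = 0"
    by (intro integral_pd_eq_0) (use u w i in \<open>auto simp: pd intro!: continuous_intros\<close>)
  then show ?thesis unfolding pd using i by simp
qed

text \<open>Comparison with a dyadic superposition of balls replaces polar coordinates.\<close>

lemma integrable_dyadic:
  fixes f :: "'a::euclidean_space \<Rightarrow> real"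
  assumes [measurable]: "f \<in> borel_measurable borel"
    and le: "\<And>z. z \<noteq> 0 \<Longrightarrow> f z \<noteq> 0 \<Longrightarrow> \<exists>n. \<bar>f z\<bar> \<le> c n \<and> norm z \<le> r n"
    and c: "\<And>n. c n \<ge> 0" and r: "\<And>n. r n \<ge> 0"
    and s: "summable (\<lambda>n. c n * r n ^ DIM('a))"
  shows "integrable lborel f"
proof -
  let ?V = "unit_ball_vol (DIM('a))"
  have "(\<integral>\<^sup>+z. ennreal (norm (f z)) \<partial>lborel) \<le> (\<integral>\<^sup>+(z::'a). (\<Sum>n. ennreal (c n) * indicator (cball 0 (r n)) z) \<partial>lborel)"
  proof (rule nn_integral_mono_AE)
    \<comment> \<open>Kernels singular at the origin are to be covered, so the origin is discarded
      as a null set.\<close>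
    have "AE z in lborel. z \<noteq> (0::'a)" by (rule AE_lborel_singleton)
    then show "AE z in lborel. ennreal (norm (f z)) \<le> (\<Sum>n. ennreal (c n) * indicator (cball 0 (r n)) z)"
    proof eventually_elim
      case (elim z)
      show ?case
      proof (cases "f z = 0")
        case False
        then obtain n where n: "\<bar>f z\<bar> \<le> c n" "norm z \<le> r n" using le[OF elim] by blast
        have "ennreal (norm (f z)) \<le> ennreal (c n) * indicator (cball 0 (r n)) z"
          using n by (simp add: ennreal_leI)
        also have "\<dots> \<le> (\<Sum>n. ennreal (c n) * indicator (cball 0 (r n)) z)"
          using sum_le_suminf[of "\<lambda>n. ennreal (c n) * indicator (cball 0 (r n)) z" "{n}"] by (simp del: sum_mult_indicator)
        finally show ?thesis .
      qed simp
    qed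
  qed
  also have "\<dots> = (\<Sum>n. ennreal (c n) * emeasure lborel (cball (0::'a) (r n)))"
  proof (subst nn_integral_suminf)
    show "(\<lambda>z::'a. ennreal (c i) * indicator (cball 0 (r i)) z) \<in> borel_measurable lborel" for i
    proof -
      have [measurable]: "cball (0::'a) (r i) \<in> sets borel" by simp
      show ?thesis by measurable
    qed
  qed (simp add: nn_integral_cmult_indicator)
  also have "\<dots> = (\<Sum>n. ennreal (?V * (c n * r n ^ DIM('a))))"
    using c r by (simp add: emeasure_cball ennreal_mult'[symmetric] mult_ac)
  also have "\<dots> < \<infinity>"
  proof -
    have "(\<Sum>n. ennreal (?V * (c n * r n ^ DIM('a)))) = ennreal (\<Sum>n. ?V * (c n * r n ^ DIM('a)))"
      by (rule suminf_ennreal2) (use c r in \<open>auto intro!: summable_mult s\<close>)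
    then show ?thesis by simp
  qed
  finally show ?thesis unfolding integrable_iff_bounded by simp
qed

lemma dyadic_bracket:
  fixes x :: real
  assumes "x \<ge> 1"
  obtains n where "2 ^ n \<le> x" "x < 2 ^ Suc n"
proof -
  obtain m where m: "x < 2 ^ m" using real_arch_pow[of 2 x] by auto
  define k where "k = (LEAST m. x < 2 ^ m)"
  have k: "x < 2 ^ k" unfolding k_def by (rule LeastI[of _ m]) (rule m)
  then have "k \<noteq> 0" using assms by (intro notI) simp
  then obtain n where n: "k = Suc n" using not0_implies_Suc by blast
  have "\<not> x < 2 ^ n" using not_less_Least[of n "\<lambda>m. x < 2 ^ m"] n k_def by simp
  then show ?thesis using that[of n] k n by simp
qed

lemma integrable_decay:
  assumes k: "k > DIM('a)"
  shows "integrable lborel (\<lambda>z::'a::euclidean_space. 1 / (1 + norm z) ^ k)"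
proof (rule integrable_dyadic)
  define c :: "nat \<Rightarrow> real" where "c = (\<lambda>n. 1 / (2 ^ n) ^ k)"
  define r :: "nat \<Rightarrow> real" where "r = (\<lambda>n. 2 ^ Suc n)"
  show "\<exists>n. \<bar>1 / (1 + norm z) ^ k\<bar> \<le> c n \<and> norm z \<le> r n" for z :: 'a
  proof -
    obtain n where "2 ^ n \<le> 1 + norm z" "1 + norm z < 2 ^ Suc n"
      using dyadic_bracket[of "1 + norm z"] by auto
    then show ?thesis
      by (intro exI[of _ n]) (auto simp: c_def r_def intro!: divide_left_mono power_mono)
  qed
  \<comment> \<open>The excess m + 1 of k over the dimension is the rate of the geometric series: a
    ball of radius 2^(n+1) has volume of order 2^(n DIM), and the kernel on its outer shell is at
    most 2^(-n k).\<close>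
  obtain m where m: "k = DIM('a) + Suc m" using less_imp_Suc_add[OF k] by auto
  have "c n * r n ^ DIM('a) = 2 ^ DIM('a) * ((1 / 2) ^ Suc m) ^ n" for n
    unfolding c_def r_def m power_add power_Suc power_mult_distrib power_divide
    by (simp add: field_simps power_mult[symmetric] power_add[symmetric])
  moreover have "summable (\<lambda>n. (2::real) ^ DIM('a) * ((1 / 2) ^ Suc m) ^ n)"
    by (intro summable_mult summable_geometric) (simp add: power_le_one power_Suc_less_one del: power_Suc)
  ultimately show "summable (\<lambda>n. c n * r n ^ DIM('a))" by simp
qed auto

text \<open>Near the origin the shells shrink: where |z| is about 2^(-n) the singular factor is at
  most 2^(n+1), against a volume of order 8^(-n), and the series of 4^(-n) converges. Outside the
  unit ball 1/|z| is at most 1, so the decaying factor alone dominates.\<close>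

lemma integrable_inverse_norm_decay:
  assumes "k > 3"
  shows "integrable lborel (\<lambda>z::real^3. 1 / (norm z * (1 + norm z) ^ k))"
proof -
  have 1: "integrable lborel (\<lambda>z::real^3. indicator (cball 0 1) z / norm z)"
  proof (rule integrable_dyadic)
    define c :: "nat \<Rightarrow> real" where "c = (\<lambda>n. 2 ^ Suc n)"
    define r :: "nat \<Rightarrow> real" where "r = (\<lambda>n. 1 / 2 ^ n)"
    show "(\<lambda>z::real^3. indicator (cball 0 1) z / norm z) \<in> borel_measurable borel"
    proof -
      have "(norm :: real^3 \<Rightarrow> real) \<in> borel_measurable borel"
        by (intro borel_measurable_continuous_onI continuous_on_norm_id)
      moreover have "(indicator (cball (0::real^3) 1) :: _ \<Rightarrow> real) \<in> borel_measurable borel"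
        by (rule borel_measurable_indicator) simp
      ultimately show ?thesis by (rule borel_measurable_divide[rotated])
    qed
    show "c n \<ge> 0" "r n \<ge> 0" for n by (simp_all add: c_def r_def)
    show "\<exists>n. \<bar>indicator (cball 0 1) z / norm z\<bar> \<le> c n \<and> norm z \<le> r n"
      if "z \<noteq> 0" "indicator (cball 0 1) z / norm z \<noteq> 0" for z :: "real^3"
    proof -
      have z: "norm z \<le> 1" "norm z > 0" using that by (auto simp: indicator_def split: if_splits)
      then have "1 / norm z \<ge> 1" by simp
      then obtain n where "2 ^ n \<le> 1 / norm z" "1 / norm z < 2 ^ Suc n"
        using dyadic_bracket by blast
      then show ?thesis using z
        by (intro exI[of _ n]) (auto simp: c_def r_def field_simps)
    qed
    have "c n * r n ^ 3 = 2 * (1 / 4) ^ n" for n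
      unfolding c_def r_def by (simp add: power3_eq_cube field_simps power_mult_distrib[symmetric])
    moreover have "summable (\<lambda>n. (2::real) * (1 / 4) ^ n)"
      by (intro summable_mult summable_geometric) simp
    ultimately show "summable (\<lambda>n. c n * r n ^ DIM(real^3))" by simp
  qed
  have 2: "integrable lborel (\<lambda>z::real^3. 1 / (1 + norm z) ^ k)"
    by (rule integrable_decay) (use assms in simp)
  show ?thesis
  proof (rule Bochner_Integration.integrable_bound[OF Bochner_Integration.integrable_add[OF 1 2]])
    show "AE z::real^3 in lborel. norm (1 / (norm z * (1 + norm z) ^ k))
      \<le> norm (indicator (cball 0 1) z / norm z + 1 / (1 + norm z) ^ k)"
    proof (intro AE_I2)
      fix z :: "real^3"
      have p: "(1 + norm z) ^ k \<ge> 1" by (simp add: one_le_power)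
      show "norm (1 / (norm z * (1 + norm z) ^ k))
        \<le> norm (indicator (cball 0 1) z / norm z + 1 / (1 + norm z) ^ k)"
      proof (cases "norm z \<le> 1")
        case True
        have "1 / (norm z * (1 + norm z) ^ k) \<le> 1 / norm z"
        proof (cases "z = 0")
          case False
          then have "norm z * 1 \<le> norm z * (1 + norm z) ^ k"
            using p by (intro mult_left_mono) auto
          then show ?thesis using False by (intro frac_le) auto
        qed simp
        moreover have "0 \<le> 1 / (1 + norm z) ^ k" by simp
        ultimately have "1 / (norm z * (1 + norm z) ^ k) \<le> 1 / norm z + 1 / (1 + norm z) ^ k"
          by linarith
        then show ?thesis using True by simp
      next
        case False
        then have "1 * (1 + norm z) ^ k \<le> norm z * (1 + norm z) ^ k"
          by (intro mult_right_mono) auto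
        then have "1 / (norm z * (1 + norm z) ^ k) \<le> 1 / (1 + norm z) ^ k"
          using p by (intro frac_le) auto
        then show ?thesis using False by simp
      qed
    qed
    show "(\<lambda>z::real^3. 1 / (norm z * (1 + norm z) ^ k)) \<in> borel_measurable lborel"
    proof -
      have [measurable]: "(norm :: real^3 \<Rightarrow> real) \<in> borel_measurable borel"
        by (intro borel_measurable_continuous_onI continuous_on_norm_id)
      show ?thesis by measurable
    qed
  qed
qed

lemma integrable_scale_integral:
  fixes f :: "'a::euclidean_space \<Rightarrow> real"
  assumes "integrable lborel f" "c > 0"
  shows "integrable lborel (\<lambda>x. f (c *\<^sub>R x))"
    "(LINT x|lborel. f (c *\<^sub>R x)) = (LINT x|lborel. f x) / c ^ DIM('a)"
  using integrable_lborel_affine[OF assms(1), of c 0] integral_lborel_affine[OF assms(1), of c 0] assms(2)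
  by simp_all

section \<open>Families of weak derivatives\<close>

text \<open>The lists stand for ordered derivatives, and only consecutive members are related, by a
  single integration by parts. Weighted L^1 is the convenient norm because every use pairs a member
  with an amplitude dominated by the weight. One bound \<open>B\<close> for all members keeps the
  later constants independent of time and of the family.\<close>

definition weak_family ::
  "nat \<Rightarrow> nat \<Rightarrow> real \<Rightarrow> ('a::euclidean_space list \<Rightarrow> 'a \<Rightarrow> real) \<Rightarrow> bool" where
  "weak_family m L B W \<longleftrightarrow> (\<forall>bs. set bs \<subseteq> Basis \<and> length bs \<le> L \<longrightarrow>
     W bs \<in> borel_measurable borel \<and>
     integrable lborel (\<lambda>z. (1 + norm z) ^ m * \<bar>W bs z\<bar>) \<and>
     (LINT z|lborel. (1 + norm z) ^ m * \<bar>W bs z\<bar>) \<le> B \<and>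
     (\<forall>j\<in>Basis. length bs < L \<longrightarrow> (\<forall>\<psi>. test_function \<psi> \<longrightarrow>
        (LINT z|lborel. W bs z * pd j \<psi> z) = - (LINT z|lborel. W (bs @ [j]) z * \<psi> z))))"

lemma
  assumes "weak_family m L B W" "set bs \<subseteq> Basis" "length bs \<le> L"
  shows weak_family_measurable: "W bs \<in> borel_measurable borel"
    and weak_family_integrable: "integrable lborel (\<lambda>z. (1 + norm z) ^ m * \<bar>W bs z\<bar>)"
    and weak_family_bound: "(LINT z|lborel. (1 + norm z) ^ m * \<bar>W bs z\<bar>) \<le> B"
    and weak_family_test: "j \<in> Basis \<Longrightarrow> length bs < L \<Longrightarrow> test_function \<psi> \<Longrightarrow>
      (LINT z|lborel. W bs z * pd j \<psi> z) = - (LINT z|lborel. W (bs @ [j]) z * \<psi> z)"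
  using assms unfolding weak_family_def by blast+

lemma poly_bounded_obtain:
  assumes "poly_bounded m \<Psi>"
  obtains C where "C \<ge> 0" "\<And>z. \<bar>\<Psi> z\<bar> \<le> C * (1 + norm z) ^ m"
proof -
  obtain C where C: "\<And>z. \<bar>\<Psi> z\<bar> \<le> C * (1 + norm z) ^ m"
    using assms unfolding poly_bounded_def by blast
  have "C \<ge> 0" using C[of 0] by simp
  with C that show thesis by blast
qed

lemma weak_family_integrable_mult:
  assumes "weak_family m L B W" "set bs \<subseteq> Basis" "length bs \<le> L"
    and "\<Psi> \<in> borel_measurable borel" "C \<ge> 0" "\<And>z. \<bar>\<Psi> z\<bar> \<le> C * (1 + norm z) ^ m"
  shows "integrable lborel (\<lambda>z. W bs z * \<Psi> z)"
    and "\<bar>LINT z|lborel. W bs z * \<Psi> z\<bar> \<le> C * B"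
proof -
  note [measurable] = weak_family_measurable[OF assms(1-3)] assms(4)
  have i: "integrable lborel (\<lambda>z. C * ((1 + norm z) ^ m * \<bar>W bs z\<bar>))"
    using weak_family_integrable[OF assms(1-3)] by simp
  have le: "\<bar>W bs z * \<Psi> z\<bar> \<le> C * ((1 + norm z) ^ m * \<bar>W bs z\<bar>)" for z
    using mult_right_mono[OF assms(6)[of z], of "\<bar>W bs z\<bar>"] by (simp add: abs_mult mult_ac)
  show I: "integrable lborel (\<lambda>z. W bs z * \<Psi> z)"
    by (rule Bochner_Integration.integrable_bound[OF i]) (auto intro!: AE_I2 order_trans[OF le])
  have "\<bar>LINT z|lborel. W bs z * \<Psi> z\<bar> \<le> (LINT z|lborel. \<bar>W bs z * \<Psi> z\<bar>)"
    using integral_norm_bound[of lborel "\<lambda>z. W bs z * \<Psi> z"] by simp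
  also have "\<dots> \<le> (LINT z|lborel. C * ((1 + norm z) ^ m * \<bar>W bs z\<bar>))"
    by (rule integral_mono[OF _ i le]) (use I in simp)
  also have "\<dots> \<le> C * B"
    using weak_family_bound[OF assms(1-3)] assms(5) by (simp add: mult_left_mono)
  finally show "\<bar>LINT z|lborel. W bs z * \<Psi> z\<bar> \<le> C * B" .
qed

lemma smooth_measurable: "smooth \<Psi> \<Longrightarrow> \<Psi> \<in> borel_measurable borel"
  by (rule borel_measurable_continuous_onI[OF smooth_continuous])

lemma abs_cutoff_le_1: "\<bar>cutoff R z\<bar> \<le> 1"
  using cutoff_range[of R z] by simp

text \<open>Extends integration by parts from compact support to polynomial growth: multiply by
  cutoffs of radius n + 1 and let n grow. The term in which the derivative hits the cutoff tends to
  0, and the weight of the family provides the majorant.\<close>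

lemma weak_family_ibp:
  fixes W :: "'a::euclidean_space list \<Rightarrow> 'a \<Rightarrow> real"
  assumes W: "weak_family m L B W" and bs: "set bs \<subseteq> Basis" "length bs < L" and j: "j \<in> Basis"
    and \<Psi>: "smooth \<Psi>" "poly_bounded m \<Psi>" "poly_bounded m (pd j \<Psi>)"
  shows "(LINT z|lborel. W bs z * pd j \<Psi> z) = - (LINT z|lborel. W (bs @ [j]) z * \<Psi> z)"
proof -
  obtain C where C: "C \<ge> 0" "\<And>z. \<bar>\<Psi> z\<bar> \<le> C * (1 + norm z) ^ m"
    using poly_bounded_obtain[OF \<Psi>(2)] by blast
  obtain D where D: "D \<ge> 0" "\<And>z. \<bar>pd j \<Psi> z\<bar> \<le> D * (1 + norm z) ^ m"
    using poly_bounded_obtain[OF \<Psi>(3)] by blast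
  obtain E where E: "E \<ge> 0"
    "\<And>R b z. R > 0 \<Longrightarrow> b \<in> Basis \<Longrightarrow> \<bar>pd b (cutoff R) (z::'a)\<bar> \<le> E / R"
    using pd_cutoff_bounded[where 'a='a] by blast
  have bs': "set bs \<subseteq> Basis" "length bs \<le> L" "set (bs @ [j]) \<subseteq> Basis" "length (bs @ [j]) \<le> L"
    using bs j by auto
  note [measurable] = weak_family_measurable[OF W bs'(1,2)] weak_family_measurable[OF W bs'(3,4)]
    smooth_measurable[OF \<Psi>(1)] smooth_measurable[OF smooth_pd[OF \<Psi>(1) j]]
    smooth_measurable[OF smooth_cutoff] smooth_measurable[OF smooth_pd[OF smooth_cutoff j]]
  let ?\<chi> = "\<lambda>n. cutoff (real (Suc n)) :: 'a \<Rightarrow> real"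
  let ?P = "\<lambda>n z. pd j (\<lambda>z. \<Psi> z * ?\<chi> n z) z"
  have pd: "?P n z = \<Psi> z * pd j (?\<chi> n) z + pd j \<Psi> z * ?\<chi> n z" for n z
    by (rule pd_mult) (intro smooth_differentiable \<Psi> smooth_cutoff)+
  have lim1: "(\<lambda>n. ?\<chi> n z) \<longlonglongrightarrow> 1" for z
  proof (rule tendsto_eventually)
    obtain N where "norm z \<le> real N" using real_arch_simple by blast
    then show "\<forall>\<^sub>F n in sequentially. ?\<chi> n z = 1"
      by (auto simp: eventually_sequentially intro!: exI[of _ N] cutoff_eq_1)
  qed
  have lim2: "(\<lambda>n. pd j (?\<chi> n) z) \<longlonglongrightarrow> 0" for z
  proof (rule Lim_null_comparison)
    show "\<forall>\<^sub>F n in sequentially. norm (pd j (?\<chi> n) z) \<le> E / real (Suc n)"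
      using E(2)[OF _ j] by (simp del: of_nat_Suc)
    show "(\<lambda>n. E / real (Suc n)) \<longlonglongrightarrow> 0"
      using tendsto_mult[OF tendsto_const[of E] LIMSEQ_inverse_real_of_nat] by (simp add: divide_inverse)
  qed
  have "(\<lambda>n. LINT z|lborel. W bs z * ?P n z) \<longlonglongrightarrow> (LINT z|lborel. W bs z * pd j \<Psi> z)"
  proof (rule integral_dominated_convergence)
    \<comment> \<open>\<open>C * E\<close> bounds the term with the differentiated cutoff, whose
      slope \<open>E / R\<close> is at most \<open>E\<close> for radii at least 1; \<open>D\<close>
      bounds the term with \<open>pd j \<Psi>\<close>.\<close>
    show "integrable lborel (\<lambda>z. (C * E + D) * ((1 + norm z) ^ m * \<bar>W bs z\<bar>))"
      using weak_family_integrable[OF W bs'(1,2)] by simp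
    show "AE z in lborel. (\<lambda>n. W bs z * ?P n z) \<longlonglongrightarrow> W bs z * pd j \<Psi> z"
    proof (rule AE_I2)
      fix z
      have "(\<lambda>n. W bs z * ?P n z) \<longlonglongrightarrow> W bs z * (\<Psi> z * 0 + pd j \<Psi> z * 1)"
        unfolding pd by (intro tendsto_intros lim1 lim2)
      then show "(\<lambda>n. W bs z * ?P n z) \<longlonglongrightarrow> W bs z * pd j \<Psi> z" by simp
    qed
    show "AE z in lborel. norm (W bs z * ?P n z) \<le> (C * E + D) * ((1 + norm z) ^ m * \<bar>W bs z\<bar>)" for n
    proof (rule AE_I2)
      fix z :: 'a
      have "E / real (Suc n) \<le> E" using E(1) by (simp add: field_simps)
      then have e: "\<bar>pd j (?\<chi> n) z\<bar> \<le> E" using E(2)[OF _ j, of "real (Suc n)" z] by simp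
      have "\<bar>?P n z\<bar> \<le> \<bar>\<Psi> z\<bar> * \<bar>pd j (?\<chi> n) z\<bar> + \<bar>pd j \<Psi> z\<bar> * \<bar>?\<chi> n z\<bar>"
        unfolding pd by (metis abs_mult abs_triangle_ineq)
      also have "\<dots> \<le> (C * (1 + norm z) ^ m) * E + (D * (1 + norm z) ^ m) * 1"
        by (intro add_mono mult_mono C D e abs_cutoff_le_1) (use C(1) D(1) in auto)
      finally have "\<bar>?P n z\<bar> \<le> (C * E + D) * (1 + norm z) ^ m"
        by (simp add: algebra_simps)
      from mult_right_mono[OF this, of "\<bar>W bs z\<bar>"]
      show "norm (W bs z * ?P n z) \<le> (C * E + D) * ((1 + norm z) ^ m * \<bar>W bs z\<bar>)"
        by (simp add: abs_mult mult_ac)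
    qed
    show "(\<lambda>z. W bs z * ?P n z) \<in> borel_measurable lborel" for n
      unfolding pd by measurable
  qed measurable
  moreover have "(\<lambda>n. - (LINT z|lborel. W (bs @ [j]) z * (\<Psi> z * ?\<chi> n z))) \<longlonglongrightarrow> - (LINT z|lborel. W (bs @ [j]) z * \<Psi> z)"
  proof (intro tendsto_minus integral_dominated_convergence)
    show "integrable lborel (\<lambda>z. C * ((1 + norm z) ^ m * \<bar>W (bs @ [j]) z\<bar>))"
      using weak_family_integrable[OF W bs'(3,4)] by simp
    show "AE z in lborel. (\<lambda>n. W (bs @ [j]) z * (\<Psi> z * ?\<chi> n z)) \<longlonglongrightarrow> W (bs @ [j]) z * \<Psi> z"
    proof (rule AE_I2)
      fix z
      have "(\<lambda>n. W (bs @ [j]) z * (\<Psi> z * ?\<chi> n z)) \<longlonglongrightarrow> W (bs @ [j]) z * (\<Psi> z * 1)"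
        by (intro tendsto_intros lim1)
      then show "(\<lambda>n. W (bs @ [j]) z * (\<Psi> z * ?\<chi> n z)) \<longlonglongrightarrow> W (bs @ [j]) z * \<Psi> z" by simp
    qed
    show "AE z in lborel. norm (W (bs @ [j]) z * (\<Psi> z * ?\<chi> n z)) \<le> C * ((1 + norm z) ^ m * \<bar>W (bs @ [j]) z\<bar>)" for n
    proof (rule AE_I2)
      fix z :: 'a
      have "\<bar>\<Psi> z\<bar> * \<bar>?\<chi> n z\<bar> \<le> (C * (1 + norm z) ^ m) * 1"
        by (intro mult_mono C abs_cutoff_le_1) (use C(1) in auto)
      from mult_right_mono[OF this, of "\<bar>W (bs @ [j]) z\<bar>"]
      show "norm (W (bs @ [j]) z * (\<Psi> z * ?\<chi> n z)) \<le> C * ((1 + norm z) ^ m * \<bar>W (bs @ [j]) z\<bar>)"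
        by (simp add: abs_mult mult_ac)
    qed
  qed measurable
  moreover have "(LINT z|lborel. W bs z * ?P n z) = - (LINT z|lborel. W (bs @ [j]) z * (\<Psi> z * ?\<chi> n z))" for n
    by (rule weak_family_test[OF W bs'(1,2) j bs(2)]) (rule test_function_cutoff_mult[OF \<Psi>(1)], simp)
  ultimately show ?thesis by (simp add: LIMSEQ_unique)
qed

subsection \<open>Multi-indices as lists of coordinate directions\<close>

definition index_x :: "(R3 \<times> R3) list \<Rightarrow> mindex" where
  "index_x bs = (\<chi> i. count (mset bs) (axis i 1, 0))"

definition index_v :: "(R3 \<times> R3) list \<Rightarrow> mindex" where
  "index_v bs = (\<chi> i. count (mset bs) (0, axis i 1))"

text \<open>The order mirrors \<open>mixed_pd\<close>: \<open>fold\<close> applies the head of the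
  list first, so the innermost derivatives, those in the third velocity, stand at the front.\<close>

definition index_list :: "mindex \<Rightarrow> mindex \<Rightarrow> (R3 \<times> R3) list" where
  "index_list \<alpha> \<beta> = replicate (\<beta> $ 3) (0, axis 3 1) @ replicate (\<beta> $ 2) (0, axis 2 1) @
     replicate (\<beta> $ 1) (0, axis 1 1) @ replicate (\<alpha> $ 3) (axis 3 1, 0) @
     replicate (\<alpha> $ 2) (axis 2 1, 0) @ replicate (\<alpha> $ 1) (axis 1 1, 0)"

lemma mixed_pd_eq_fold: "mixed_pd \<alpha> \<beta> u = fold pd (index_list \<alpha> \<beta>) u"
  unfolding mixed_pd_def index_list_def by simp

lemma Basis_R3: "(Basis :: R3 set) = {axis 1 1, axis 2 1, axis 3 1}"
  by (auto simp: Basis_vec_def UNIV_3)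

lemma Basis_phase:
  "(Basis :: (R3 \<times> R3) set) = {(axis 1 1, 0), (axis 2 1, 0), (axis 3 1, 0), (0, axis 1 1), (0, axis 2 1), (0, axis 3 1)}"
  unfolding Basis_prod_def Basis_R3 by auto

lemma mset_index_list:
  assumes "set bs \<subseteq> Basis"
  shows "mset (index_list (index_x bs) (index_v bs)) = mset bs"
proof (rule multiset_eqI)
  fix b :: "R3 \<times> R3"
  show "count (mset (index_list (index_x bs) (index_v bs))) b = count (mset bs) b"
  proof (cases "b \<in> Basis")
    case True
    then show ?thesis unfolding Basis_phase
      by (auto simp: index_list_def index_x_def index_v_def axis_eq_axis axis_eq_0_iff
          axis_eq_0_iff[THEN eq_commute[THEN trans]])
  next
    case False
    then have "b \<notin> set bs" using assms by blast
    then have "count (mset bs) b = 0" by (simp add: count_eq_zero_iff)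
    moreover have "count (mset (index_list (index_x bs) (index_v bs))) b = 0"
    proof -
      have "b \<notin> set (index_list (index_x bs) (index_v bs))"
        using False unfolding Basis_phase by (auto simp: index_list_def)
      then show ?thesis by (metis not_in_iff set_mset_mset)
    qed
    ultimately show ?thesis by argo
  qed
qed

lemma mi_length_index:
  assumes "set bs \<subseteq> Basis"
  shows "mi_length (index_x bs) + mi_length (index_v bs) = length bs"
proof -
  have "length bs = length (index_list (index_x bs) (index_v bs))"
    using mset_index_list[OF assms] by (metis size_mset)
  then show ?thesis by (simp add: index_list_def mi_length_def sum_3)
qed

text \<open>Sorting the directions into the fixed order of \<open>mixed_pd\<close> is a permutation,
  legitimate by the symmetry of mixed derivatives. Smoothness is the invariant that keeps every swap
  justified.\<close>

lemma mixed_pd_index: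
  assumes "set bs \<subseteq> Basis" "smooth \<psi>"
  shows "mixed_pd (index_x bs) (index_v bs) \<psi> = fold pd bs \<psi>"
  unfolding mixed_pd_eq_fold
proof (rule fold_permuted_eq[OF mset_index_list[OF assms(1)], where P=smooth, OF assms(2)])
  have set: "set (index_list (index_x bs) (index_v bs)) \<subseteq> Basis"
    using mset_index_list[OF assms(1)] assms(1) by (metis mset_eq_setD)
  show "smooth (pd b z)" if "b \<in> set (index_list (index_x bs) (index_v bs))" "smooth z" for b z
    using that set by (auto intro: smooth_pd)
  show "pd b (pd c z) = pd c (pd b z)"
    if "b \<in> set (index_list (index_x bs) (index_v bs))" "c \<in> set (index_list (index_x bs) (index_v bs))" "smooth z" for b c z
    using that set by (intro pd_commute) auto
qed

text \<open>Local integrability hides measurability in the restrictions to balls; the function is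
  their pointwise limit.\<close>

lemma locally_integrable_measurable:
  fixes u :: "'a::euclidean_space \<Rightarrow> real"
  assumes "locally_integrable u"
  shows "u \<in> borel_measurable borel"
proof (rule borel_measurable_LIMSEQ_real)
  let ?f = "\<lambda>n x. indicator (cball 0 (real n)) x * u x"
  show "(\<lambda>n. ?f n x) \<longlonglongrightarrow> u x" for x
  proof (rule tendsto_eventually)
    obtain N where "norm x \<le> real N" using real_arch_simple by blast
    then show "\<forall>\<^sub>F n in sequentially. ?f n x = u x"
      by (auto simp: eventually_sequentially intro!: exI[of _ N])
  qed
  fix n
  have "set_integrable lborel (cball 0 (real n)) u"
    using assms unfolding locally_integrable_def by simp
  then show "?f n \<in> borel_measurable borel"
    unfolding set_integrable_def by (auto dest: borel_measurable_integrable)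
qed

lemma test_function_smooth: "test_function \<psi> \<Longrightarrow> smooth \<psi>"
  by (simp add: test_function_def)

lemma test_function_pd:
  fixes \<psi> :: "'a::euclidean_space \<Rightarrow> real"
  assumes \<psi>: "test_function \<psi>" and j: "j \<in> Basis"
  shows "test_function (pd j \<psi>)"
proof -
  have "compact (closure {z. \<psi> z \<noteq> 0})" using \<psi> by (simp add: test_function_def)
  then obtain R where R: "\<forall>z\<in>closure {z. \<psi> z \<noteq> 0}. norm z \<le> R"
    by (meson compact_imp_bounded bounded_iff)
  have zero: "\<psi> z = 0" if "norm z > R" for z
  proof (rule ccontr)
    assume "\<psi> z \<noteq> 0"
    then have "z \<in> closure {z. \<psi> z \<noteq> 0}" by (intro subsetD[OF closure_subset]) simp
    then have "norm z \<le> R" using R by (rule bspec[rotated])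
    with that show False by simp
  qed
  have "norm z \<le> R" if "pd j \<psi> z \<noteq> 0" for z
  proof (rule ccontr)
    assume "\<not> norm z \<le> R"
    then have z: "z \<in> - cball 0 R" by auto
    have "((\<lambda>_. 0) has_derivative (\<lambda>_. 0)) (at z)" by simp
    then have "(\<psi> has_derivative (\<lambda>_. 0)) (at z)"
    proof (rule has_derivative_transform_within_open)
      show "open (- cball (0::'a) R)" by (simp add: open_Compl)
      show "0 = \<psi> x" if "x \<in> - cball 0 R" for x
        using zero[of x] that by simp
    qed (rule z)
    then have "pd j \<psi> z = 0" by (rule pd_eqI)
    with that show False by simp
  qed
  then show ?thesis by (rule test_functionI[OF smooth_pd[OF test_function_smooth[OF \<psi>] j]])
qed

definition deriv_family :: "(R3 \<times> R3 \<Rightarrow> real) \<Rightarrow> (R3 \<times> R3) list \<Rightarrow> R3 \<times> R3 \<Rightarrow> real" where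
  "deriv_family u bs = weak_deriv (index_x bs) (index_v bs) u"

lemma norm_le_sum_components: "norm (z :: R3 \<times> R3) \<le> norm (snd z) + norm (fst z)"
  using norm_Pair_le[of "fst z" "snd z"] by (simp add: add.commute)

lemma deriv_family_weak:
  assumes u: "u \<in> weighted_sobolev N" and bs: "set bs \<subseteq> Basis" "length bs \<le> N"
  shows "has_weak_deriv (index_x bs) (index_v bs) u (deriv_family u bs)"
    and "integrable lborel (\<lambda>z. (weighted_deriv N u (index_x bs) (index_v bs) z)\<^sup>2)"
    and "(LINT z|lborel. (weighted_deriv N u (index_x bs) (index_v bs) z)\<^sup>2) \<le> (weighted_norm N u)\<^sup>2"
proof -
  have mem: "(index_x bs, index_v bs) \<in> mi_pairs N"
    using mi_length_index[OF bs(1)] bs(2) by (simp add: mi_pairs_def)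
  then have "\<exists>w. has_weak_deriv (index_x bs) (index_v bs) u w"
    using u unfolding weighted_sobolev_def by auto
  then show "has_weak_deriv (index_x bs) (index_v bs) u (deriv_family u bs)"
    unfolding deriv_family_def weak_deriv_def by (rule someI_ex)
  show "integrable lborel (\<lambda>z. (weighted_deriv N u (index_x bs) (index_v bs) z)\<^sup>2)"
    using u mem unfolding weighted_sobolev_def by auto
  let ?I = "\<lambda>p. LINT z|lborel. (weighted_deriv N u (fst p) (snd p) z)\<^sup>2"
  have "sqrt (?I (index_x bs, index_v bs)) \<le> (\<Sum>p\<in>mi_pairs N. sqrt (?I p))"
    by (rule member_le_sum[OF mem]) (auto simp: finite_mi_pairs)
  then have "sqrt (?I (index_x bs, index_v bs)) \<le> weighted_norm N u"
    unfolding weighted_norm_def by (simp add: case_prod_beta)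
  then have "(sqrt (?I (index_x bs, index_v bs)))\<^sup>2 \<le> (weighted_norm N u)\<^sup>2"
    by (rule power_mono) simp
  then show "(LINT z|lborel. (weighted_deriv N u (index_x bs) (index_v bs) z)\<^sup>2) \<le> (weighted_norm N u)\<^sup>2"
    by simp
qed

text \<open>Young's inequality trades the weighted \<open>L\<^sup>2\<close> norm for a weighted \<open>L\<^sup>1\<close> norm; the loss of
  homogeneity in the norm is harmless since it may grow like a small power of time anyway.\<close>

lemma weak_family_deriv_family:
  obtains K where "K > 0"
    "\<And>u b. u \<in> weighted_sobolev 30 \<Longrightarrow> weighted_norm 30 u \<le> b \<Longrightarrow> weak_family 200 8 (K * (1 + b\<^sup>2)) (deriv_family u)"
proof
  \<comment> \<open>The exponent 7 exceeds the dimension 6 of phase space.\<close>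
  define I where "I = (LINT z::R3 \<times> R3|lborel. 1 / (1 + norm z) ^ 7)"
  have int: "integrable lborel (\<lambda>z::R3 \<times> R3. 1 / (1 + norm z) ^ 7)"
    by (rule integrable_decay) simp
  have I: "I \<ge> 0" unfolding I_def by simp
  show "1 + I > 0" using I by simp
  fix u b assume u: "u \<in> weighted_sobolev 30" and b: "weighted_norm 30 u \<le> b"
  have "weighted_norm 30 u \<ge> 0"
    unfolding weighted_norm_def by (auto intro!: sum_nonneg)
  then have nb: "(weighted_norm 30 u)\<^sup>2 \<le> b\<^sup>2" using b by (rule power_mono[rotated])
  show "weak_family 200 8 ((1 + I) * (1 + b\<^sup>2)) (deriv_family u)"
    unfolding weak_family_def
  proof (intro allI impI, elim conjE)
    fix bs :: "(R3 \<times> R3) list" assume bs: "set bs \<subseteq> Basis" "length bs \<le> 8"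
    let ?w = "deriv_family u bs"
    let ?q = "\<lambda>z. (weighted_deriv 30 u (index_x bs) (index_v bs) z)\<^sup>2"
    have hw: "has_weak_deriv (index_x bs) (index_v bs) u ?w"
      by (rule deriv_family_weak[OF u bs(1)]) (use bs in simp)
    then have meas [measurable]: "?w \<in> borel_measurable borel"
      unfolding has_weak_deriv_def by (blast intro: locally_integrable_measurable)
    have iq: "integrable lborel ?q" "(LINT z|lborel. ?q z) \<le> b\<^sup>2"
      using deriv_family_weak(2,3)[OF u bs(1)] bs nb by fastforce+
    have le: "(1 + norm z) ^ 200 * \<bar>?w z\<bar> \<le> ?q z + 1 / (1 + norm z) ^ 7" for z
    proof -
      \<comment> \<open>At most eight derivatives leave an exponent of at least 300 - 64 = 236. Of
        this 200 is the weight retained; the surplus \<open>r\<close> makes the second factor in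
        Young's inequality square integrable.\<close>
      let ?p = "300 - 8 * length bs" and ?n = "1 + norm z"
      have p: "?p = 200 + (100 - 8 * length bs)" using bs(2) by simp
      define r where "r = 100 - 8 * length bs"
      have r: "r \<ge> 7" using bs(2) unfolding r_def by simp
      have q: "?q z = ((1 + norm (snd z) + norm (fst z)) ^ ?p * \<bar>?w z\<bar>)\<^sup>2"
        unfolding weighted_deriv_def deriv_family_def mi_length_index[OF bs(1)]
        by (simp add: case_prod_beta power_mult_distrib)
      have "?n ^ ?p * \<bar>?w z\<bar> \<le> (1 + norm (snd z) + norm (fst z)) ^ ?p * \<bar>?w z\<bar>"
        using norm_le_sum_components[of z] by (intro mult_right_mono power_mono) auto
      then have "(?n ^ ?p * \<bar>?w z\<bar>)\<^sup>2 \<le> ?q z"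
        unfolding q by (intro power_mono) auto
      moreover have "?n ^ 200 * \<bar>?w z\<bar> = (?n ^ ?p * \<bar>?w z\<bar>) * (1 / ?n ^ r)"
        unfolding p r_def[symmetric] power_add by simp
      moreover have "(1 / ?n ^ r)\<^sup>2 \<le> 1 / ?n ^ 7"
      proof -
        have "?n ^ 7 \<le> ?n ^ (2 * r)" by (rule power_increasing) (use r in auto)
        then have "1 / ?n ^ (2 * r) \<le> 1 / ?n ^ 7" by (intro divide_left_mono mult_pos_pos zero_less_power) (auto intro: add_pos_nonneg)
        then show ?thesis by (simp add: power_divide power_mult[symmetric] mult.commute)
      qed
      moreover have "x * y \<le> x\<^sup>2 + y\<^sup>2" for x y :: real
        using sum_squares_bound[of x y] zero_le_power2[of x] zero_le_power2[of y] by linarith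
      note this[of "?n ^ ?p * \<bar>?w z\<bar>" "1 / ?n ^ r"]
      ultimately show ?thesis by linarith
    qed
    have i2: "integrable lborel (\<lambda>z. ?q z + 1 / (1 + norm z) ^ 7)"
      by (intro Bochner_Integration.integrable_add iq int)
    have i1: "integrable lborel (\<lambda>z. (1 + norm z) ^ 200 * \<bar>?w z\<bar>)"
      by (rule Bochner_Integration.integrable_bound[OF i2]) (auto intro!: AE_I2 order_trans[OF le])
    have "(LINT z|lborel. (1 + norm z) ^ 200 * \<bar>?w z\<bar>) \<le> (LINT z|lborel. ?q z + 1 / (1 + norm z) ^ 7)"
      by (rule integral_mono[OF i1 i2 le])
    also have "\<dots> \<le> b\<^sup>2 + I" using iq int unfolding I_def by simp
    also have "\<dots> \<le> (1 + I) * (1 + b\<^sup>2)" using I by (simp add: algebra_simps)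
    finally have bound: "(LINT z|lborel. (1 + norm z) ^ 200 * \<bar>?w z\<bar>) \<le> (1 + I) * (1 + b\<^sup>2)" .
    \<comment> \<open>Testing the weak derivative along \<open>bs\<close> with
      \<open>pd j \<psi>\<close>, or the one along \<open>bs @ [j]\<close> with
      \<open>\<psi>\<close>, integrates \<open>u\<close> against the same function. Eliminating
      \<open>u\<close> relates the two members; the lengths differ by one, which gives the minus
      sign.\<close>
    have test: "(LINT z|lborel. ?w z * pd j \<psi> z) = - (LINT z|lborel. deriv_family u (bs @ [j]) z * \<psi> z)"
      if j: "j \<in> Basis" and l: "length bs < 8" and \<psi>: "test_function \<psi>" for j \<psi>
    proof -
      have bj: "set (bs @ [j]) \<subseteq> Basis" "length (bs @ [j]) \<le> 30" using bs j by auto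
      note s = test_function_smooth[OF \<psi>]
      have t: "test_function (pd j \<psi>)" by (rule test_function_pd[OF \<psi> j])
      have e1: "mixed_pd (index_x bs) (index_v bs) (pd j \<psi>) = fold pd bs (pd j \<psi>)"
        by (rule mixed_pd_index[OF bs(1) test_function_smooth[OF t]])
      have e2: "mixed_pd (index_x (bs @ [j])) (index_v (bs @ [j])) \<psi> = fold pd (bs @ [j]) \<psi>"
        by (rule mixed_pd_index[OF bj(1) s])
      have "(LINT z|lborel. u z * fold pd bs (pd j \<psi>) z)
          = (-1) ^ length bs * (LINT z|lborel. ?w z * pd j \<psi> z)"
        using hw t unfolding has_weak_deriv_def mi_length_index[OF bs(1)] e1[symmetric] by blast
      moreover have "(LINT z|lborel. u z * fold pd (bs @ [j]) \<psi> z)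
        = (-1) ^ length (bs @ [j]) * (LINT z|lborel. deriv_family u (bs @ [j]) z * \<psi> z)"
        using deriv_family_weak(1)[OF u bj] \<psi>
        unfolding has_weak_deriv_def mi_length_index[OF bj(1)] e2[symmetric] by blast
      moreover have "fold pd bs (pd j \<psi>) = fold pd (bs @ [j]) \<psi>"
        using fold_pd_commute[OF s bs(1) j] by simp
      ultimately have "(-1) ^ length bs * (LINT z|lborel. ?w z * pd j \<psi> z)
        = (-1) ^ length bs * - (LINT z|lborel. deriv_family u (bs @ [j]) z * \<psi> z)"
        by simp
      moreover have "(-1 :: real) ^ length bs \<noteq> 0" by simp
      ultimately show ?thesis unfolding mult_cancel_left by argo
    qed
    show "?w \<in> borel_measurable borel \<and> integrable lborel (\<lambda>z. (1 + norm z) ^ 200 * \<bar>?w z\<bar>) \<and>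
      (LINT z|lborel. (1 + norm z) ^ 200 * \<bar>?w z\<bar>) \<le> (1 + I) * (1 + b\<^sup>2) \<and>
      (\<forall>j\<in>Basis. length bs < 8 \<longrightarrow> (\<forall>\<psi>. test_function \<psi> \<longrightarrow>
        (LINT z|lborel. ?w z * pd j \<psi> z) = - (LINT z|lborel. deriv_family u (bs @ [j]) z * \<psi> z)))"
      by (intro conjI ballI impI allI meas i1 bound) (rule test)
  qed
qed

text \<open>The weak derivative of order zero is a chosen representative that equals
  \<open>u\<close> only almost everywhere; the identity is recorded in the tested form in which it
  is used.\<close>

lemma deriv_family_Nil:
  assumes "u \<in> weighted_sobolev N" "test_function \<psi>"
  shows "(LINT z|lborel. u z * \<psi> z) = (LINT z|lborel. deriv_family u [] z * \<psi> z)"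
proof -
  have "has_weak_deriv (index_x []) (index_v []) u (deriv_family u [])"
    by (rule deriv_family_weak[OF assms(1)]) auto
  then show ?thesis
    using assms(2) mixed_pd_index[of "[]" \<psi>] test_function_smooth[OF assms(2)] mi_length_index[of "[]"]
    unfolding has_weak_deriv_def by fastforce
qed

section \<open>A pointwise Sobolev inequality\<close>

lemma pd_invariant:
  assumes "\<And>s. F (z + s *\<^sub>R b) = F z" "F differentiable (at z)"
  shows "pd b F z = 0"
proof -
  have "((\<lambda>s. F (z + s *\<^sub>R b)) has_real_derivative pd b F (z + 0 *\<^sub>R b)) (at 0)"
    by (rule has_real_derivative_line) (use assms(2) in simp)
  then have "((\<lambda>_. F z) has_real_derivative pd b F z) (at 0)" by (simp add: assms(1))
  then show ?thesis using DERIV_unique[OF _ DERIV_const] by blast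
qed

lemma test_function_bounded:
  assumes "test_function (\<psi> :: 'a::euclidean_space \<Rightarrow> real)"
  obtains C where "C \<ge> 0" "\<And>z. \<bar>\<psi> z\<bar> \<le> C"
proof -
  let ?K = "closure {z. \<psi> z \<noteq> 0}"
  have "compact (\<psi> ` ?K)"
    using assms smooth_continuous[OF test_function_smooth[OF assms]]
    by (intro compact_continuous_image) (auto simp: test_function_def)
  then obtain B where B: "\<forall>y\<in>\<psi> ` ?K. norm y \<le> B"
    by (meson compact_imp_bounded bounded_iff)
  have "\<bar>\<psi> z\<bar> \<le> max 0 B" for z
  proof (cases "\<psi> z = 0")
    case False
    then have "z \<in> ?K" by (intro subsetD[OF closure_subset]) simp
    then show ?thesis using B by fastforce
  qed simp
  then show thesis using that[of "max 0 B"] by simp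
qed

lemma weak_family_test_integrable:
  assumes W: "weak_family m L B W" "set bs \<subseteq> Basis" "length bs \<le> L" and \<psi>: "test_function \<psi>"
  shows "integrable lborel (\<lambda>z. W bs z * \<psi> z)"
proof -
  obtain C where C: "C \<ge> 0" "\<And>z. \<bar>\<psi> z\<bar> \<le> C" using test_function_bounded[OF \<psi>] by blast
  have "\<bar>\<psi> z\<bar> \<le> C * (1 + norm z) ^ m" for z
  proof -
    have "1 \<le> (1 + norm z) ^ m" by (simp add: one_le_power)
    from mult_left_mono[OF this C(1)] show ?thesis using C(2)[of z] by simp
  qed
  then show ?thesis
    by (rule weak_family_integrable_mult(1)[OF W smooth_measurable[OF test_function_smooth[OF \<psi>]] C(1)])
qed

definition mollifier :: "real \<Rightarrow> 'a::euclidean_space \<Rightarrow> 'a \<Rightarrow> 'a \<Rightarrow> real" where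
  "mollifier \<epsilon> z\<^sub>0 b z = bump ((z \<bullet> b - z\<^sub>0 \<bullet> b) / \<epsilon>) / \<epsilon>"

text \<open>A primitive along \<open>b\<close> of the difference of the mollifiers at scales
  \<open>\<epsilon>\<close> and 1. A single step does not vanish far to the right; subtracting the
  step at scale 1 makes the difference compactly supported in this coordinate, so that it may enter
  a test function.\<close>

definition step_difference :: "real \<Rightarrow> 'a::euclidean_space \<Rightarrow> 'a \<Rightarrow> 'a \<Rightarrow> real" where
  "step_difference \<epsilon> z\<^sub>0 b z = step ((z \<bullet> b - z\<^sub>0 \<bullet> b) / \<epsilon>) - step ((z \<bullet> b - z\<^sub>0 \<bullet> b) / 1)"

lemma smooth_cmult: "smooth u \<Longrightarrow> smooth (\<lambda>z. c * u z)"
  by (rule smooth_mult[OF smooth_const])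

lemma smooth_diff: "smooth u \<Longrightarrow> smooth w \<Longrightarrow> smooth (\<lambda>z. u z - w z)"
  using smooth_add[OF _ smooth_cmult[of w "-1"], of u] by simp

lemma smooth_mollifier: "smooth (mollifier \<epsilon> z\<^sub>0 b)"
  unfolding mollifier_def[abs_def]
  using smooth_cmult[OF smooth_coordinate_compose[OF smooth_bump, of b "z\<^sub>0 \<bullet> b" \<epsilon>], of "1 / \<epsilon>"] by simp

lemma smooth_step_difference: "smooth (step_difference \<epsilon> z\<^sub>0 b)"
  unfolding step_difference_def[abs_def]
  by (rule smooth_diff) (rule smooth_coordinate_compose[OF smooth_step])+

lemma pd_diff:
  assumes "u differentiable (at z)" "w differentiable (at z)"
  shows "pd b (\<lambda>z. u z - w z) z = pd b u z - pd b w z"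
  by (rule pd_eqI) (intro has_derivative_diff differentiable_has_derivative_pd assms)

lemma pd_step_difference:
  assumes "b \<in> Basis" "\<epsilon> > 0"
  shows "pd b (step_difference \<epsilon> z\<^sub>0 b) z = mollifier \<epsilon> z\<^sub>0 b z - mollifier 1 z\<^sub>0 b z"
proof -
  have 1: "pd b (\<lambda>z. step ((z \<bullet> b - z\<^sub>0 \<bullet> b) / R)) z = mollifier R z\<^sub>0 b z" if "R > 0" for R
    using that assms(1)
    by (simp add: pd_coordinate_compose[OF smooth_differentiable[OF smooth_step]] bump_def mollifier_def)
  have d: "(\<lambda>z::'a. step ((z \<bullet> b - z\<^sub>0 \<bullet> b) / R)) differentiable (at z)" for R
    by (rule smooth_differentiable[OF smooth_coordinate_compose[OF smooth_step]])
  show ?thesis unfolding step_difference_def[abs_def] pd_diff[OF d d]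
    by (simp only: 1[OF assms(2)] 1[OF zero_less_one])
qed

lemma mollifier_support: "\<epsilon> > 0 \<Longrightarrow> mollifier \<epsilon> z\<^sub>0 b z \<noteq> 0 \<Longrightarrow> \<bar>z \<bullet> b - z\<^sub>0 \<bullet> b\<bar> \<le> \<epsilon>"
  using bump_eq_0[of "(z \<bullet> b - z\<^sub>0 \<bullet> b) / \<epsilon>"]
  by (cases "\<bar>z \<bullet> b - z\<^sub>0 \<bullet> b\<bar> \<le> \<epsilon>") (auto simp: mollifier_def)

lemma step_difference_support:
  assumes "0 < \<epsilon>" "\<epsilon> \<le> 1" "step_difference \<epsilon> z\<^sub>0 b z \<noteq> 0"
  shows "\<bar>z \<bullet> b - z\<^sub>0 \<bullet> b\<bar> \<le> 1"
proof (rule ccontr)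
  let ?s = "z \<bullet> b - z\<^sub>0 \<bullet> b"
  assume "\<not> \<bar>?s\<bar> \<le> 1"
  then consider "?s > 1" | "?s < -1" by linarith
  then show False
  proof cases
    case 1
    then have "?s / \<epsilon> \<ge> 1" using assms by (simp add: field_simps)
    with 1 show False using assms(3) by (simp add: step_difference_def step_eq_1)
  next
    case 2
    then have "?s / \<epsilon> \<le> -1" using assms by (simp add: field_simps)
    with 2 show False using assms(3) by (simp add: step_difference_def step_eq_0)
  qed
qed

lemma abs_step_difference_le: "\<bar>step_difference \<epsilon> z\<^sub>0 b z\<bar> \<le> 1"
  unfolding step_difference_def
  using step_nonneg[of "(z \<bullet> b - z\<^sub>0 \<bullet> b) / \<epsilon>"] step_nonneg[of "(z \<bullet> b - z\<^sub>0 \<bullet> b) / 1"]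
    step_le_1[of "(z \<bullet> b - z\<^sub>0 \<bullet> b) / \<epsilon>"] step_le_1[of "(z \<bullet> b - z\<^sub>0 \<bullet> b) / 1"]
  unfolding abs_le_iff by linarith

lemma coordinate_shift_invariant:
  assumes "b \<in> Basis" "c \<in> Basis" "b \<noteq> c"
  shows "mollifier \<epsilon> z\<^sub>0 b (z + s *\<^sub>R c) = mollifier \<epsilon> z\<^sub>0 b z"
    "step_difference \<epsilon> z\<^sub>0 b (z + s *\<^sub>R c) = step_difference \<epsilon> z\<^sub>0 b z"
  using assms by (simp_all add: mollifier_def step_difference_def inner_add_left inner_Basis)

lemma cube_norm_le:
  fixes z z0 :: "'a::euclidean_space" and r :: real
  assumes "\<And>b. b \<in> Basis \<Longrightarrow> \<bar>z \<bullet> b - z0 \<bullet> b\<bar> \<le> r"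
  shows "norm (z - z0) \<le> DIM('a) * r"
proof -
  have "norm (z - z0) \<le> (\<Sum>b\<in>Basis. \<bar>(z - z0) \<bullet> b\<bar>)" by (rule norm_le_l1)
  also have "\<dots> \<le> (\<Sum>b\<in>(Basis::'a set). r)"
    by (rule sum_mono) (use assms in \<open>simp add: inner_diff_left\<close>)
  finally show ?thesis by simp
qed

lemma cube_test_function:
  fixes \<psi> :: "'a::euclidean_space \<Rightarrow> real"
  assumes "smooth \<psi>" and supp: "\<And>z b. \<psi> z \<noteq> 0 \<Longrightarrow> b \<in> Basis \<Longrightarrow> \<bar>z \<bullet> b - z0 \<bullet> b\<bar> \<le> 1"
  shows "test_function \<psi>"
proof (rule test_functionI[OF assms(1)])
  fix z assume "\<psi> z \<noteq> 0"
  then have "norm (z - z0) \<le> real DIM('a) * 1" by (intro cube_norm_le supp)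
  then show "norm z \<le> DIM('a) + norm z0" using norm_triangle_sub[of z z0] by simp
qed

text \<open>Each factor \<open>\<eta>\<^sub>\<epsilon>\<close> approximating the Dirac mass is \<open>\<partial>\<Phi> + \<eta>\<^sub>1\<close> with \<open>|\<Phi>| \<le> 1\<close> supported in the
  unit interval, so pairing a function with the product of all of them costs one derivative per
  coordinate but no power of \<open>\<epsilon>\<close>.\<close>

lemma mollified_pairing_bound:
  fixes W :: "'a::euclidean_space list \<Rightarrow> 'a \<Rightarrow> real"
  assumes W: "weak_family m L B W" and \<epsilon>: "0 < \<epsilon>" "\<epsilon> \<le> 1"
    and C: "C \<ge> 1" "\<And>s. bump s \<le> C"
  shows "distinct l \<Longrightarrow> set l \<subseteq> Basis \<Longrightarrow> set bs \<subseteq> Basis \<Longrightarrow> length bs + length l \<le> L \<Longrightarrow> smooth T \<Longrightarrow>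
    M \<ge> 0 \<Longrightarrow> (\<And>z. \<bar>T z\<bar> \<le> M) \<Longrightarrow>
    (\<And>z b. T z \<noteq> 0 \<Longrightarrow> b \<in> Basis - set l \<Longrightarrow> \<bar>z \<bullet> b - z\<^sub>0 \<bullet> b\<bar> \<le> 1) \<Longrightarrow>
    (\<And>z s b. b \<in> set l \<Longrightarrow> T (z + s *\<^sub>R b) = T z) \<Longrightarrow>
    \<bar>LINT z|lborel. W bs z * ((\<Prod>b\<in>set l. mollifier \<epsilon> z\<^sub>0 b z) * T z)\<bar>
      \<le> M * (1 + C) ^ length l * ((1 + real DIM('a)) ^ m / (1 + norm z\<^sub>0) ^ m * B)"
proof (induction l arbitrary: bs T M)
  case Nil
  let ?D = "real DIM('a)"
  \<comment> \<open>On the unit cube around the base point, 1 plus the norm of the base point is at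
    most (1 + DIM) times 1 + |z|. So the weight at \<open>z\<close> is traded for a factor at the
    base point.\<close>
  let ?c = "M * ((1 + ?D) ^ m / (1 + norm z\<^sub>0) ^ m)"
  have T: "test_function T" by (rule cube_test_function[OF Nil.prems(5)]) (use Nil.prems(8) in simp)
  have "\<bar>LINT z|lborel. W bs z * T z\<bar> \<le> ?c * B"
  proof (rule weak_family_integrable_mult(2)[OF W])
    show "set bs \<subseteq> Basis" "length bs \<le> L" using Nil.prems by auto
    show "T \<in> borel_measurable borel" by (rule smooth_measurable[OF Nil.prems(5)])
    show "?c \<ge> 0" using Nil.prems(6) by (auto intro!: mult_nonneg_nonneg divide_nonneg_nonneg)
    show "\<bar>T z\<bar> \<le> ?c * (1 + norm z) ^ m" for z
    proof (cases "T z = 0")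
      case True
      then show ?thesis using Nil.prems(6) by simp
    next
      case False
      then have "norm (z - z\<^sub>0) \<le> ?D * 1" by (intro cube_norm_le Nil.prems(8)) auto
      then have "norm z\<^sub>0 \<le> ?D + norm z"
        using norm_triangle_sub[of z\<^sub>0 z] by (simp add: norm_minus_commute)
      moreover have "0 \<le> ?D * norm z" by simp
      moreover have "(1 + ?D) * (1 + norm z) = 1 + ?D + norm z + ?D * norm z" by (simp add: algebra_simps)
      ultimately have "1 + norm z\<^sub>0 \<le> (1 + ?D) * (1 + norm z)" by linarith
      then have "(1 + norm z\<^sub>0) ^ m \<le> ((1 + ?D) * (1 + norm z)) ^ m"
        by (rule power_mono) simp
      then have "1 \<le> (1 + ?D) ^ m / (1 + norm z\<^sub>0) ^ m * (1 + norm z) ^ m"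
        by (simp add: power_mult_distrib divide_simps add_pos_nonneg)
      from mult_left_mono[OF this Nil.prems(6)] show ?thesis
        using Nil.prems(7)[of z] by (simp add: mult_ac)
    qed
  qed
  then show ?case by (simp add: mult_ac)
next
  \<comment> \<open>\<open>T\<close> holds the factors already treated. Both \<open>T\<close> and
    the mollifiers still pending are constant along \<open>b\<close>, so the derivative in
    \<open>b\<close> meets only \<open>step_difference\<close>; what remains carries the mollifier
    at unit scale.\<close>
  case (Cons b l)
  let ?P = "\<lambda>z. \<Prod>b\<in>set l. mollifier \<epsilon> z\<^sub>0 b z"
  let ?\<Phi> = "step_difference \<epsilon> z\<^sub>0 b" and ?\<kappa> = "mollifier 1 z\<^sub>0 b" and ?\<eta> = "mollifier \<epsilon> z\<^sub>0 b"
  let ?A = "(1 + real DIM('a)) ^ m / (1 + norm z\<^sub>0) ^ m * B"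
  have b: "b \<in> Basis" "b \<notin> set l" and l: "distinct l" "set l \<subseteq> Basis" using Cons.prems by auto
  have bs: "set bs \<subseteq> Basis" "length bs < L" "set (bs @ [b]) \<subseteq> Basis" "length (bs @ [b]) + length l \<le> L"
    using Cons.prems b by auto
  note sT = Cons.prems(5)
  have sP: "smooth ?P" by (intro smooth_prod smooth_mollifier)
  have invP: "?P (z + s *\<^sub>R b) = ?P z" for z s
    by (rule prod.cong) (use b l in \<open>auto intro!: coordinate_shift_invariant\<close>)
  have suppP: "\<bar>z \<bullet> c - z\<^sub>0 \<bullet> c\<bar> \<le> 1" if "?P z \<noteq> 0" "c \<in> set l" for z c
  proof -
    have "mollifier \<epsilon> z\<^sub>0 c z \<noteq> 0" using that by auto
    then show ?thesis using mollifier_support[OF \<epsilon>(1)] \<epsilon>(2) by fastforce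
  qed
  have t1: "test_function (\<lambda>z. ?\<Phi> z * (?P z * T z))"
  proof (rule cube_test_function)
    show "smooth (\<lambda>z. ?\<Phi> z * (?P z * T z))" by (intro smooth_mult smooth_step_difference sP sT)
    show "\<bar>z \<bullet> c - z\<^sub>0 \<bullet> c\<bar> \<le> 1" if nz: "?\<Phi> z * (?P z * T z) \<noteq> 0" and c: "c \<in> Basis" for z c
    proof -
      have nz': "?\<Phi> z \<noteq> 0" "?P z \<noteq> 0" "T z \<noteq> 0" using nz by auto
      show ?thesis
        using step_difference_support[OF \<epsilon> nz'(1)] suppP[OF nz'(2), of c] Cons.prems(8)[OF nz'(3), of c] c
        by (cases "c = b"; cases "c \<in> set l") auto
    qed
  qed
  have t2: "test_function (\<lambda>z. ?\<kappa> z * (?P z * T z))"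
  proof (rule cube_test_function)
    show "smooth (\<lambda>z. ?\<kappa> z * (?P z * T z))" by (intro smooth_mult smooth_mollifier sP sT)
    show "\<bar>z \<bullet> c - z\<^sub>0 \<bullet> c\<bar> \<le> 1" if nz: "?\<kappa> z * (?P z * T z) \<noteq> 0" and c: "c \<in> Basis" for z c
    proof -
      have nz': "?\<kappa> z \<noteq> 0" "?P z \<noteq> 0" "T z \<noteq> 0" using nz by auto
      show ?thesis
        using mollifier_support[OF _ nz'(1)] suppP[OF nz'(2), of c] Cons.prems(8)[OF nz'(3), of c] c
        by (cases "c = b"; cases "c \<in> set l") auto
    qed
  qed
  have pd: "pd b (\<lambda>z. ?\<Phi> z * (?P z * T z)) z = (?\<eta> z - ?\<kappa> z) * (?P z * T z)" for z
  proof -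
    have sPT: "smooth (\<lambda>z. ?P z * T z)" by (intro smooth_mult sP sT)
    have "pd b (\<lambda>z. ?P z * T z) z = 0"
      by (rule pd_invariant[OF _ smooth_differentiable[OF sPT]]) (use invP Cons.prems(9)[of b] in simp)
    then show ?thesis
      using pd_mult[OF smooth_differentiable[OF smooth_step_difference] smooth_differentiable[OF sPT],
          of b \<epsilon> z\<^sub>0 b z] pd_step_difference[OF b(1) \<epsilon>(1)] by simp
  qed
  have i1: "integrable lborel (\<lambda>z. W bs z * pd b (\<lambda>z. ?\<Phi> z * (?P z * T z)) z)"
    by (rule weak_family_test_integrable[OF W _ _ test_function_pd[OF t1 b(1)]]) (use bs in auto)
  have i2: "integrable lborel (\<lambda>z. W bs z * (?\<kappa> z * (?P z * T z)))"
    by (rule weak_family_test_integrable[OF W _ _ t2]) (use bs in auto)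
  have "(LINT z|lborel. W bs z * ((\<Prod>b\<in>set (b # l). mollifier \<epsilon> z\<^sub>0 b z) * T z))
    = (LINT z|lborel. W bs z * pd b (\<lambda>z. ?\<Phi> z * (?P z * T z)) z + W bs z * (?\<kappa> z * (?P z * T z)))"
    unfolding pd using b by (intro Bochner_Integration.integral_cong) (simp_all add: algebra_simps)
  also have "\<dots> = (LINT z|lborel. W bs z * pd b (\<lambda>z. ?\<Phi> z * (?P z * T z)) z)
      + (LINT z|lborel. W bs z * (?\<kappa> z * (?P z * T z)))"
    by (rule Bochner_Integration.integral_add[OF i1 i2])
  also have "(LINT z|lborel. W bs z * pd b (\<lambda>z. ?\<Phi> z * (?P z * T z)) z)
      = - (LINT z|lborel. W (bs @ [b]) z * (?\<Phi> z * (?P z * T z)))"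
    by (rule weak_family_test[OF W bs(1) _ b(1) bs(2) t1]) (use bs in simp)
  finally have eq: "(LINT z|lborel. W bs z * ((\<Prod>b\<in>set (b # l). mollifier \<epsilon> z\<^sub>0 b z) * T z))
    = - (LINT z|lborel. W (bs @ [b]) z * (?P z * (?\<Phi> z * T z))) + (LINT z|lborel. W bs z * (?P z * (?\<kappa> z * T z)))"
    by (simp add: mult_ac)
  have 1: "\<bar>LINT z|lborel. W (bs @ [b]) z * (?P z * (?\<Phi> z * T z))\<bar> \<le> M * (1 + C) ^ length l * ?A"
  proof (rule Cons.IH[OF l bs(3,4)])
    show "smooth (\<lambda>z. ?\<Phi> z * T z)" by (intro smooth_mult smooth_step_difference sT)
    show "M \<ge> 0" by fact
    show "\<bar>?\<Phi> z * T z\<bar> \<le> M" for z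
      using mult_mono[OF abs_step_difference_le[of \<epsilon> z\<^sub>0 b z] Cons.prems(7)[of z]] by (simp add: abs_mult)
    show "\<bar>z \<bullet> c - z\<^sub>0 \<bullet> c\<bar> \<le> 1" if "?\<Phi> z * T z \<noteq> 0" "c \<in> Basis - set l" for z c
      using that step_difference_support[OF \<epsilon>, of z\<^sub>0 b z] Cons.prems(8)[of z c] by (cases "c = b") auto
    show "?\<Phi> (z + s *\<^sub>R c) * T (z + s *\<^sub>R c) = ?\<Phi> z * T z" if "c \<in> set l" for z s c
    proof -
      have c: "c \<in> Basis" "b \<noteq> c" using that b l by auto
      show ?thesis
        unfolding coordinate_shift_invariant(2)[OF b(1) c] using that Cons.prems(9)[of c z s] by simp
    qed
  qed
  have 2: "\<bar>LINT z|lborel. W bs z * (?P z * (?\<kappa> z * T z))\<bar> \<le> (C * M) * (1 + C) ^ length l * ?A"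
  proof (rule Cons.IH[OF l bs(1)])
    show "length bs + length l \<le> L" using bs by simp
    show "smooth (\<lambda>z. ?\<kappa> z * T z)" by (intro smooth_mult smooth_mollifier sT)
    show "C * M \<ge> 0" using C(1) Cons.prems(6) by simp
    have \<kappa>: "\<bar>?\<kappa> z\<bar> \<le> C" for z using C(2) bump_nonneg by (simp add: mollifier_def)
    show "\<bar>?\<kappa> z * T z\<bar> \<le> C * M" for z
      using mult_mono[OF \<kappa>[of z] Cons.prems(7)[of z]] C(1) by (simp add: abs_mult)
    show "\<bar>z \<bullet> c - z\<^sub>0 \<bullet> c\<bar> \<le> 1" if "?\<kappa> z * T z \<noteq> 0" "c \<in> Basis - set l" for z c
      using that mollifier_support[of 1 z\<^sub>0 b z] Cons.prems(8)[of z c] by (cases "c = b") auto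
    show "?\<kappa> (z + s *\<^sub>R c) * T (z + s *\<^sub>R c) = ?\<kappa> z * T z" if "c \<in> set l" for z s c
    proof -
      have c: "c \<in> Basis" "b \<noteq> c" using that b l by auto
      show ?thesis
        unfolding coordinate_shift_invariant(1)[OF b(1) c] using that Cons.prems(9)[of c z s] by simp
    qed
  qed
  \<comment> \<open>Each coordinate costs 1 for the term integrated by parts and \<open>C\<close>,
    the height of the unit bump, for the other.\<close>
  have "M * (1 + C) ^ length (b # l) * ?A = M * (1 + C) ^ length l * ?A + (C * M) * (1 + C) ^ length l * ?A"
    by (simp add: algebra_simps)
  then show ?case unfolding eq using 1 2 by linarith
qed

lemma nn_integral_mollifier_line:
  assumes "\<epsilon> > 0"
  shows "(\<integral>\<^sup>+x. ennreal (bump ((x - c) / \<epsilon>) / \<epsilon>) \<partial>lborel) = 1"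
proof -
  have cont: "continuous_on UNIV (\<lambda>x. bump ((x - c) / \<epsilon>) / \<epsilon>)"
    using assms by (intro continuous_intros continuous_on_compose2[OF bump_continuous[of UNIV]]) auto
  have "(\<integral>\<^sup>+x. ennreal (bump ((x - c) / \<epsilon>) / \<epsilon>) \<partial>lborel)
    = (\<integral>\<^sup>+x. ennreal (bump ((x - c) / \<epsilon>) / \<epsilon>) * indicator {c - \<epsilon>..c + \<epsilon>} x \<partial>lborel)"
  proof (rule nn_integral_cong)
    fix x show "ennreal (bump ((x - c) / \<epsilon>) / \<epsilon>) = ennreal (bump ((x - c) / \<epsilon>) / \<epsilon>) * indicator {c - \<epsilon>..c + \<epsilon>} x"
    proof (cases "x \<in> {c - \<epsilon>..c + \<epsilon>}")
      case False
      then have "\<bar>(x - c) / \<epsilon>\<bar> > 1" using assms by (auto simp: abs_if field_simps)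
      then show ?thesis by (simp add: bump_eq_0)
    qed simp
  qed
  also have "\<dots> = ennreal (step ((c + \<epsilon> - c) / \<epsilon>) - step ((c - \<epsilon> - c) / \<epsilon>))"
  proof (rule nn_integral_FTC_Icc)
    show "(\<lambda>x. bump ((x - c) / \<epsilon>) / \<epsilon>) \<in> borel_measurable borel"
      by (rule borel_measurable_continuous_onI[OF cont])
    show "((\<lambda>x. step ((x - c) / \<epsilon>)) has_real_derivative bump ((x - c) / \<epsilon>) / \<epsilon>) (at x)" for x
    proof -
      have "((\<lambda>x. (x - c) / \<epsilon>) has_real_derivative 1 / \<epsilon>) (at x)"
        using assms by (auto intro!: derivative_eq_intros)
      from DERIV_chain2[OF step_deriv this] show ?thesis by simp
    qed
  qed (use assms bump_nonneg in auto)
  also have "\<dots> = 1" using assms by (simp add: step_eq_0 step_eq_1)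
  finally show ?thesis .
qed

lemma integral_mollifier:
  fixes z\<^sub>0 :: "'a::euclidean_space"
  assumes "\<epsilon> > 0"
  shows "integrable lborel (\<lambda>z. \<Prod>b\<in>Basis. mollifier \<epsilon> z\<^sub>0 b z)"
    and "(LINT z|lborel. (\<Prod>b\<in>Basis. mollifier \<epsilon> z\<^sub>0 b z)) = 1"
proof -
  have nn: "mollifier \<epsilon> z\<^sub>0 b z \<ge> 0" for b z using assms bump_nonneg by (simp add: mollifier_def)
  have sm: "smooth (\<lambda>z. \<Prod>b\<in>Basis. mollifier \<epsilon> z\<^sub>0 b z)" by (intro smooth_prod smooth_mollifier)
  have bm: "(\<lambda>x. ennreal (bump ((x - c) / \<epsilon>) / \<epsilon>)) \<in> borel_measurable borel" for c
    using assms
    by (intro measurable_compose[OF borel_measurable_continuous_onI measurable_ennreal] continuous_intros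
        continuous_on_compose2[OF bump_continuous[of UNIV]]) auto
  have "(\<integral>\<^sup>+z. ennreal (\<Prod>b\<in>Basis. mollifier \<epsilon> z\<^sub>0 b z) \<partial>lborel)
    = (\<integral>\<^sup>+z. (\<Prod>b\<in>Basis. ennreal (bump ((z \<bullet> b - z\<^sub>0 \<bullet> b) / \<epsilon>) / \<epsilon>)) \<partial>lborel)"
    by (intro nn_integral_cong) (simp add: prod_ennreal nn mollifier_def[symmetric])
  also have "\<dots> = (\<Prod>b\<in>(Basis::'a set). \<integral>\<^sup>+x. ennreal (bump ((x - z\<^sub>0 \<bullet> b) / \<epsilon>) / \<epsilon>) \<partial>lborel)"
    by (rule nn_integral_lborel_prod[of "\<lambda>b x. ennreal (bump ((x - z\<^sub>0 \<bullet> b) / \<epsilon>) / \<epsilon>)"]) (auto intro: bm)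
  also have "\<dots> = 1" by (simp add: nn_integral_mollifier_line[OF assms])
  finally have eq: "(\<integral>\<^sup>+z. ennreal (\<Prod>b\<in>Basis. mollifier \<epsilon> z\<^sub>0 b z) \<partial>lborel) = 1" .
  show "integrable lborel (\<lambda>z. \<Prod>b\<in>Basis. mollifier \<epsilon> z\<^sub>0 b z)"
    by (rule integrableI_nonneg) (use smooth_measurable[OF sm] eq nn in \<open>auto intro!: AE_I2 prod_nonneg\<close>)
  show "(LINT z|lborel. (\<Prod>b\<in>Basis. mollifier \<epsilon> z\<^sub>0 b z)) = 1"
    by (subst integral_eq_nn_integral) (use smooth_measurable[OF sm] eq nn in \<open>auto intro!: AE_I2 prod_nonneg\<close>)
qed

text \<open>Pair \<open>u\<close> with a product mollifier: the pairing is bounded independently of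
  the width by \<open>mollified_pairing_bound\<close>, and continuity makes it tend to the value at
  the point. The price is one L^1 derivative per coordinate, hence DIM further entries in the list.
  The function \<open>u\<close> is tied to the family only through test functions.\<close>

lemma sobolev_pointwise:
  obtains K where "K \<ge> 0"
    "\<And>W B bs u z. weak_family m L B W \<Longrightarrow> set bs \<subseteq> Basis \<Longrightarrow> length bs + DIM('a) \<le> L \<Longrightarrow>
      continuous_on UNIV u \<Longrightarrow>
      (\<And>\<psi>. test_function \<psi> \<Longrightarrow> (LINT z|lborel. u z * \<psi> z) = (LINT z|lborel. W bs z * \<psi> z)) \<Longrightarrow>
      \<bar>u z\<bar> \<le> K * B / (1 + norm (z::'a::euclidean_space)) ^ m"
proof -
  obtain C where C: "C \<ge> 1" "\<And>s. bump s \<le> C" using bump_bounded by blast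
  define K where "K = (1 + C) ^ DIM('a) * (1 + real DIM('a)) ^ m"
  have "\<bar>u z\<^sub>0\<bar> \<le> K * B / (1 + norm z\<^sub>0) ^ m"
    if W: "weak_family m L B W" and bs: "set bs \<subseteq> Basis" "length bs + DIM('a) \<le> L"
      and u: "continuous_on UNIV u"
      and eq: "\<And>\<psi>. test_function \<psi> \<Longrightarrow> (LINT z|lborel. u z * \<psi> z) = (LINT z|lborel. W bs z * \<psi> z)"
    for W B bs u and z\<^sub>0 :: 'a
  proof (rule field_le_epsilon)
    fix \<omega> :: real assume \<omega>: "\<omega> > 0"
    have "isCont u z\<^sub>0" using u by (simp add: continuous_on_eq_continuous_at)
    then obtain r where r: "r > 0" "\<And>z. dist z z\<^sub>0 < r \<Longrightarrow> dist (u z) (u z\<^sub>0) < \<omega>"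
      using \<omega> unfolding continuous_at_eps_delta by blast
    \<comment> \<open>The mollifier lives in a cube of half-side \<open>\<epsilon>\<close>, on which
      the distance to the centre is at most DIM times \<open>\<epsilon>\<close>, hence below
      \<open>r\<close>.\<close>
    define \<epsilon> where "\<epsilon> = min 1 (r / (2 * real DIM('a)))"
    have \<epsilon>: "0 < \<epsilon>" "\<epsilon> \<le> 1" "DIM('a) * \<epsilon> < r"
      using r(1) unfolding \<epsilon>_def by (auto simp: min_def field_simps)
    let ?\<eta> = "\<lambda>z. \<Prod>b\<in>Basis. mollifier \<epsilon> z\<^sub>0 b z"
    have nn: "?\<eta> z \<ge> 0" for z using \<epsilon> bump_nonneg by (auto intro!: prod_nonneg simp: mollifier_def)
    have supp: "\<bar>z \<bullet> b - z\<^sub>0 \<bullet> b\<bar> \<le> \<epsilon>" if "?\<eta> z \<noteq> 0" "b \<in> Basis" for z b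
      using that mollifier_support[OF \<epsilon>(1)] by auto
    have sm: "smooth ?\<eta>" by (intro smooth_prod smooth_mollifier)
    have t: "test_function ?\<eta>"
      by (rule cube_test_function[OF sm, of z\<^sub>0]) (rule order_trans[OF supp \<epsilon>(2)])
    obtain l :: "'a list" where l: "distinct l" "set l = Basis"
      using finite_distinct_list[OF finite_Basis] by blast
    have len: "length l = DIM('a)" using distinct_card[OF l(1)] l(2) by simp
    have "\<bar>LINT z|lborel. W bs z * ((\<Prod>b\<in>set l. mollifier \<epsilon> z\<^sub>0 b z) * 1)\<bar> \<le> 1 * (1 + C) ^ length l * ((1 + real DIM('a)) ^ m / (1 + norm z\<^sub>0) ^ m * B)"
      by (rule mollified_pairing_bound[OF W \<epsilon>(1,2) C l(1) _ bs(1)]) (use l len bs in auto)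
    then have A: "\<bar>LINT z|lborel. u z * ?\<eta> z\<bar> \<le> K * B / (1 + norm z\<^sub>0) ^ m"
      unfolding l(2) len using eq[OF t] by (simp add: K_def mult_ac)
    have close: "\<bar>(u z - u z\<^sub>0) * ?\<eta> z\<bar> \<le> \<omega> * ?\<eta> z" for z
    proof (cases "?\<eta> z = 0")
      case False
      then have "norm (z - z\<^sub>0) \<le> DIM('a) * \<epsilon>" by (intro cube_norm_le supp)
      then have "dist z z\<^sub>0 < r" using \<epsilon>(3) by (simp add: dist_norm)
      then have "\<bar>u z - u z\<^sub>0\<bar> \<le> \<omega>" using r(2)[of z] by (simp add: dist_real_def)
      then show ?thesis using mult_right_mono[OF _ nn[of z]] nn[of z] by (simp add: abs_mult)
    next
      case True
      show ?thesis unfolding True by simp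
    qed
    have um: "u \<in> borel_measurable borel" by (rule borel_measurable_continuous_onI[OF u])
    have i: "integrable lborel (\<lambda>z. \<omega> * ?\<eta> z)" "integrable lborel (\<lambda>z. u z\<^sub>0 * ?\<eta> z)"
      by (intro integrable_mult_right integral_mollifier(1) \<epsilon>(1))+
    have id: "integrable lborel (\<lambda>z. (u z - u z\<^sub>0) * ?\<eta> z)"
      by (rule Bochner_Integration.integrable_bound[OF i(1)])
        (use um smooth_measurable[OF sm] order_trans[OF close abs_ge_self] in \<open>auto intro!: AE_I2\<close>)
    have "\<bar>LINT z|lborel. (u z - u z\<^sub>0) * ?\<eta> z\<bar> \<le> (LINT z|lborel. \<bar>(u z - u z\<^sub>0) * ?\<eta> z\<bar>)"
      using integral_norm_bound[of lborel "\<lambda>z. (u z - u z\<^sub>0) * ?\<eta> z"] by simp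
    also have "\<dots> \<le> (LINT z|lborel. \<omega> * ?\<eta> z)"
      by (rule integral_mono[OF integrable_abs[OF id] i(1) close])
    also have "\<dots> = \<omega>" using integral_mollifier(2)[OF \<epsilon>(1), of z\<^sub>0] by simp
    finally have D: "\<bar>LINT z|lborel. (u z - u z\<^sub>0) * ?\<eta> z\<bar> \<le> \<omega>" .
    have "(LINT z|lborel. u z * ?\<eta> z) = (LINT z|lborel. (u z - u z\<^sub>0) * ?\<eta> z + u z\<^sub>0 * ?\<eta> z)"
      by (simp add: algebra_simps)
    also have "\<dots> = (LINT z|lborel. (u z - u z\<^sub>0) * ?\<eta> z) + u z\<^sub>0"
      using integral_mollifier(2)[OF \<epsilon>(1), of z\<^sub>0] by (subst Bochner_Integration.integral_add[OF id i(2)]) simp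
    finally show "\<bar>u z\<^sub>0\<bar> \<le> K * B / (1 + norm z\<^sub>0) ^ m + \<omega>" using A D by linarith
  qed
  moreover have "K \<ge> 0" using C unfolding K_def by simp
  ultimately show thesis using that by blast
qed

section \<open>Oscillatory integrals in velocity\<close>

definition phase :: "(R3 \<Rightarrow> R3) \<Rightarrow> real \<Rightarrow> R3 \<Rightarrow> R3 \<times> R3 \<Rightarrow> real" where
  "phase a t \<xi> z = \<xi> \<bullet> fst z + t * (\<xi> \<bullet> a (snd z))"

text \<open>The coefficients \<open>c\<close> are the inverse of the Jacobian of \<open>a\<close>.\<close>

definition nondegenerate :: "(R3 \<Rightarrow> R3) \<Rightarrow> (R3 \<Rightarrow> R3 \<Rightarrow> R3 \<times> R3 \<Rightarrow> real) \<Rightarrow> bool" where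
  "nondegenerate a c \<longleftrightarrow>
     (\<forall>k\<in>Basis. symb 4 (\<lambda>z::R3 \<times> R3. a (snd z) \<bullet> k)) \<and>
     (\<forall>i\<in>Basis. \<forall>j\<in>Basis. symb 4 (c i j)) \<and>
     (\<forall>i\<in>Basis. \<forall>k\<in>Basis. \<forall>z. (\<Sum>j\<in>Basis. c i j z * pd (0, j) (\<lambda>z. a (snd z) \<bullet> k) z) = i \<bullet> k)"

lemma
  assumes "nondegenerate a c"
  shows nondegenerate_velocity: "k \<in> Basis \<Longrightarrow> symb 4 (\<lambda>z::R3 \<times> R3. a (snd z) \<bullet> k)"
    and nondegenerate_coefficient: "i \<in> Basis \<Longrightarrow> j \<in> Basis \<Longrightarrow> symb 4 (c i j)"
    and nondegenerate_inverse: "i \<in> Basis \<Longrightarrow> k \<in> Basis \<Longrightarrow>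
      (\<Sum>j\<in>Basis. c i j z * pd (0, j) (\<lambda>z. a (snd z) \<bullet> k) z) = i \<bullet> k"
  using assms unfolding nondegenerate_def by blast+

lemma Basis_velocity: "j \<in> Basis \<Longrightarrow> (0, j) \<in> (Basis :: (R3 \<times> R3) set)"
  by (simp add: Basis_prod_def)

lemma symb_cmult: "symb d u \<Longrightarrow> symb d (\<lambda>z. c * u z)"
  using symb_mult[OF symb_const[of 0 c]] by simp

lemma bounded_linear_snd_inner: "bounded_linear (\<lambda>z::R3 \<times> R3. snd z \<bullet> k)"
  by (intro bounded_linear_compose[OF bounded_linear_inner_left] bounded_linear_snd)

lemma bounded_linear_fst_inner: "bounded_linear (\<lambda>z::R3 \<times> R3. k \<bullet> fst z)"
  by (intro bounded_linear_compose[OF bounded_linear_inner_right] bounded_linear_fst)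

section \<open>The classical and the relativistic velocity\<close>

lemma nondegenerate_identity: "nondegenerate (\<lambda>v. v) (\<lambda>i j _. i \<bullet> j)"
  unfolding nondegenerate_def
proof (intro conjI ballI allI)
  fix i j k :: R3 and z :: "R3 \<times> R3" assume "i \<in> Basis" "k \<in> Basis"
  show "symb 4 (\<lambda>z::R3 \<times> R3. snd z \<bullet> k)"
    by (rule symb_mono[OF symb_linear[OF bounded_linear_snd_inner]]) simp
  show "symb 4 (\<lambda>_. i \<bullet> j)" by (rule symb_const)
  show "(\<Sum>j\<in>Basis. (i \<bullet> j) * pd (0, j) (\<lambda>z. snd z \<bullet> k) z) = i \<bullet> k"
    unfolding pd_linear[OF bounded_linear_snd_inner] snd_conv
    by (subst euclidean_inner[of i k]) (simp add: inner_commute)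
qed

definition lorentz :: "R3 \<times> R3 \<Rightarrow> real" where
  "lorentz z = 1 / sqrt (1 + (norm (snd z))\<^sup>2)"

text \<open>With q for \<open>lorentz\<close>, the derivative - (v . h) q^3 is grouped into the
  factors (v . h) q and q, which are bounded in v, as the symbol estimate requires.\<close>

lemma lorentz_has_derivative:
  "(lorentz has_derivative (\<lambda>h. - ((snd z \<bullet> snd h) * lorentz z) * (lorentz z * lorentz z))) (at z)"
proof -
  let ?s = "sqrt (1 + snd z \<bullet> snd z)"
  have p: "1 + snd z \<bullet> snd z > 0" by (simp add: add_pos_nonneg)
  have D: "((\<lambda>z::R3\<times>R3. 1 + snd z \<bullet> snd z) has_derivative (\<lambda>h. 2 * (snd z \<bullet> snd h))) (at z)"
    by (auto intro!: derivative_eq_intros simp: inner_commute)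
  have "((\<lambda>x. 1 / sqrt x) has_real_derivative - (inverse (sqrt x) / 2) / (sqrt x * sqrt x)) (at x)" if "x > 0" for x
    using that by (auto intro!: derivative_eq_intros)
  from has_derivative_compose[OF D this[OF p, unfolded has_field_derivative_def]]
  have "((\<lambda>z. 1 / sqrt (1 + snd z \<bullet> snd z)) has_derivative
      (\<lambda>h. (- (inverse ?s / 2) / (?s * ?s)) * (2 * (snd z \<bullet> snd h)))) (at z)" .
  moreover have "(- (inverse s / 2) / (s * s)) * (2 * x) = - (x * (1 / s)) * ((1 / s) * (1 / s))" for s x :: real
    by (cases "s = 0") (simp_all add: field_simps)
  ultimately show ?thesis
    unfolding lorentz_def[abs_def] power2_norm_eq_inner by (simp only:)
qed

lemma lorentz_pos: "lorentz z > 0"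
  by (simp add: lorentz_def add_pos_nonneg)

lemma lorentz_square: "(1 + snd z \<bullet> snd z) * (lorentz z * lorentz z) = 1"
proof -
  have "1 + snd z \<bullet> snd z > 0" by (simp add: add_pos_nonneg)
  then show ?thesis unfolding lorentz_def power2_norm_eq_inner by simp
qed

lemma lorentz_differentiable: "lorentz differentiable (at z)"
  using lorentz_has_derivative unfolding differentiable_def by blast

text \<open>With q for \<open>lorentz\<close>, the functions q and (v . k) q are bounded, and the
  derivatives of each kind are polynomials in functions of both kinds. Hence the joint
  induction.\<close>

lemma nder_lorentz:
  "nder (poly_bounded 0) n lorentz \<and> (\<forall>k. nder (poly_bounded 0) n (\<lambda>z. (snd z \<bullet> k) * lorentz z))"
proof (induction n)
  case 0
  have l1: "lorentz z \<le> 1" for z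
    unfolding lorentz_def by (simp add: add_pos_nonneg)
  have "\<bar>(snd z \<bullet> k) * lorentz z\<bar> \<le> norm k" for z k
  proof -
    have "\<bar>snd z \<bullet> k\<bar> * lorentz z \<le> (norm (snd z) * norm k) * lorentz z"
      using lorentz_pos[of z] by (intro mult_right_mono Cauchy_Schwarz_ineq2) auto
    also have "\<dots> = norm k * (norm (snd z) * lorentz z)" by simp
    also have "norm (snd z) * lorentz z \<le> 1"
      unfolding lorentz_def by (simp add: divide_le_eq add_pos_nonneg real_le_rsqrt)
    then have "norm k * (norm (snd z) * lorentz z) \<le> norm k * 1" by (rule mult_left_mono) simp
    finally show ?thesis using lorentz_pos[of z] by (simp add: abs_mult)
  qed
  then have b: "poly_bounded 0 (\<lambda>z. (snd z \<bullet> k) * lorentz z)" for k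
    unfolding poly_bounded_def by (metis power_0 mult.right_neutral)
  have "\<bar>lorentz z\<bar> \<le> 1" for z using l1[of z] lorentz_pos[of z] by simp
  then have "poly_bounded 0 lorentz"
    unfolding poly_bounded_def by (metis power_0 mult.right_neutral)
  moreover have "(\<lambda>z. (snd z \<bullet> k) * lorentz z) differentiable (at z)" for k z
    by (intro differentiable_mult lorentz_differentiable bounded_linear_imp_differentiable bounded_linear_snd_inner)
  ultimately show ?case using b lorentz_differentiable by simp
next
  case (Suc n)
  have base: "poly_bounded 0 lorentz" "poly_bounded 0 (\<lambda>z. (snd z \<bullet> k) * lorentz z)" for k
    using Suc nder_pred by blast+
  have d: "(\<lambda>z. (snd z \<bullet> k) * lorentz z) differentiable (at z)" for k z
    using Suc nder_differentiable by blast
  have c: "nder (poly_bounded 0) n (\<lambda>_. x)" for x :: real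
    using symb_const[of 0 x] unfolding symb_def by blast
  have mul: "nder (poly_bounded 0) n (\<lambda>z. u z * w z)"
    if "nder (poly_bounded 0) n u" "nder (poly_bounded 0) n w" for u w :: "R3 \<times> R3 \<Rightarrow> real"
  proof (rule nder_mult[of "poly_bounded 0" "poly_bounded 0" "poly_bounded 0", OF poly_bounded_add _ that])
    show "poly_bounded 0 (\<lambda>z. u z * w z)" if "poly_bounded 0 u" "poly_bounded 0 w" for u w :: "R3 \<times> R3 \<Rightarrow> real"
      using poly_bounded_mult[OF that] by simp
  qed
  have pd1: "pd b lorentz = (\<lambda>z. (-1) * ((snd z \<bullet> snd b) * lorentz z) * (lorentz z * lorentz z))" for b
    by (rule ext) (use pd_eqI[OF lorentz_has_derivative] in simp)
  have pd2: "pd b (\<lambda>z. (snd z \<bullet> k) * lorentz z) = (\<lambda>z. (snd b \<bullet> k) * lorentz z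
      + (-1) * (((snd z \<bullet> k) * lorentz z) * (((snd z \<bullet> snd b) * lorentz z) * lorentz z)))" for b k
  proof
    fix z
    show "pd b (\<lambda>z. (snd z \<bullet> k) * lorentz z) z = (snd b \<bullet> k) * lorentz z
      + (-1) * (((snd z \<bullet> k) * lorentz z) * (((snd z \<bullet> snd b) * lorentz z) * lorentz z))"
      using pd_mult[OF bounded_linear_imp_differentiable[OF bounded_linear_snd_inner] lorentz_differentiable, of b k z]
      by (simp add: pd1 pd_linear[OF bounded_linear_snd_inner] algebra_simps)
  qed
  have l: "nder (poly_bounded 0) n lorentz" and lv: "nder (poly_bounded 0) n (\<lambda>z. (snd z \<bullet> k) * lorentz z)" for k
    using Suc by blast+
  have "nder (poly_bounded 0) n (pd b lorentz)" for b
    unfolding pd1 by (rule mul[OF mul[OF c lv] mul[OF l l]])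
  moreover have "nder (poly_bounded 0) n (pd b (\<lambda>z. (snd z \<bullet> k) * lorentz z))" for b k
    unfolding pd2
    by (rule nder_add[of "poly_bounded 0", OF poly_bounded_add mul[OF c l] mul[OF c mul[OF lv mul[OF lv l]]]])
  ultimately show ?case using base d lorentz_differentiable by simp
qed

lemma symb_lorentz: "symb 0 lorentz" and symb_relativistic: "symb 0 (\<lambda>z. (snd z \<bullet> k) * lorentz z)"
  unfolding symb_def using nder_lorentz by blast+

text \<open>The Jacobian of v q is q (I - q^2 v v^T), a rank-one perturbation of a multiple of the
  identity, and its inverse is q^(-1) (I + v v^T) by the Sherman-Morrison formula. The factor q^(-1)
  is written (1 + |v|^2) q, a product of known symbols; the degrees 2 + 0 + 2 give the order
  4.\<close>

lemma nondegenerate_relativistic: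
  "nondegenerate (\<lambda>v. (1 / sqrt (1 + (norm v)\<^sup>2)) *\<^sub>R v)
     (\<lambda>i j z. ((1 + (\<Sum>b\<in>Basis. (snd z \<bullet> b) * (snd z \<bullet> b))) * lorentz z) * (i \<bullet> j + (snd z \<bullet> i) * (snd z \<bullet> j)))"
  unfolding nondegenerate_def
proof (intro conjI ballI allI)
  have a: "(\<lambda>z::R3 \<times> R3. ((1 / sqrt (1 + (norm (snd z))\<^sup>2)) *\<^sub>R snd z) \<bullet> k) = (\<lambda>z. (snd z \<bullet> k) * lorentz z)" for k
    by (simp add: lorentz_def)
  fix i k :: R3 assume "i \<in> Basis" "k \<in> Basis"
  show "symb 4 (\<lambda>z::R3 \<times> R3. ((1 / sqrt (1 + (norm (snd z))\<^sup>2)) *\<^sub>R snd z) \<bullet> k)"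
    unfolding a by (rule symb_mono[OF symb_relativistic]) simp
  have lin: "symb 1 (\<lambda>z::R3 \<times> R3. snd z \<bullet> l)" for l by (rule symb_linear[OF bounded_linear_snd_inner])
  have quad: "symb 2 (\<lambda>z::R3 \<times> R3. (snd z \<bullet> l) * (snd z \<bullet> l'))" for l l'
    using symb_mult[OF lin lin, of l l'] by (simp add: numeral_2_eq_2)
  have "symb 2 (\<lambda>z::R3 \<times> R3. 1 + (\<Sum>b\<in>Basis. (snd z \<bullet> b) * (snd z \<bullet> b)))"
    unfolding Basis_R3 by (simp add: axis_eq_axis) (intro symb_add symb_const quad)
  from symb_mult[OF symb_mult[OF this symb_lorentz] symb_add[OF symb_const quad]]
  show "symb 4 (\<lambda>z. ((1 + (\<Sum>b\<in>Basis. (snd z \<bullet> b) * (snd z \<bullet> b))) * lorentz z) * (i \<bullet> j + (snd z \<bullet> i) * (snd z \<bullet> j)))" for j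
    by simp
  fix z :: "R3 \<times> R3"
  let ?q = "lorentz z" and ?v = "snd z"
  have pd: "pd (0, j) (\<lambda>z. (snd z \<bullet> k) * lorentz z) z = ?q * (j \<bullet> k) - (?v \<bullet> j) * ((?v \<bullet> k) * ?q * (?q * ?q))" for j
    using pd_mult[OF bounded_linear_imp_differentiable[OF bounded_linear_snd_inner] lorentz_differentiable, of "(0, j)" k z]
    by (simp add: pd_eqI[OF lorentz_has_derivative] pd_linear[OF bounded_linear_snd_inner] algebra_simps)
  have vv: "(\<Sum>b\<in>Basis. (?v \<bullet> b) * (?v \<bullet> b)) = ?v \<bullet> ?v"
    by (rule euclidean_inner[symmetric])
  let ?E = "(1 + ?v \<bullet> ?v) * ?q"
  have "(\<Sum>j\<in>Basis. (?E * (i \<bullet> j + (?v \<bullet> i) * (?v \<bullet> j))) * (?q * (j \<bullet> k) - (?v \<bullet> j) * ((?v \<bullet> k) * ?q * (?q * ?q))))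
    = (\<Sum>j\<in>Basis. ?E * ?q * ((i \<bullet> j) * (k \<bullet> j)) - ?E * ((?v \<bullet> k) * ?q * (?q * ?q)) * ((i \<bullet> j) * (?v \<bullet> j))
       + ?E * ?q * (?v \<bullet> i) * ((?v \<bullet> j) * (k \<bullet> j)) - ?E * (?v \<bullet> i) * ((?v \<bullet> k) * ?q * (?q * ?q)) * ((?v \<bullet> j) * (?v \<bullet> j)))"
    by (rule sum.cong) (simp_all add: algebra_simps inner_commute)
  also have "\<dots> = ?E * ?q * (i \<bullet> k) - ?E * ((?v \<bullet> k) * ?q * (?q * ?q)) * (i \<bullet> ?v)
       + ?E * ?q * (?v \<bullet> i) * (?v \<bullet> k) - ?E * (?v \<bullet> i) * ((?v \<bullet> k) * ?q * (?q * ?q)) * (?v \<bullet> ?v)"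
    unfolding sum.distrib sum_subtractf sum_distrib_left[symmetric] euclidean_inner[symmetric] ..
  \<comment> \<open>The terms are arranged around (1 + |v|^2) q^2 = 1, which makes the last bracket
    vanish.\<close>
  also have "\<dots> = ((1 + ?v \<bullet> ?v) * (?q * ?q)) * (i \<bullet> k)
      + ((1 + ?v \<bullet> ?v) * (?q * ?q)) * (?v \<bullet> i) * (?v \<bullet> k) * (1 - (1 + ?v \<bullet> ?v) * (?q * ?q))"
    by (simp add: algebra_simps inner_commute)
  also have "\<dots> = i \<bullet> k" unfolding lorentz_square by simp
  finally show "(\<Sum>j\<in>Basis. ((1 + (\<Sum>b\<in>Basis. (snd z \<bullet> b) * (snd z \<bullet> b))) * lorentz z) * (i \<bullet> j + (snd z \<bullet> i) * (snd z \<bullet> j)) *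
      pd (0, j) (\<lambda>z. ((1 / sqrt (1 + (norm (snd z))\<^sup>2)) *\<^sub>R snd z) \<bullet> k) z) = i \<bullet> k"
    unfolding a pd vv .
qed

lemma symb_phase_part:
  assumes "nondegenerate a c"
  shows "symb 4 (\<lambda>z::R3 \<times> R3. \<xi> \<bullet> a (snd z))"
proof -
  have "symb 4 (\<lambda>z::R3 \<times> R3. (\<xi> \<bullet> k) * (a (snd z) \<bullet> k))" if "k \<in> Basis" for k
    by (rule symb_cmult[OF nondegenerate_velocity[OF assms that]])
  then have "symb 4 (\<lambda>z::R3 \<times> R3. \<Sum>k\<in>Basis. (\<xi> \<bullet> k) * (a (snd z) \<bullet> k))"
    unfolding Basis_R3 by (simp add: axis_eq_axis) (intro symb_add; simp)
  then show ?thesis unfolding euclidean_inner[symmetric] .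
qed

lemma symb_phase:
  assumes "nondegenerate a c"
  shows "symb 4 (phase a t \<xi>)"
  unfolding phase_def[abs_def]
  by (intro symb_add symb_cmult symb_phase_part[OF assms] symb_mono[OF symb_linear[OF bounded_linear_fst_inner]]) simp

text \<open>Row \<open>i\<close> of the inverse Jacobian undoes the Jacobian in the velocity
  gradient of the phase and isolates one coordinate of t \<xi>. This gives the vector field along
  which the integration by parts takes place.\<close>

lemma pd_phase:
  assumes a: "nondegenerate a c" and i: "i \<in> Basis"
  shows "(\<Sum>j\<in>Basis. c i j z * pd (0, j) (phase a t \<xi>) z) = t * (\<xi> \<bullet> i)"
proof -
  have d: "(\<lambda>z. a (snd z) \<bullet> k) differentiable (at z)" if "k \<in> Basis" for k
    by (rule smooth_differentiable[OF symb_smooth[OF nondegenerate_velocity[OF a that]]])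
  have "pd (0, j) (phase a t \<xi>) z = t * (\<Sum>k\<in>Basis. (\<xi> \<bullet> k) * pd (0, j) (\<lambda>z. a (snd z) \<bullet> k) z)" for j
  proof (rule pd_eqI[THEN trans])
    show "(phase a t \<xi> has_derivative (\<lambda>h. \<xi> \<bullet> fst h + t * (\<Sum>k\<in>Basis. (\<xi> \<bullet> k) * pd h (\<lambda>z. a (snd z) \<bullet> k) z))) (at z)"
      unfolding phase_def[abs_def] euclidean_inner[of \<xi> "a (snd _)"]
      by (intro has_derivative_add has_derivative_mult_right has_derivative_sum bounded_linear_imp_has_derivative
          bounded_linear_fst_inner differentiable_has_derivative_pd d)
  qed simp
  then have "(\<Sum>j\<in>Basis. c i j z * pd (0, j) (phase a t \<xi>) z)
    = t * (\<Sum>j\<in>Basis. \<Sum>k\<in>Basis. (\<xi> \<bullet> k) * (c i j z * pd (0, j) (\<lambda>z. a (snd z) \<bullet> k) z))"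
    by (simp add: sum_distrib_left mult_ac)
  also have "(\<Sum>j\<in>Basis. \<Sum>k\<in>Basis. (\<xi> \<bullet> k) * (c i j z * pd (0, j) (\<lambda>z. a (snd z) \<bullet> k) z))
    = (\<Sum>k\<in>Basis. (\<xi> \<bullet> k) * (\<Sum>j\<in>Basis. c i j z * pd (0, j) (\<lambda>z. a (snd z) \<bullet> k) z))"
    by (subst sum.swap) (simp add: sum_distrib_left)
  also have "\<dots> = (\<Sum>k\<in>Basis. (\<xi> \<bullet> k) * (i \<bullet> k))"
    by (intro sum.cong refl) (simp add: nondegenerate_inverse[OF a i])
  finally show ?thesis by (simp add: euclidean_inner[symmetric])
qed

text \<open>The constant is uniform over families, frequencies, times and the shift
  \<open>\<sigma>\<close>; the shift is there because integration by parts turns a cosine into a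
  sine. Using a single coordinate \<open>i\<close> lets the same vector field be applied
  \<open>k\<close> times.\<close>

definition oscillation_bound ::
  "nat \<Rightarrow> nat \<Rightarrow> (R3 \<Rightarrow> R3) \<Rightarrow> nat \<Rightarrow> (R3 \<times> R3 \<Rightarrow> real) \<Rightarrow> real \<Rightarrow> bool" where
  "oscillation_bound m L a k u K \<longleftrightarrow> K \<ge> 0 \<and> (\<forall>W B bs \<xi> t \<sigma>. \<forall>i\<in>Basis.
     weak_family m L B W \<and> set bs \<subseteq> Basis \<and> length bs + k \<le> L \<longrightarrow>
     \<bar>t * (\<xi> \<bullet> i)\<bar> ^ k * \<bar>LINT z|lborel. W bs z * (cos (phase a t \<xi> z + \<sigma>) * u z)\<bar> \<le> K * B)"

lemma poly_bounded_cos_mult: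
  assumes "poly_bounded m u"
  shows "poly_bounded m (\<lambda>z. cos (w z) * u z)"
proof -
  obtain C where C: "C \<ge> 0" "\<And>z. \<bar>u z\<bar> \<le> C * (1 + norm z) ^ m"
    using poly_bounded_obtain[OF assms] by blast
  have "\<bar>cos (w z) * u z\<bar> \<le> C * (1 + norm z) ^ m" for z
    using mult_mono[OF abs_cos_le_one[of "w z"] C(2)[of z]] by (simp add: abs_mult)
  then show ?thesis unfolding poly_bounded_def by blast
qed

lemma weak_family_symb_integrable:
  assumes W: "weak_family m L B W" "set bs \<subseteq> Basis" "length bs \<le> L"
    and u: "smooth u" "poly_bounded m u"
  shows "integrable lborel (\<lambda>z. W bs z * u z)"
proof -
  obtain C where "C \<ge> 0" "\<And>z. \<bar>u z\<bar> \<le> C * (1 + norm z) ^ m"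
    using poly_bounded_obtain[OF u(2)] by blast
  then show ?thesis by (intro weak_family_integrable_mult(1)[OF W smooth_measurable[OF u(1)]])
qed

text \<open>One step: \<open>t \<xi>\<^sub>i cos(\<theta> + \<sigma>)\<close> is the derivative of \<open>sin(\<theta> + \<sigma>)\<close> along the vector field
  \<open>\<Sum>\<^sub>j c\<^sub>i\<^sub>j \<partial>\<^sub>v\<^sub>j\<close>, which is then integrated by parts. The sine is written as a shifted cosine so
  that the induction closes.\<close>

lemma oscillation_step:
  assumes a: "nondegenerate a c" and W: "weak_family m L B W" and bs: "set bs \<subseteq> Basis" "length bs < L"
    and i: "i \<in> Basis" and u: "symb d u" and d: "d + 8 \<le> m"
  shows "(t * (\<xi> \<bullet> i)) * (LINT z|lborel. W bs z * (cos (phase a t \<xi> z + \<sigma>) * u z))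
    = - (\<Sum>j\<in>Basis. (LINT z|lborel. W (bs @ [(0, j)]) z * (cos (phase a t \<xi> z + (\<sigma> - pi / 2)) * (c i j z * u z)))
       + (LINT z|lborel. W bs z * (cos (phase a t \<xi> z + (\<sigma> - pi / 2)) * pd (0, j) (\<lambda>z. c i j z * u z) z)))"
proof -
  let ?\<theta> = "phase a t \<xi>"
  let ?C = "\<lambda>z. cos (?\<theta> z + \<sigma>)" and ?S = "\<lambda>z. cos (?\<theta> z + (\<sigma> - pi / 2))"
  let ?e = "\<lambda>j z. c i j z * u z"
  have S_sin: "?S z = sin (?\<theta> z + \<sigma>)" for z
    by (simp add: cos_diff add.assoc[symmetric] add_diff_eq)
  have s\<theta>: "smooth (\<lambda>z. ?\<theta> z + s)" for s by (intro smooth_add smooth_const symb_smooth[OF symb_phase[OF a]])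
  have e: "symb (4 + d) (?e j)" if "j \<in> Basis" for j
    by (rule symb_mult[OF nondegenerate_coefficient[OF a i that] u])
  have pd\<theta>: "symb 4 (pd (0, j) ?\<theta>)" if "j \<in> Basis" for j
    by (rule symb_pd[OF symb_phase[OF a] Basis_velocity[OF that]])
  have pdS: "pd h ?S z = ?C z * pd h ?\<theta> z" for h z
  proof (rule pd_eqI)
    have "(?\<theta> has_derivative (\<lambda>h. pd h ?\<theta> z)) (at z)"
      by (intro differentiable_has_derivative_pd smooth_differentiable symb_smooth[OF symb_phase[OF a]])
    then have "((\<lambda>z. sin (?\<theta> z + \<sigma>)) has_derivative (\<lambda>h. ?C z * pd h ?\<theta> z)) (at z)"
      by (auto intro!: derivative_eq_intros simp: mult.commute)
    then show "(?S has_derivative (\<lambda>h. ?C z * pd h ?\<theta> z)) (at z)" by (simp add: S_sin)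
  qed
  have pdSe: "pd (0, j) (\<lambda>z. ?S z * ?e j z) z = ?C z * (pd (0, j) ?\<theta> z * ?e j z) + ?S z * pd (0, j) (?e j) z"
    if "j \<in> Basis" for j z
    using pd_mult[of ?S z "?e j" "(0, j)"] that
      smooth_differentiable[OF smooth_cos[OF s\<theta>]] smooth_differentiable[OF symb_smooth[OF e[OF that]]]
    by (simp add: pdS)
  have bnd: "poly_bounded m (\<lambda>z. ?S z * ?e j z)"
      "poly_bounded m (\<lambda>z. ?C z * (pd (0, j) ?\<theta> z * ?e j z))"
      "poly_bounded m (\<lambda>z. ?S z * pd (0, j) (?e j) z)" if j: "j \<in> Basis" for j
  proof -
    show "poly_bounded m (\<lambda>z. ?S z * ?e j z)"
      by (intro poly_bounded_cos_mult poly_bounded_mono[OF symb_poly_bounded[OF e[OF j]]]) (use d in simp)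
    \<comment> \<open>The worst amplitude: the phase derivative and the coefficient each have order
      4, whence the margin 8 over \<open>d\<close>.\<close>
    show "poly_bounded m (\<lambda>z. ?C z * (pd (0, j) ?\<theta> z * ?e j z))"
      by (intro poly_bounded_cos_mult poly_bounded_mono[OF symb_poly_bounded[OF symb_mult[OF pd\<theta>[OF j] e[OF j]]]]) (use d in simp)
    show "poly_bounded m (\<lambda>z. ?S z * pd (0, j) (?e j) z)"
      by (intro poly_bounded_cos_mult poly_bounded_mono[OF symb_poly_bounded[OF symb_pd[OF e[OF j] Basis_velocity[OF j]]]]) (use d in simp)
  qed
  have sm: "smooth (\<lambda>z. ?S z * ?e j z)" "smooth (\<lambda>z. ?C z * (pd (0, j) ?\<theta> z * ?e j z))"
      "smooth (\<lambda>z. ?S z * pd (0, j) (?e j) z)" if j: "j \<in> Basis" for j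
    by (intro smooth_mult smooth_cos s\<theta> symb_smooth[OF e[OF j]] symb_smooth[OF pd\<theta>[OF j]]
        symb_smooth[OF symb_pd[OF e[OF j] Basis_velocity[OF j]]])+
  have bs': "length bs \<le> L" using bs by simp
  have int1: "integrable lborel (\<lambda>z. W bs z * (?C z * (pd (0, j) ?\<theta> z * ?e j z)))"
    and int2: "integrable lborel (\<lambda>z. W bs z * (?S z * pd (0, j) (?e j) z))" if j: "j \<in> Basis" for j
    by (intro weak_family_symb_integrable[OF W bs(1) bs'] sm bnd j)+
  have key: "(LINT z|lborel. W bs z * (?C z * (pd (0, j) ?\<theta> z * ?e j z)))
    = - ((LINT z|lborel. W (bs @ [(0, j)]) z * (?S z * ?e j z)) + (LINT z|lborel. W bs z * (?S z * pd (0, j) (?e j) z)))"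
    if j: "j \<in> Basis" for j
  proof -
    have "poly_bounded m (pd (0, j) (\<lambda>z. ?S z * ?e j z))"
      using poly_bounded_add[OF bnd(2,3)[OF j]] by (simp add: pdSe[OF j, abs_def])
    from weak_family_ibp[OF W bs Basis_velocity[OF j] sm(1)[OF j] bnd(1)[OF j] this]
    have "(LINT z|lborel. W bs z * (?C z * (pd (0, j) ?\<theta> z * ?e j z)) + W bs z * (?S z * pd (0, j) (?e j) z))
      = - (LINT z|lborel. W (bs @ [(0, j)]) z * (?S z * ?e j z))"
      unfolding pdSe[OF j] distrib_left .
    then show ?thesis unfolding Bochner_Integration.integral_add[OF int1[OF j] int2[OF j]] by linarith
  qed
  have "(t * (\<xi> \<bullet> i)) * (LINT z|lborel. W bs z * (?C z * u z))
    = (LINT z|lborel. W bs z * (?C z * ((t * (\<xi> \<bullet> i)) * u z)))"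
    by (subst integral_mult_right_zero[symmetric]) (simp add: mult_ac)
  also have "\<dots> = (LINT z|lborel. (\<Sum>j\<in>Basis. W bs z * (?C z * (pd (0, j) ?\<theta> z * ?e j z))))"
  proof (rule Bochner_Integration.integral_cong[OF refl])
    fix z
    have eq: "t * (\<xi> \<bullet> i) = (\<Sum>j\<in>Basis. c i j z * pd (0, j) ?\<theta> z)"
      by (rule pd_phase[OF a i, symmetric])
    show "W bs z * (?C z * ((t * (\<xi> \<bullet> i)) * u z)) = (\<Sum>j\<in>Basis. W bs z * (?C z * (pd (0, j) ?\<theta> z * ?e j z)))"
      unfolding eq by (simp add: sum_distrib_left sum_distrib_right mult_ac)
  qed
  also have "\<dots> = (\<Sum>j\<in>Basis. LINT z|lborel. W bs z * (?C z * (pd (0, j) ?\<theta> z * ?e j z)))"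
    by (rule Bochner_Integration.integral_sum[OF int1])
  finally show ?thesis by (simp add: key sum_negf[symmetric])
qed

text \<open>Each integration by parts sends a derivative either to the family, lengthening the list,
  or to the amplitude. In both cases the coefficient raises the degree of the amplitude by 4. The
  additional 4 in the budget is for the phase derivative that occurs inside a single step.\<close>

lemma oscillation_bound_exists:
  assumes a: "nondegenerate a c"
  shows "symb d u \<Longrightarrow> d + 4 * k + 4 \<le> m \<Longrightarrow> \<exists>K. oscillation_bound m L a k u K"
proof (induction k arbitrary: d u)
  case 0
  have "poly_bounded m u"
    by (rule poly_bounded_mono[OF symb_poly_bounded[OF 0(1)]]) (use 0 in simp)
  then obtain C where C: "C \<ge> 0" "\<And>z. \<bar>u z\<bar> \<le> C * (1 + norm z) ^ m"
    using poly_bounded_obtain by blast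
  have "\<bar>LINT z|lborel. W bs z * (cos (phase a t \<xi> z + \<sigma>) * u z)\<bar> \<le> C * B"
    if "weak_family m L B W" "set bs \<subseteq> Basis" "length bs \<le> L" for W B bs \<xi> t \<sigma>
  proof (rule weak_family_integrable_mult(2)[OF that _ C(1)])
    show "(\<lambda>z. cos (phase a t \<xi> z + \<sigma>) * u z) \<in> borel_measurable borel"
      by (intro smooth_measurable smooth_mult smooth_cos smooth_add smooth_const
          symb_smooth[OF symb_phase[OF a]] symb_smooth[OF 0(1)])
    show "\<bar>cos (phase a t \<xi> z + \<sigma>) * u z\<bar> \<le> C * (1 + norm z) ^ m" for z
      using mult_mono[OF abs_cos_le_one[of "phase a t \<xi> z + \<sigma>"] C(2)[of z]] by (simp add: abs_mult)
  qed
  then show ?case using C(1) unfolding oscillation_bound_def by auto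
next
  case (Suc k)
  have e: "symb (4 + d) (\<lambda>z. c i j z * u z)" if "i \<in> Basis" "j \<in> Basis" for i j
    by (rule symb_mult[OF nondegenerate_coefficient[OF a that] Suc.prems(1)])
  have "\<exists>K. oscillation_bound m L a k (\<lambda>z. c i j z * u z) K" if "i \<in> Basis" "j \<in> Basis" for i j
    by (rule Suc.IH[OF e[OF that]]) (use Suc.prems in simp)
  then obtain K1 where K1: "\<And>i j. i \<in> Basis \<Longrightarrow> j \<in> Basis \<Longrightarrow> oscillation_bound m L a k (\<lambda>z. c i j z * u z) (K1 i j)"
    by metis
  have "\<exists>K. oscillation_bound m L a k (pd (0, j) (\<lambda>z. c i j z * u z)) K" if "i \<in> Basis" "j \<in> Basis" for i j
    by (rule Suc.IH[OF symb_pd[OF e[OF that] Basis_velocity[OF that(2)]]]) (use Suc.prems in simp)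
  then obtain K2 where K2: "\<And>i j. i \<in> Basis \<Longrightarrow> j \<in> Basis \<Longrightarrow>
      oscillation_bound m L a k (pd (0, j) (\<lambda>z. c i j z * u z)) (K2 i j)"
    by metis
  define K where "K = (\<Sum>i\<in>Basis. \<Sum>j\<in>Basis. K1 i j + K2 i j)"
  have nn: "K1 i j + K2 i j \<ge> 0" if "i \<in> Basis" "j \<in> Basis" for i j
    using K1[OF that] K2[OF that] by (simp add: oscillation_bound_def)
  have "oscillation_bound m L a (Suc k) u K"
    unfolding oscillation_bound_def
  proof (intro conjI allI ballI impI)
    show "K \<ge> 0" unfolding K_def by (intro sum_nonneg nn)
    fix W :: "(R3 \<times> R3) list \<Rightarrow> R3 \<times> R3 \<Rightarrow> real" and bs :: "(R3 \<times> R3) list" and B \<xi> t \<sigma> and i :: R3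
    assume i: "i \<in> Basis" and WB: "weak_family m L B W \<and> set bs \<subseteq> Basis \<and> length bs + Suc k \<le> L"
    then have W: "weak_family m L B W" and bs: "set bs \<subseteq> Basis" "length bs + Suc k \<le> L" by blast+
    have "B \<ge> 0"
    proof -
      have "0 \<le> (LINT z|lborel. (1 + norm z) ^ m * \<bar>W bs z\<bar>)" by simp
      also have "\<dots> \<le> B" by (rule weak_family_bound[OF W bs(1)]) (use bs in simp)
      finally show ?thesis .
    qed
    let ?X = "\<bar>t * (\<xi> \<bullet> i)\<bar>"
    let ?I1 = "\<lambda>j. LINT z|lborel. W (bs @ [(0, j)]) z * (cos (phase a t \<xi> z + (\<sigma> - pi / 2)) * (c i j z * u z))"
    let ?I2 = "\<lambda>j. LINT z|lborel. W bs z * (cos (phase a t \<xi> z + (\<sigma> - pi / 2)) * pd (0, j) (\<lambda>z. c i j z * u z) z)"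
    have I1: "?X ^ k * \<bar>?I1 j\<bar> \<le> K1 i j * B" and I2: "?X ^ k * \<bar>?I2 j\<bar> \<le> K2 i j * B" if j: "j \<in> Basis" for j
    proof -
      have "set (bs @ [(0, j)]) \<subseteq> Basis" "length (bs @ [(0, j)]) + k \<le> L" using bs Basis_velocity[OF j] by auto
      then show "?X ^ k * \<bar>?I1 j\<bar> \<le> K1 i j * B"
        using K1[OF i j] W i unfolding oscillation_bound_def by blast
      have "length bs + k \<le> L" using bs by simp
      then show "?X ^ k * \<bar>?I2 j\<bar> \<le> K2 i j * B"
        using K2[OF i j] W bs(1) i unfolding oscillation_bound_def by blast
    qed
    have "?X ^ Suc k * \<bar>LINT z|lborel. W bs z * (cos (phase a t \<xi> z + \<sigma>) * u z)\<bar>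
      = ?X ^ k * \<bar>(t * (\<xi> \<bullet> i)) * (LINT z|lborel. W bs z * (cos (phase a t \<xi> z + \<sigma>) * u z))\<bar>"
      by (simp add: abs_mult)
    also have "\<dots> = ?X ^ k * \<bar>\<Sum>j\<in>Basis. ?I1 j + ?I2 j\<bar>"
      by (subst oscillation_step[OF a W bs(1) _ i Suc.prems(1)]) (use bs Suc.prems in simp_all)
    also have "\<dots> \<le> ?X ^ k * (\<Sum>j\<in>Basis. \<bar>?I1 j\<bar> + \<bar>?I2 j\<bar>)"
      by (intro mult_left_mono order_trans[OF sum_abs] sum_mono abs_triangle_ineq) simp
    also have "\<dots> = (\<Sum>j\<in>Basis. ?X ^ k * \<bar>?I1 j\<bar> + ?X ^ k * \<bar>?I2 j\<bar>)"
      by (simp add: sum_distrib_left distrib_left)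
    also have "\<dots> \<le> (\<Sum>j\<in>Basis. K1 i j * B + K2 i j * B)"
      by (intro sum_mono add_mono I1 I2)
    also have "\<dots> = (\<Sum>j\<in>Basis. K1 i j + K2 i j) * B"
      by (simp add: sum_distrib_right distrib_right)
    also have "\<dots> \<le> K * B"
    proof (rule mult_right_mono[OF _ \<open>B \<ge> 0\<close>])
      show "(\<Sum>j\<in>Basis. K1 i j + K2 i j) \<le> K"
        unfolding K_def by (rule member_le_sum[OF i]) (auto intro!: sum_nonneg nn)
    qed
    finally show "?X ^ Suc k * \<bar>LINT z|lborel. W bs z * (cos (phase a t \<xi> z + \<sigma>) * u z)\<bar> \<le> K * B" .
  qed
  then show ?case by blast
qed

text \<open>Combines no integration by parts, which is good for small |t||\<xi>|, with
  \<open>k\<close> of them in the coordinate where \<xi> is largest; that coordinate controls the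
  norm up to the factor 3.\<close>

lemma oscillatory_decay:
  assumes a: "nondegenerate a c" and k: "k \<le> L" "4 * k + 4 \<le> m"
  obtains K where "K \<ge> 0"
    "\<And>W B \<xi> t \<sigma>. weak_family m L B W \<Longrightarrow>
      \<bar>LINT z|lborel. W [] z * cos (phase a t \<xi> z + \<sigma>)\<bar> \<le> K * B / (1 + \<bar>t\<bar> * norm \<xi>) ^ k"
proof -
  obtain K0 where K0: "oscillation_bound m L a 0 (\<lambda>_. 1) K0"
    using oscillation_bound_exists[OF a symb_const[of 0 1], of 0 m L] k by auto
  obtain K1 where K1: "oscillation_bound m L a k (\<lambda>_. 1) K1"
    using oscillation_bound_exists[OF a symb_const[of 0 1], of k m L] k by auto
  define K where "K = 4 ^ k * (K0 + K1)"
  have nn: "K0 \<ge> 0" "K1 \<ge> 0" using K0 K1 by (simp_all add: oscillation_bound_def)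
  have "\<bar>LINT z|lborel. W [] z * cos (phase a t \<xi> z + \<sigma>)\<bar> \<le> K * B / (1 + \<bar>t\<bar> * norm \<xi>) ^ k"
    if W: "weak_family m L B W" for W B \<xi> t \<sigma>
  proof -
    let ?I = "\<bar>LINT z|lborel. W [] z * cos (phase a t \<xi> z + \<sigma>)\<bar>"
    let ?M = "\<lambda>i. \<bar>t * (\<xi> \<bullet> i)\<bar>"
    have J0: "?I \<le> K0 * B"
    proof -
      have "axis 1 1 \<in> (Basis :: R3 set)" by simp
      then show ?thesis using K0 W unfolding oscillation_bound_def by fastforce
    qed
    have J1: "?M i ^ k * ?I \<le> K1 * B" if "i \<in> Basis" for i
      using K1 W k that unfolding oscillation_bound_def by fastforce
    obtain i where i: "i \<in> Basis" "\<And>j. j \<in> Basis \<Longrightarrow> ?M j \<le> ?M i"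
    proof -
      have "finite (?M ` (Basis :: R3 set))" "?M ` (Basis :: R3 set) \<noteq> {}" by simp_all
      from Max_in[OF this] Max_ge[OF this(1)] that show thesis by (metis (no_types, lifting) imageE image_eqI)
    qed
    have "\<bar>t\<bar> * norm \<xi> \<le> \<bar>t\<bar> * (\<Sum>j\<in>Basis. \<bar>\<xi> \<bullet> j\<bar>)" by (intro mult_left_mono norm_le_l1) simp
    also have "\<dots> = (\<Sum>j\<in>Basis. ?M j)" by (simp add: sum_distrib_left abs_mult)
    also have "\<dots> \<le> (\<Sum>j\<in>(Basis :: R3 set). ?M i)" by (intro sum_mono i)
    also have "\<dots> = 3 * ?M i" by simp
    finally have s: "1 + \<bar>t\<bar> * norm \<xi> \<le> 1 + 3 * ?M i" by simp
    have "(1 + \<bar>t\<bar> * norm \<xi>) ^ k * ?I \<le> (1 + 3 * ?M i) ^ k * ?I"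
      by (intro mult_right_mono power_mono s) simp_all
    also have "\<dots> \<le> (4 ^ k * (1 + ?M i ^ k)) * ?I"
    proof (rule mult_right_mono)
      \<comment> \<open>1 + 3 M is at most 4 max(1, M), and the k-th power of the maximum is at most
        1 + M^k.\<close>
      have "(1 + 3 * ?M i) ^ k \<le> (4 * max 1 (?M i)) ^ k" by (rule power_mono) auto
      also have "\<dots> = 4 ^ k * (max 1 (?M i)) ^ k" by (rule power_mult_distrib)
      also have "\<dots> \<le> 4 ^ k * (1 + ?M i ^ k)"
        by (rule mult_left_mono) (auto simp: max_def)
      finally show "(1 + 3 * ?M i) ^ k \<le> 4 ^ k * (1 + ?M i ^ k)" .
    qed simp
    also have "\<dots> = 4 ^ k * (?I + ?M i ^ k * ?I)" by (simp add: algebra_simps)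
    also have "\<dots> \<le> 4 ^ k * (K0 * B + K1 * B)" by (intro mult_left_mono add_mono J0 J1 i) simp
    also have "\<dots> = K * B" by (simp add: K_def algebra_simps)
    finally show ?thesis
      by (subst pos_le_divide_eq) (auto simp: mult.commute intro!: zero_less_power add_pos_nonneg)
  qed
  moreover have "K \<ge> 0" using nn unfolding K_def by simp
  ultimately show thesis using that by blast
qed

section \<open>Regularity and decay of the profile\<close>

lemma C1_differentiable: "C1 u \<Longrightarrow> u differentiable (at z)"
  by (simp add: C1_def differentiable_on_def)

lemma C1_continuous_pd:
  fixes u :: "'a::euclidean_space \<Rightarrow> real"
  assumes "C1 u" "continuous_on S p" "continuous_on S h"
  shows "continuous_on S (\<lambda>s. pd (h s) u (p s))"
proof -
  have "continuous_on S (\<lambda>s. pd b u (p s))" if "b \<in> Basis" for b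
    by (rule continuous_on_compose2[OF _ assms(2)]) (use assms(1) that in \<open>auto simp: C1_def\<close>)
  then have "continuous_on S (\<lambda>s. \<Sum>b\<in>Basis. (h s \<bullet> b) * pd b u (p s))"
    by (intro continuous_intros assms(3))
  moreover have "(\<lambda>s. pd (h s) u (p s)) = (\<lambda>s. \<Sum>b\<in>Basis. (h s \<bullet> b) * pd b u (p s))"
    by (rule ext, rule pd_linear_combination[OF C1_differentiable[OF assms(1)]])
  ultimately show ?thesis by argo
qed

lemma C1_continuous: "C1 u \<Longrightarrow> continuous_on S u"
  by (meson C1_differentiable continuous_at_imp_continuous_on differentiable_imp_continuous_within)

lemma integrable_continuous_test:
  fixes u :: "'a::euclidean_space \<Rightarrow> real"
  assumes "continuous_on UNIV u" "test_function \<psi>"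
  shows "integrable lborel (\<lambda>z. u z * \<psi> z)"
proof -
  let ?K = "closure {z. \<psi> z \<noteq> 0}"
  have "integrable lborel (\<lambda>z. indicator ?K z *\<^sub>R (u z * \<psi> z))"
    using assms smooth_continuous[OF test_function_smooth[OF assms(2)]]
    by (intro borel_integrable_compact continuous_on_mult)
      (auto simp: test_function_def intro: continuous_on_subset)
  moreover have "indicator ?K z *\<^sub>R (u z * \<psi> z) = u z * \<psi> z" for z
  proof (cases "\<psi> z = 0")
    case False
    then have "z \<in> ?K" by (intro subsetD[OF closure_subset]) simp
    then show ?thesis by simp
  qed simp
  ultimately show ?thesis by (simp only:)
qed

text \<open>The eighth power is split as four in position and four in velocity, each exceeding the
  dimension three, so that iterated integrals converge separately.\<close>

lemma decay_split:
  fixes z :: "R3 \<times> R3"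
  shows "1 / (1 + norm z) ^ 8 \<le> 1 / (1 + norm (fst z)) ^ 4 * (1 / (1 + norm (snd z)) ^ 4)"
proof -
  have "(1 + norm (fst z)) ^ 4 * (1 + norm (snd z)) ^ 4 \<le> (1 + norm z) ^ 4 * (1 + norm z) ^ 4"
    using norm_fst_le[of "fst z" "snd z"] norm_snd_le[of "snd z" "fst z"] by (intro mult_mono power_mono) auto
  also have "\<dots> = (1 + norm z) ^ 8" by (simp add: power_add[symmetric])
  finally have le: "(1 + norm (fst z)) ^ 4 * (1 + norm (snd z)) ^ 4 \<le> (1 + norm z) ^ 8" .
  have "1 / (1 + norm z) ^ 8 \<le> 1 / ((1 + norm (fst z)) ^ 4 * (1 + norm (snd z)) ^ 4)"
    by (rule divide_left_mono[OF le]) (auto intro!: mult_pos_pos zero_less_power add_pos_nonneg)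
  then show ?thesis by simp
qed

lemma decay_mono:
  fixes z :: "'a::real_normed_vector"
  assumes "k \<le> l"
  shows "1 / (1 + norm z) ^ l \<le> 1 / (1 + norm z) ^ k"
  by (rule divide_left_mono) (auto intro!: power_increasing assms mult_pos_pos zero_less_power add_pos_nonneg)

text \<open>Both velocity laws are treated at once through \<open>nondegenerate\<close>. The bounds
  on \<open>\<delta>\<close> and \<open>\<epsilon>\<close> make the squared norm of the profile at
  most (1 + |t|)^(1/4), the function \<open>growth\<close>.\<close>

locale vp_solution =
  fixes a :: "R3 \<Rightarrow> R3" and c :: "R3 \<Rightarrow> R3 \<Rightarrow> R3 \<times> R3 \<Rightarrow> real" and \<mu> \<delta> \<epsilon> :: real
    and f0 :: "R3 \<Rightarrow> R3 \<Rightarrow> real" and f :: "real \<Rightarrow> R3 \<Rightarrow> R3 \<Rightarrow> real" and \<phi> :: "real \<Rightarrow> R3 \<Rightarrow> real"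
  assumes nd: "nondegenerate a c" and mu: "\<bar>\<mu>\<bar> = 1" and \<delta>: "0 < \<delta>" "\<delta> \<le> 1 / 8"
    and \<epsilon>: "0 < \<epsilon>" "\<epsilon> \<le> 1" and sol: "global_solution 30 \<delta> \<epsilon> a \<mu> f0 f \<phi>"
begin

definition F :: "real \<times> R3 \<times> R3 \<Rightarrow> real" where
  "F = (\<lambda>(t, x, v). f t x v)"

definition g :: "real \<Rightarrow> R3 \<times> R3 \<Rightarrow> real" where
  "g t = profile a f t"

definition shear :: "real \<Rightarrow> R3 \<times> R3 \<Rightarrow> real \<times> R3 \<times> R3" where
  "shear t z = (t, fst z + t *\<^sub>R a (snd z), snd z)"

text \<open>The Jacobian of \<open>a\<close>, read off from the phase-space functions in
  \<open>nondegenerate\<close> so that their smoothness transfers; they are constant in position,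
  where 0 is inserted.\<close>

definition Da :: "R3 \<Rightarrow> R3 \<Rightarrow> R3" where
  "Da v h = (\<Sum>k\<in>Basis. pd (0, h) (\<lambda>z::R3 \<times> R3. a (snd z) \<bullet> k) (0, v) *\<^sub>R k)"

definition growth :: "real \<Rightarrow> real" where
  "growth t = (1 + \<bar>t\<bar>) powr (1 / 4)"

lemma growth_ge_1: "growth t \<ge> 1"
  unfolding growth_def by (simp add: ge_one_powr_ge_zero)

lemma vp: "vlasov_poisson a \<mu> f \<phi>"
  using sol by (simp add: global_solution_def)

lemma C1_F: "C1 F"
  using vp by (simp add: vlasov_poisson_def F_def)

lemma g_eq: "g t z = F (shear t z)"
  by (simp add: g_def profile_def F_def shear_def case_prod_beta)

lemma a_has_derivative: "(a has_derivative Da v) (at v)"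
proof -
  have "((\<lambda>v. a v \<bullet> k) has_derivative (\<lambda>h. pd (0, h) (\<lambda>z::R3 \<times> R3. a (snd z) \<bullet> k) (0, v))) (at v)"
    if "k \<in> Basis" for k
  proof -
    have "((\<lambda>v::R3. (0::R3, v)) has_derivative (\<lambda>h. (0, h))) (at v)"
      by (auto intro!: derivative_eq_intros)
    from has_derivative_compose[OF this differentiable_has_derivative_pd[OF smooth_differentiable[OF
      symb_smooth[OF nondegenerate_velocity[OF nd that]]]]]
    show ?thesis by simp
  qed
  then have "((\<lambda>v. \<Sum>k\<in>Basis. (a v \<bullet> k) *\<^sub>R k) has_derivative Da v) (at v)"
    unfolding Da_def[abs_def] by (intro has_derivative_sum has_derivative_scaleR_left)
  then show ?thesis by (simp add: euclidean_representation)
qed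

lemma a_continuous: "continuous_on S a"
  using a_has_derivative by (meson continuous_at_imp_continuous_on has_derivative_continuous)

lemma Da_continuous: "continuous_on S (\<lambda>v. Da v h)"
proof -
  have "continuous_on S (\<lambda>v. pd (0, h) (\<lambda>z::R3 \<times> R3. a (snd z) \<bullet> k) (0, v))" if "k \<in> Basis" for k
  proof -
    have s: "smooth (\<lambda>z::R3 \<times> R3. a (snd z) \<bullet> k)" by (rule symb_smooth[OF nondegenerate_velocity[OF nd that]])
    then have "C1 (\<lambda>z::R3 \<times> R3. a (snd z) \<bullet> k)"
      by (simp add: C1_def smooth_continuous smooth_pd smooth_differentiable differentiable_at_imp_differentiable_on)
    then show ?thesis by (rule C1_continuous_pd) (intro continuous_intros)+
  qed
  then show ?thesis unfolding Da_def by (intro continuous_intros)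
qed

lemma shear_has_derivative:
  "(shear t has_derivative (\<lambda>h. (0, fst h + t *\<^sub>R Da (snd z) (snd h), snd h))) (at z)"
proof -
  have "((\<lambda>z::R3 \<times> R3. a (snd z)) has_derivative (\<lambda>h. Da (snd z) (snd h))) (at z)"
    by (rule has_derivative_compose[OF bounded_linear_imp_has_derivative[OF bounded_linear_snd] a_has_derivative])
  then show ?thesis
    unfolding shear_def[abs_def]
    by (intro has_derivative_Pair has_derivative_const has_derivative_add has_derivative_scaleR_right
        bounded_linear_imp_has_derivative[OF bounded_linear_fst] bounded_linear_imp_has_derivative[OF bounded_linear_snd])
qed

lemma g_has_derivative:
  "(g t has_derivative (\<lambda>h. pd (0, fst h + t *\<^sub>R Da (snd z) (snd h), snd h) F (shear t z))) (at z)"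
  unfolding g_eq[abs_def]
  by (rule has_derivative_compose[OF shear_has_derivative differentiable_has_derivative_pd[OF C1_differentiable[OF C1_F]]])

lemma g_differentiable: "g t differentiable (at z)"
  using g_has_derivative unfolding differentiable_def by blast

lemma pd_g: "pd h (g t) z = pd (0, fst h + t *\<^sub>R Da (snd z) (snd h), snd h) F (shear t z)"
  by (rule pd_eqI[OF g_has_derivative])

lemma shear_continuous: "continuous_on S (shear t)"
  unfolding shear_def[abs_def]
  by (intro continuous_intros continuous_on_compose2[OF a_continuous[of UNIV]]) auto

lemma g_continuous: "continuous_on S (g t)"
  using g_differentiable
  by (meson continuous_at_imp_continuous_on differentiable_imp_continuous_within)

lemma pd_g_continuous: "continuous_on S (pd h (g t))"
  unfolding pd_g[abs_def]
  by (intro C1_continuous_pd[OF C1_F] shear_continuous continuous_intros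
      continuous_on_compose2[OF Da_continuous[of UNIV]]) auto

lemma g_measurable [measurable]: "g t \<in> borel_measurable borel"
  by (rule borel_measurable_continuous_onI[OF g_continuous])

lemma deriv_family_bound:
  obtains K where "K \<ge> 0" "\<And>t. weak_family 200 8 (K * growth t) (deriv_family (g t))"
proof -
  obtain K where K: "K > 0"
    "\<And>u b. u \<in> weighted_sobolev 30 \<Longrightarrow> weighted_norm 30 u \<le> b \<Longrightarrow> weak_family 200 8 (K * (1 + b\<^sup>2)) (deriv_family u)"
    using weak_family_deriv_family by blast
  have "weak_family 200 8 (2 * K * growth t) (deriv_family (g t))" for t
  proof -
    let ?b = "(1 + \<bar>t\<bar>) powr \<delta> * \<epsilon>"
    have W: "weak_family 200 8 (K * (1 + ?b\<^sup>2)) (deriv_family (g t))"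
      by (rule K(2)) (use sol in \<open>auto simp: global_solution_def g_def\<close>)
    have "?b\<^sup>2 \<le> ((1 + \<bar>t\<bar>) powr \<delta>)\<^sup>2"
      using \<epsilon> by (intro power_mono) (auto simp: mult_left_le)
    also have "\<dots> = (1 + \<bar>t\<bar>) powr (2 * \<delta>)" by (simp add: power2_eq_square powr_add[symmetric])
    also have "\<dots> \<le> growth t" unfolding growth_def by (intro powr_mono) (use \<delta> in auto)
    finally have "1 + ?b\<^sup>2 \<le> 2 * growth t" using growth_ge_1[of t] by simp
    then have "K * (1 + ?b\<^sup>2) \<le> 2 * K * growth t" using K(1) by simp
    then show ?thesis using W unfolding weak_family_def by (meson order_trans)
  qed
  then show thesis using that[of "2 * K"] K(1) by simp
qed

text \<open>Matches the classical gradient of the C^1 profile with the chosen weak one: classical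
  integration by parts and the relation inside the family both reduce to the profile integrated
  against \<open>pd j \<psi>\<close>.\<close>

lemma pd_g_test:
  assumes "weak_family 200 8 B (deriv_family (g t))" "j \<in> Basis" "test_function \<psi>"
  shows "(LINT z|lborel. pd j (g t) z * \<psi> z) = (LINT z|lborel. deriv_family (g t) [j] z * \<psi> z)"
proof -
  have gs: "g t \<in> weighted_sobolev 30" using sol by (simp add: global_solution_def g_def)
  note s = test_function_smooth[OF assms(3)] and t = test_function_pd[OF assms(3,2)]
  have "(LINT z|lborel. g t z * pd j \<psi> z) = - (LINT z|lborel. pd j (g t) z * \<psi> z)"
    by (rule integral_by_parts_pd)
      (auto intro!: g_differentiable pd_g_continuous smooth_differentiable[OF s] smooth_continuous[OF smooth_pd[OF s assms(2)]]
        integrable_continuous_test g_continuous assms t)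
  moreover have "(LINT z|lborel. g t z * pd j \<psi> z) = (LINT z|lborel. deriv_family (g t) [] z * pd j \<psi> z)"
    by (rule deriv_family_Nil[OF gs t])
  moreover have "(LINT z|lborel. deriv_family (g t) [] z * pd j \<psi> z) = - (LINT z|lborel. deriv_family (g t) ([] @ [j]) z * \<psi> z)"
    by (rule weak_family_test[OF assms(1)]) (use assms in auto)
  ultimately show ?thesis by simp
qed

text \<open>The pointwise bounds come first, at the full weight 200, and feed the oscillatory one.
  That estimate has to speak of \<open>g\<close> itself, so \<open>g\<close> must be the root of a
  family, and for this its own weighted integral must be bounded.\<close>

lemma profile_bounds:
  obtains K where "K \<ge> 0"
    "\<And>t z. \<bar>g t z\<bar> \<le> K * growth t / (1 + norm z) ^ 8"
    "\<And>t z j. j \<in> Basis \<Longrightarrow> \<bar>pd j (g t) z\<bar> \<le> K * growth t / (1 + norm z) ^ 8"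
    "\<And>t \<xi> \<sigma>. \<bar>LINT z|lborel. g t z * cos (phase a t \<xi> z + \<sigma>)\<bar> \<le> K * growth t / (1 + \<bar>t\<bar> * norm \<xi>) ^ 7"
proof -
  obtain K0 where K0: "K0 \<ge> 0" "\<And>t. weak_family 200 8 (K0 * growth t) (deriv_family (g t))"
    using deriv_family_bound by blast
  obtain K1 where K1: "K1 \<ge> 0" "\<And>W B bs u z. weak_family 200 8 B W \<Longrightarrow> set bs \<subseteq> Basis \<Longrightarrow>
      length bs + DIM(R3 \<times> R3) \<le> 8 \<Longrightarrow> continuous_on UNIV u \<Longrightarrow>
      (\<And>\<psi>. test_function \<psi> \<Longrightarrow> (LINT z|lborel. u z * \<psi> z) = (LINT z|lborel. W bs z * \<psi> z)) \<Longrightarrow>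
      \<bar>u z\<bar> \<le> K1 * B / (1 + norm (z::R3 \<times> R3)) ^ 200"
    using sobolev_pointwise[where 'a = "R3 \<times> R3" and m=200 and L=8] by blast
  have gs: "g t \<in> weighted_sobolev 30" for t using sol by (simp add: global_solution_def g_def)
  have g200: "\<bar>g t z\<bar> \<le> K1 * (K0 * growth t) / (1 + norm z) ^ 200" for t z
    by (rule K1(2)[OF K0(2), of "[]"]) (auto intro!: g_continuous deriv_family_Nil[OF gs])
  have pd200: "\<bar>pd j (g t) z\<bar> \<le> K1 * (K0 * growth t) / (1 + norm z) ^ 200" if "j \<in> Basis" for t z j
    by (rule K1(2)[OF K0(2), of "[j]"]) (use that in \<open>auto intro!: pd_g_continuous pd_g_test[OF K0(2)]\<close>)
  have nn: "K1 * (K0 * growth t) \<ge> 0" for t using K0 K1 growth_ge_1[of t] by simp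
  have weaken: "K1 * (K0 * growth t) / (1 + norm z) ^ 200 \<le> K1 * (K0 * growth t) / (1 + norm z) ^ 8" for t and z :: "R3 \<times> R3"
    using mult_left_mono[OF decay_mono[of 8 200 z] nn[of t]] by simp
  \<comment> \<open>200 = 32 + 168, and 168 exceeds the dimension 6.\<close>
  define I where "I = (LINT z::R3 \<times> R3|lborel. 1 / (1 + norm z) ^ 168)"
  have int: "integrable lborel (\<lambda>z::R3 \<times> R3. 1 / (1 + norm z) ^ 168)" by (rule integrable_decay) simp
  have I: "I \<ge> 0" unfolding I_def by simp
  \<comment> \<open>Only the root, a chosen representative, is replaced by the continuous
    \<open>g\<close>. The relations of the family survive because the two agree against test
    functions.\<close>
  define G where "G = (\<lambda>t bs. if bs = [] then g t else deriv_family (g t) bs)"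
  define K2 where "K2 = K0 + K1 * K0 * I"
  have fam: "weak_family 32 8 (K2 * growth t) (G t)" for t
    unfolding weak_family_def
  proof (intro allI impI, elim conjE)
    fix bs :: "(R3 \<times> R3) list" assume bs: "set bs \<subseteq> Basis" "length bs \<le> 8"
    have meas [measurable]: "G t bs \<in> borel_measurable borel"
      using weak_family_measurable[OF K0(2) bs] by (simp add: G_def)
    have size: "integrable lborel (\<lambda>z. (1 + norm z) ^ 32 * \<bar>G t bs z\<bar>) \<and>
        (LINT z|lborel. (1 + norm z) ^ 32 * \<bar>G t bs z\<bar>) \<le> K2 * growth t"
    proof (cases "bs = []")
      case True
      have le: "(1 + norm z) ^ 32 * \<bar>g t z\<bar> \<le> K1 * (K0 * growth t) * (1 / (1 + norm z) ^ 168)" for z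
      proof -
        have pos: "(1 + norm z) ^ n > 0" for n by (intro zero_less_power add_pos_nonneg) auto
        have "(1 + norm z) ^ 32 * \<bar>g t z\<bar> \<le> (1 + norm z) ^ 32 * (K1 * (K0 * growth t) / (1 + norm z) ^ (32 + 168))"
          using g200[of t z] pos[of 32] by (intro mult_left_mono) auto
        also have "\<dots> = K1 * (K0 * growth t) * (1 / (1 + norm z) ^ 168)"
          unfolding power_add using pos[of 32] by (simp add: field_simps)
        finally show ?thesis .
      qed
      have i2: "integrable lborel (\<lambda>z::R3 \<times> R3. K1 * (K0 * growth t) * (1 / (1 + norm z) ^ 168))"
        by (intro integrable_mult_right int)
      have i1: "integrable lborel (\<lambda>z. (1 + norm z) ^ 32 * \<bar>g t z\<bar>)"
        by (rule Bochner_Integration.integrable_bound[OF i2]) (use order_trans[OF le abs_ge_self] in \<open>auto intro!: AE_I2\<close>)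
      have "(LINT z|lborel. (1 + norm z) ^ 32 * \<bar>g t z\<bar>) \<le> (LINT z::R3 \<times> R3|lborel. K1 * (K0 * growth t) * (1 / (1 + norm z) ^ 168))"
        by (rule integral_mono[OF i1 i2 le])
      also have "\<dots> = K1 * (K0 * growth t) * I" unfolding I_def by (rule integral_mult_right_zero)
      also have "\<dots> \<le> K2 * growth t"
        using K0(1) growth_ge_1[of t] unfolding K2_def by (simp add: algebra_simps)
      finally show ?thesis using True i1 by (simp add: G_def)
    next
      case False
      then have Gd: "G t bs = deriv_family (g t) bs" by (simp add: G_def)
      note i2 = weak_family_integrable[OF K0(2) bs, of t] and b2 = weak_family_bound[OF K0(2) bs, of t]
      have le: "(1 + norm z) ^ 32 * \<bar>G t bs z\<bar> \<le> (1 + norm z) ^ 200 * \<bar>deriv_family (g t) bs z\<bar>" for z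
        unfolding Gd by (intro mult_right_mono power_increasing) auto
      have i1: "integrable lborel (\<lambda>z. (1 + norm z) ^ 32 * \<bar>G t bs z\<bar>)"
        by (rule Bochner_Integration.integrable_bound[OF i2]) (use order_trans[OF le abs_ge_self] in \<open>auto intro!: AE_I2\<close>)
      have "(LINT z|lborel. (1 + norm z) ^ 32 * \<bar>G t bs z\<bar>) \<le> K0 * growth t"
        by (rule order_trans[OF integral_mono[OF i1 i2 le] b2])
      also have "\<dots> \<le> K2 * growth t"
        using K0(1) K1(1) I growth_ge_1[of t] unfolding K2_def by (intro mult_right_mono) auto
      finally show ?thesis using i1 by simp
    qed
    have test: "(LINT z|lborel. G t bs z * pd j \<psi> z) = - (LINT z|lborel. G t (bs @ [j]) z * \<psi> z)"
      if "j \<in> Basis" "length bs < 8" "test_function \<psi>" for j \<psi>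
    proof -
      have "(LINT z|lborel. G t bs z * pd j \<psi> z) = (LINT z|lborel. deriv_family (g t) bs z * pd j \<psi> z)"
        using deriv_family_Nil[OF gs test_function_pd[OF that(3,1)]] by (simp add: G_def)
      then show ?thesis
        using weak_family_test[OF K0(2) bs that] by (simp add: G_def)
    qed
    show "G t bs \<in> borel_measurable borel \<and> integrable lborel (\<lambda>z. (1 + norm z) ^ 32 * \<bar>G t bs z\<bar>) \<and>
      (LINT z|lborel. (1 + norm z) ^ 32 * \<bar>G t bs z\<bar>) \<le> K2 * growth t \<and>
      (\<forall>j\<in>Basis. length bs < 8 \<longrightarrow> (\<forall>\<psi>. test_function \<psi> \<longrightarrow>
        (LINT z|lborel. G t bs z * pd j \<psi> z) = - (LINT z|lborel. G t (bs @ [j]) z * \<psi> z)))"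
      using size by (intro conjI ballI impI allI meas) (auto intro: test)
  qed
  \<comment> \<open>Seven steps take the weight 4 * 7 + 4 = 32 and fit into eight
    derivatives.\<close>
  obtain K3 where K3: "K3 \<ge> 0"
    "\<And>W B \<xi> t \<sigma>. weak_family 32 8 B W \<Longrightarrow>
      \<bar>LINT z|lborel. W [] z * cos (phase a t \<xi> z + \<sigma>)\<bar> \<le> K3 * B / (1 + \<bar>t\<bar> * norm \<xi>) ^ 7"
    using oscillatory_decay[OF nd, of 7 8 32] by auto
  define K where "K = K1 * K0 + K3 * K2"
  have K2: "K2 \<ge> 0" using K0 K1 I by (simp add: K2_def)
  have le1: "K1 * (K0 * growth t) / q \<le> K * growth t / q" if "q > 0" for q t
    using that K2 K3(1) growth_ge_1[of t] unfolding K_def by (intro divide_right_mono) (auto simp: distrib_right)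
  have le2: "K3 * (K2 * growth t) / q \<le> K * growth t / q" if "q > 0" for q t
    using that K0(1) K1(1) growth_ge_1[of t] unfolding K_def by (intro divide_right_mono) (auto simp: distrib_right)
  show thesis
  proof (rule that[of K])
    show "K \<ge> 0" using K0 K1 K2 K3 by (simp add: K_def)
    have pos: "(1 + norm z) ^ 8 > 0" for z :: "R3 \<times> R3" by (intro zero_less_power add_pos_nonneg) auto
    show "\<bar>g t z\<bar> \<le> K * growth t / (1 + norm z) ^ 8" for t z
      by (rule order_trans[OF g200 order_trans[OF weaken le1[OF pos]]])
    show "\<bar>pd j (g t) z\<bar> \<le> K * growth t / (1 + norm z) ^ 8" if "j \<in> Basis" for t z j
      by (rule order_trans[OF pd200[OF that] order_trans[OF weaken le1[OF pos]]])
    show "\<bar>LINT z|lborel. g t z * cos (phase a t \<xi> z + \<sigma>)\<bar> \<le> K * growth t / (1 + \<bar>t\<bar> * norm \<xi>) ^ 7" for t \<xi> \<sigma>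
    proof -
      have p: "(1 + \<bar>t\<bar> * norm \<xi>) ^ 7 > 0" by (intro zero_less_power add_pos_nonneg) auto
      show ?thesis
        using K3(2)[OF fam, of t t \<xi> \<sigma>] le2[OF p, of t] by (simp add: G_def)
    qed
  qed
qed

end

section \<open>The force field on the Fourier side\<close>

text \<open>The chord is at most the arc, via 2 - 2 cos u = 4 sin^2(u/2). This provides the majorant
  for difference quotients under the Fourier inversion integral.\<close>

lemma norm_cis_minus_1_le: "norm (cis u - 1) \<le> \<bar>u\<bar>"
proof -
  have "cos u = 1 - 2 * (sin (u / 2))\<^sup>2" using cos_double_sin[of "u / 2"] by simp
  moreover have "(sin (u / 2))\<^sup>2 \<le> (u / 2)\<^sup>2"
    using abs_sin_x_le_abs_x[of "u / 2"] unfolding abs_le_square_iff .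
  ultimately have "2 - 2 * cos u \<le> u\<^sup>2" by (simp add: power2_eq_square)
  moreover have "(norm (cis u - 1))\<^sup>2 = (cos u - 1)\<^sup>2 + (sin u)\<^sup>2" by (simp add: cmod_power2)
  moreover have "(cos u - 1)\<^sup>2 + (sin u)\<^sup>2 = 2 - 2 * cos u"
    using sin_cos_squared_add[of u] by (simp add: power2_eq_square algebra_simps)
  ultimately have "(norm (cis u - 1))\<^sup>2 \<le> (\<bar>u\<bar>)\<^sup>2" by simp
  then show ?thesis by (rule power2_le_imp_le) simp
qed

lemma cis_difference_quotient:
  assumes s: "s \<longlonglongrightarrow> 0" "\<And>n. s n \<noteq> (0::real)"
  shows "(\<lambda>n. (cis (s n * r) - 1) / of_real (s n)) \<longlonglongrightarrow> \<i> * of_real r"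
proof -
  have "((\<lambda>h. exp (\<i> * of_real r * h)) has_field_derivative \<i> * of_real r) (at 0)"
    by (auto intro!: derivative_eq_intros)
  then have D: "((\<lambda>h. (exp (\<i> * of_real r * h) - 1) / h) \<longlongrightarrow> \<i> * of_real r) (at 0)"
    by (simp add: DERIV_def)
  have "filterlim (\<lambda>n. complex_of_real (s n)) (at 0) sequentially"
    unfolding filterlim_at using s tendsto_of_real[OF s(1), where 'a=complex] by (auto intro!: always_eventually)
  from filterlim_compose[OF D this]
  show ?thesis by (simp add: cis_conv_exp mult_ac)
qed

lemma cis_measurable: "continuous_on UNIV u \<Longrightarrow> (\<lambda>x::'a::euclidean_space. cis (u x)) \<in> borel_measurable borel"
  by (intro borel_measurable_continuous_onI continuous_intros)

lemma continuous_pair_measurable: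
  fixes h :: "'a::euclidean_space \<times> 'b::euclidean_space \<Rightarrow> 'c::topological_space"
  assumes "continuous_on UNIV h"
  shows "h \<in> borel_measurable (lborel \<Otimes>\<^sub>M lborel)"
  unfolding lborel_prod using borel_measurable_continuous_onI[OF assms] by simp

text \<open>The real and imaginary parts are the shifts 0 and -pi/2 of one cosine integral, so an
  estimate uniform in the shift bounds the modulus.\<close>

lemma norm_integral_cis_le:
  fixes u :: "'a::euclidean_space \<Rightarrow> real"
  assumes u: "integrable lborel u" and th: "continuous_on UNIV \<theta>"
    and C: "\<And>\<sigma>. \<bar>LINT x|lborel. u x * cos (\<theta> x + \<sigma>)\<bar> \<le> C"
  shows "norm (LINT x|lborel. cis (\<theta> x) * of_real (u x)) \<le> 2 * C"
proof -
  let ?f = "\<lambda>x. cis (\<theta> x) * of_real (u x)"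
  have i: "integrable lborel ?f"
    by (rule Bochner_Integration.integrable_bound[OF u])
      (use u th in \<open>auto simp: norm_mult intro!: borel_measurable_times cis_measurable\<close>)
  have "Re (LINT x|lborel. ?f x) = (LINT x|lborel. u x * cos (\<theta> x + 0))"
    using integral_Re[OF i] by (simp add: mult.commute)
  moreover have "Im (LINT x|lborel. ?f x) = (LINT x|lborel. u x * cos (\<theta> x + - (pi / 2)))"
    using integral_Im[OF i] by (simp add: mult.commute cos_diff)
  ultimately show ?thesis
    using cmod_le[of "LINT x|lborel. ?f x"] C[of 0] C[of "- (pi / 2)"] by linarith
qed

context vp_solution
begin

text \<open>A constant fixed by choice can be named throughout the locale; it is uniform in time and
  frequency.\<close>

definition \<kappa> :: real where
  "\<kappa> = (SOME K. K \<ge> 0 \<and> (\<forall>t z. \<bar>g t z\<bar> \<le> K * growth t / (1 + norm z) ^ 8) \<and>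
    (\<forall>t z. \<forall>j\<in>Basis. \<bar>pd j (g t) z\<bar> \<le> K * growth t / (1 + norm z) ^ 8) \<and>
    (\<forall>t \<xi> \<sigma>. \<bar>LINT z|lborel. g t z * cos (phase a t \<xi> z + \<sigma>)\<bar> \<le> K * growth t / (1 + \<bar>t\<bar> * norm \<xi>) ^ 7))"

lemma
  shows \<kappa>_nonneg: "\<kappa> \<ge> 0"
    and g_bound: "\<bar>g t z\<bar> \<le> \<kappa> * growth t / (1 + norm z) ^ 8"
    and pd_g_Basis_bound: "j \<in> Basis \<Longrightarrow> \<bar>pd j (g t) z\<bar> \<le> \<kappa> * growth t / (1 + norm z) ^ 8"
    and g_oscillation: "\<bar>LINT z|lborel. g t z * cos (phase a t \<xi> z + \<sigma>)\<bar> \<le> \<kappa> * growth t / (1 + \<bar>t\<bar> * norm \<xi>) ^ 7"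
proof -
  have "\<exists>K. K \<ge> 0 \<and> (\<forall>t z. \<bar>g t z\<bar> \<le> K * growth t / (1 + norm z) ^ 8) \<and>
    (\<forall>t z. \<forall>j\<in>Basis. \<bar>pd j (g t) z\<bar> \<le> K * growth t / (1 + norm z) ^ 8) \<and>
    (\<forall>t \<xi> \<sigma>. \<bar>LINT z|lborel. g t z * cos (phase a t \<xi> z + \<sigma>)\<bar> \<le> K * growth t / (1 + \<bar>t\<bar> * norm \<xi>) ^ 7)"
  proof (rule profile_bounds)
    fix K assume K: "K \<ge> 0" "\<And>t z. \<bar>g t z\<bar> \<le> K * growth t / (1 + norm z) ^ 8"
      "\<And>t z j. j \<in> Basis \<Longrightarrow> \<bar>pd j (g t) z\<bar> \<le> K * growth t / (1 + norm z) ^ 8"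
      "\<And>t \<xi> \<sigma>. \<bar>LINT z|lborel. g t z * cos (phase a t \<xi> z + \<sigma>)\<bar> \<le> K * growth t / (1 + \<bar>t\<bar> * norm \<xi>) ^ 7"
    show ?thesis by (rule exI[of _ K], intro conjI allI ballI K)
  qed
  from someI_ex[OF this, folded \<kappa>_def]
  show "\<kappa> \<ge> 0" "\<bar>g t z\<bar> \<le> \<kappa> * growth t / (1 + norm z) ^ 8"
    "j \<in> Basis \<Longrightarrow> \<bar>pd j (g t) z\<bar> \<le> \<kappa> * growth t / (1 + norm z) ^ 8"
    "\<bar>LINT z|lborel. g t z * cos (phase a t \<xi> z + \<sigma>)\<bar> \<le> \<kappa> * growth t / (1 + \<bar>t\<bar> * norm \<xi>) ^ 7"
    by blast+
qed

definition \<gamma> :: "real \<Rightarrow> real" where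
  "\<gamma> t = \<kappa> * growth t"

lemma \<gamma>_nonneg: "\<gamma> t \<ge> 0"
  using \<kappa>_nonneg growth_ge_1[of t] by (simp add: \<gamma>_def)

lemma pd_g_bound: "\<bar>pd h (g t) z\<bar> \<le> 6 * norm h * (\<gamma> t / (1 + norm z) ^ 8)"
proof -
  have "\<bar>pd h (g t) z\<bar> = \<bar>\<Sum>b\<in>Basis. (h \<bullet> b) * pd b (g t) z\<bar>"
    by (subst pd_linear_combination[OF g_differentiable]) (rule refl)
  also have "\<dots> \<le> (\<Sum>b\<in>Basis. \<bar>(h \<bullet> b) * pd b (g t) z\<bar>)" by (rule sum_abs)
  also have "\<dots> \<le> (\<Sum>b\<in>(Basis :: (R3 \<times> R3) set). norm h * (\<gamma> t / (1 + norm z) ^ 8))"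
    unfolding abs_mult by (intro sum_mono mult_mono Basis_le_norm)
      (use pd_g_Basis_bound in \<open>auto simp: \<gamma>_def\<close>)
  finally show ?thesis by simp
qed

section \<open>Slices of the profile at fixed velocity, and the density\<close>

definition I4 :: real where "I4 = (LINT y::R3|lborel. 1 / (1 + norm y) ^ 4)"

lemma integrable_I4: "integrable lborel (\<lambda>y::R3. 1 / (1 + norm y) ^ 4)"
  by (rule integrable_decay) simp

lemma I4_nonneg: "I4 \<ge> 0"
  unfolding I4_def by simp

lemma slice_decay: "1 / (1 + norm (y, v)) ^ 8 \<le> 1 / (1 + norm y) ^ 4" for y v :: R3
proof -
  have "1 / (1 + norm (y, v)) ^ 8 \<le> 1 / (1 + norm (y, v)) ^ 4" by (rule decay_mono) simp
  also have "\<dots> \<le> 1 / (1 + norm y) ^ 4"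
    by (rule divide_left_mono)
      (use norm_fst_le[of y v] in \<open>auto intro!: power_mono mult_pos_pos zero_less_power add_pos_nonneg\<close>)
  finally show ?thesis .
qed

lemma slice_continuous: "continuous_on S (\<lambda>y. g t (y, v))"
  by (rule continuous_on_compose2[OF g_continuous[of UNIV]]) (auto intro!: continuous_intros)

lemma pd_slice_continuous: "continuous_on S (\<lambda>y. pd h (g t) (y, v))"
  by (rule continuous_on_compose2[OF pd_g_continuous[of UNIV]]) (auto intro!: continuous_intros)

lemma decay_dominated:
  fixes u :: "R3 \<Rightarrow> real"
  assumes "u \<in> borel_measurable borel" "\<And>y. \<bar>u y\<bar> \<le> C * (1 / (1 + norm y) ^ 4)"
  shows "integrable lborel u" "(LINT y|lborel. \<bar>u y\<bar>) \<le> C * I4"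
proof -
  have i: "integrable lborel (\<lambda>y::R3. C * (1 / (1 + norm y) ^ 4))" by (intro integrable_mult_right integrable_I4)
  show u: "integrable lborel u"
    by (rule Bochner_Integration.integrable_bound[OF i]) (use assms order_trans[OF assms(2) abs_ge_self] in auto)
  have "(LINT y|lborel. \<bar>u y\<bar>) \<le> (LINT y::R3|lborel. C * (1 / (1 + norm y) ^ 4))"
    by (rule integral_mono[OF integrable_abs[OF u] i assms(2)])
  then show "(LINT y|lborel. \<bar>u y\<bar>) \<le> C * I4" unfolding I4_def by (simp only: integral_mult_right_zero)
qed

lemma slice_bound: "\<bar>g t (y, v)\<bar> \<le> \<gamma> t * (1 / (1 + norm y) ^ 4)"
  using order_trans[OF g_bound[of t "(y, v)"]] mult_left_mono[OF slice_decay[of y v] \<gamma>_nonneg[of t]]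
  by (simp add: \<gamma>_def)

lemma pd_slice_bound: "\<bar>pd h (g t) (y, v)\<bar> \<le> (6 * norm h * \<gamma> t) * (1 / (1 + norm y) ^ 4)"
proof -
  have "6 * norm h * (\<gamma> t / (1 + norm (y, v)) ^ 8) = (6 * norm h * \<gamma> t) * (1 / (1 + norm (y, v)) ^ 8)" by simp
  also have "\<dots> \<le> (6 * norm h * \<gamma> t) * (1 / (1 + norm y) ^ 4)"
    by (rule mult_left_mono[OF slice_decay]) (simp add: \<gamma>_nonneg)
  finally show ?thesis using pd_g_bound[of h t "(y, v)"] by linarith
qed

lemma slice_integrable: "integrable lborel (\<lambda>y. g t (y, v))" "(LINT y|lborel. \<bar>g t (y, v)\<bar>) \<le> \<gamma> t * I4"
  by (rule decay_dominated[OF borel_measurable_continuous_onI[OF slice_continuous] slice_bound])+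

lemma pd_slice_integrable: "integrable lborel (\<lambda>y. pd h (g t) (y, v))"
    "(LINT y|lborel. \<bar>pd h (g t) (y, v)\<bar>) \<le> (6 * norm h * \<gamma> t) * I4"
  by (rule decay_dominated[OF borel_measurable_continuous_onI[OF pd_slice_continuous] pd_slice_bound])+

lemma f_eq_g: "f t x v = g t (x - t *\<^sub>R a v, v)"
  by (simp add: g_def profile_def)

lemma g_integrable: "integrable lborel (g t)"
proof (rule Bochner_Integration.integrable_bound)
  show "integrable lborel (\<lambda>z::R3 \<times> R3. \<gamma> t * (1 / (1 + norm z) ^ 8))"
    by (intro integrable_mult_right integrable_decay) simp
  show "AE z in lborel. norm (g t z) \<le> norm (\<gamma> t * (1 / (1 + norm z) ^ 8))"
    using g_bound[of t] \<gamma>_nonneg[of t] by (intro AE_I2) (simp add: \<gamma>_def)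
qed simp

lemma phase_continuous: "continuous_on S (phase a t \<xi>)"
  by (rule smooth_continuous[OF symb_smooth[OF symb_phase[OF nd]]])

lemma f_continuous: "continuous_on S (\<lambda>p. f (t1 p) (x1 p) (v1 p))"
  if "continuous_on S t1" "continuous_on S x1" "continuous_on S v1"
  using continuous_on_compose2[OF C1_continuous[OF C1_F, of UNIV] continuous_on_Pair[OF that(1) continuous_on_Pair[OF that(2,3)]]]
  by (simp add: F_def)

text \<open>Substitute x = y + t a(v) at fixed v. Fubini is justified with v outside: the inner
  absolute integral is then, by translation invariance, that of a slice of the profile, and the
  decay of slices in v makes the outer one finite.\<close>

lemma fourier_density:
  "fourier (density f t) \<xi> = (LINT z|lborel. cis (- phase a t \<xi> z) * of_real (g t z))"
proof -
  let ?\<Phi> = "\<lambda>v x. cis (- (\<xi> \<bullet> x)) * complex_of_real (f t x v)"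
  let ?\<Psi> = "\<lambda>y v. cis (- phase a t \<xi> (y, v)) * complex_of_real (g t (y, v))"
  have shift: "?\<Phi> v (y + t *\<^sub>R a v) = ?\<Psi> y v" for v y
    by (simp add: f_eq_g phase_def inner_add_right)
  have shift': "?\<Phi> v x = ?\<Psi> (x + - (t *\<^sub>R a v)) v" for v x
    using shift[where v=v and y="x + - (t *\<^sub>R a v)"] by simp
  have \<Psi>int: "integrable lborel (\<lambda>y. ?\<Psi> y v)" for v
  proof (rule Bochner_Integration.integrable_bound[OF slice_integrable(1)[of t v]])
    show "(\<lambda>y. ?\<Psi> y v) \<in> borel_measurable lborel"
    proof -
      have "continuous_on UNIV (\<lambda>y. phase a t \<xi> (y, v))"
        by (rule continuous_on_compose2[OF phase_continuous[of UNIV]]) (auto intro!: continuous_intros)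
      then have "continuous_on UNIV (\<lambda>y. ?\<Psi> y v)" by (intro continuous_intros slice_continuous)
      then show ?thesis using borel_measurable_continuous_onI by simp
    qed
  qed (simp add: norm_mult)
  have meas: "(\<lambda>(v, x). ?\<Phi> v x) \<in> borel_measurable (lborel \<Otimes>\<^sub>M lborel)"
    unfolding case_prod_beta
    by (intro continuous_pair_measurable continuous_intros f_continuous)
  have "integrable (lborel \<Otimes>\<^sub>M lborel) (\<lambda>(v, x). ?\<Phi> v x)"
  proof (rule lborel_pair.Fubini_integrable[OF meas])
    show "AE v in lborel. integrable lborel (\<lambda>x. case (v, x) of (v, x) \<Rightarrow> ?\<Phi> v x)"
      unfolding prod.case shift' by (intro AE_I2 integrable_translate \<Psi>int)
    have eq: "(LINT x|lborel. norm (?\<Phi> v x)) = (LINT y|lborel. \<bar>g t (y, v)\<bar>)" for v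
      unfolding shift' by (subst integral_translate[of "\<lambda>y. norm (?\<Psi> y v)"]) (simp add: norm_mult)
    show "integrable lborel (\<lambda>v. LINT x|lborel. norm (case (v, x) of (v, x) \<Rightarrow> ?\<Phi> v x))"
    proof (rule decay_dominated(1))
      have "(\<lambda>(v, x). norm (?\<Phi> v x)) \<in> borel_measurable (lborel \<Otimes>\<^sub>M lborel)"
        unfolding case_prod_beta
        by (intro continuous_pair_measurable continuous_intros f_continuous)
      from lborel.borel_measurable_lebesgue_integral[OF this]
      show "(\<lambda>v. LINT x|lborel. norm (case (v, x) of (v, x) \<Rightarrow> ?\<Phi> v x)) \<in> borel_measurable borel" by simp
      fix v :: R3
      have "\<bar>g t (y, v)\<bar> \<le> (\<gamma> t * (1 / (1 + norm v) ^ 4)) * (1 / (1 + norm y) ^ 4)" for y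
        using order_trans[OF g_bound[of t "(y, v)"]] mult_left_mono[OF decay_split[of "(y, v)"] \<gamma>_nonneg[of t]]
        by (simp add: \<gamma>_def mult_ac)
      from decay_dominated(2)[OF borel_measurable_continuous_onI[OF slice_continuous] this]
      show "\<bar>LINT x|lborel. norm (case (v, x) of (v, x) \<Rightarrow> ?\<Phi> v x)\<bar> \<le> (\<gamma> t * I4) * (1 / (1 + norm v) ^ 4)"
        unfolding prod.case eq by (simp add: mult_ac)
    qed
  qed
  then have Fub: "(LINT x|lborel. LINT v|lborel. ?\<Phi> v x) = (LINT v|lborel. LINT x|lborel. ?\<Phi> v x)"
    by (rule lborel_pair.Fubini_integral)
  have "fourier (density f t) \<xi> = (LINT x|lborel. LINT v|lborel. ?\<Phi> v x)"
    unfolding fourier_def density_def by simp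
  also have "\<dots> = (LINT v|lborel. LINT y|lborel. ?\<Psi> y v)"
    unfolding Fub
  proof (rule Bochner_Integration.integral_cong[OF refl])
    fix v
    show "(LINT x|lborel. ?\<Phi> v x) = (LINT y|lborel. ?\<Psi> y v)"
      unfolding shift' by (rule integral_translate[of "\<lambda>y. ?\<Psi> y v"])
  qed
  also have "\<dots> = integral\<^sup>L (lborel \<Otimes>\<^sub>M lborel) (\<lambda>(y, v). ?\<Psi> y v)"
  proof (rule lborel_pair.integral_snd)
    have "integrable lborel (\<lambda>z. cis (- phase a t \<xi> z) * complex_of_real (g t z))"
      by (rule Bochner_Integration.integrable_bound[OF g_integrable])
        (auto simp: norm_mult intro!: borel_measurable_times cis_measurable continuous_intros phase_continuous)
    then show "integrable (lborel \<Otimes>\<^sub>M lborel) (\<lambda>(y, v). ?\<Psi> y v)"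
      unfolding lborel_prod case_prod_beta by simp
  qed
  finally show ?thesis unfolding lborel_prod case_prod_beta by simp
qed

lemma fourier_density_bound: "norm (fourier (density f t) \<xi>) \<le> 2 * (\<gamma> t / (1 + \<bar>t\<bar> * norm \<xi>) ^ 7)"
  unfolding fourier_density
proof (rule norm_integral_cis_le[OF g_integrable])
  show "continuous_on UNIV (\<lambda>z. - phase a t \<xi> z)" by (intro continuous_intros phase_continuous)
  fix \<sigma>
  have "cos (- phase a t \<xi> z + \<sigma>) = cos (phase a t \<xi> z + - \<sigma>)" for z
    by (metis cos_minus minus_add_distrib minus_minus)
  then show "\<bar>LINT z|lborel. g t z * cos (- phase a t \<xi> z + \<sigma>)\<bar> \<le> \<gamma> t / (1 + \<bar>t\<bar> * norm \<xi>) ^ 7"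
    using g_oscillation[of t \<xi> "- \<sigma>"] by (simp add: \<gamma>_def)
qed

section \<open>The potential and its gradient by Fourier inversion\<close>

definition potential_hat :: "real \<Rightarrow> R3 \<Rightarrow> complex" where
  "potential_hat t \<xi> = - fourier (density f t) \<xi> / of_real ((norm \<xi>)\<^sup>2)"

lemma potential_hat_integrable: "integrable lborel (potential_hat t)"
  using vp unfolding vlasov_poisson_def newtonian_potential_def potential_hat_def[abs_def] by blast

lemma potential_inversion:
  "of_real (\<phi> t x) = of_real (1 / (2 * pi) ^ 3) * (LINT \<xi>|lborel. cis (\<xi> \<bullet> x) * potential_hat t \<xi>)"
  using vp unfolding vlasov_poisson_def newtonian_potential_def potential_hat_def by blast

lemma potential_differentiable: "\<phi> t differentiable (at x)"
  using vp by (auto simp: vlasov_poisson_def twice_differentiable_def differentiable_on_def)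

lemma potential_hat_bound: "norm \<xi> * norm (potential_hat t \<xi>) \<le> 2 * \<gamma> t * (1 / (norm \<xi> * (1 + \<bar>t\<bar> * norm \<xi>) ^ 7))"
proof (cases "\<xi> = 0")
  case False
  have "norm \<xi> * norm (potential_hat t \<xi>) = norm (fourier (density f t) \<xi>) / norm \<xi>"
    using False by (simp add: potential_hat_def norm_divide norm_mult power2_eq_square)
  also have "\<dots> \<le> 2 * (\<gamma> t / (1 + \<bar>t\<bar> * norm \<xi>) ^ 7) / norm \<xi>"
    by (intro divide_right_mono fourier_density_bound) simp
  also have "\<dots> = 2 * \<gamma> t * (1 / (norm \<xi> * (1 + \<bar>t\<bar> * norm \<xi>) ^ 7))" by (simp add: mult.commute)
  finally show ?thesis .
qed simp

definition J :: "nat \<Rightarrow> real" where "J k = (LINT \<xi>::R3|lborel. 1 / (norm \<xi> * (1 + norm \<xi>) ^ k))"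

lemma J_nonneg: "J k \<ge> 0"
  unfolding J_def by simp

text \<open>Rescaling \<xi> by |t| gives |t|^(-3) from the volume and |t| from the singular factor.
  This is where the dispersive rate t^(-2) arises.\<close>

lemma scaled_kernel:
  assumes t: "t \<noteq> 0" and k: "k > 3"
  shows "integrable lborel (\<lambda>\<xi>::R3. 1 / (norm \<xi> * (1 + \<bar>t\<bar> * norm \<xi>) ^ k))"
    and "(LINT \<xi>::R3|lborel. 1 / (norm \<xi> * (1 + \<bar>t\<bar> * norm \<xi>) ^ k)) = J k / t\<^sup>2"
proof -
  let ?h = "\<lambda>\<xi>::R3. 1 / (norm \<xi> * (1 + norm \<xi>) ^ k)"
  have eq: "1 / (norm \<xi> * (1 + \<bar>t\<bar> * norm \<xi>) ^ k) = \<bar>t\<bar> * ?h (\<bar>t\<bar> *\<^sub>R \<xi>)" for \<xi> :: R3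
    using t by simp
  note h = integrable_inverse_norm_decay[OF k]
  have t': "\<bar>t\<bar> > 0" using t by simp
  show "integrable lborel (\<lambda>\<xi>::R3. 1 / (norm \<xi> * (1 + \<bar>t\<bar> * norm \<xi>) ^ k))"
    unfolding eq by (rule integrable_mult_right[OF integrable_scale_integral(1)[OF h t']])
  have "(LINT \<xi>::R3|lborel. 1 / (norm \<xi> * (1 + \<bar>t\<bar> * norm \<xi>) ^ k)) = \<bar>t\<bar> * (J k / \<bar>t\<bar> ^ 3)"
    unfolding eq integral_mult_right_zero integrable_scale_integral(2)[OF h t'] J_def by simp
  also have "\<dots> = J k / t\<^sup>2" using t by (simp add: power2_eq_square power3_eq_cube)
  finally show "(LINT \<xi>::R3|lborel. 1 / (norm \<xi> * (1 + \<bar>t\<bar> * norm \<xi>) ^ k)) = J k / t\<^sup>2" .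
qed

lemma force_hat_measurable: "(\<lambda>\<xi>. (\<i> * of_real (\<xi> \<bullet> b)) * potential_hat t \<xi>) \<in> borel_measurable borel"
proof -
  have "(\<lambda>\<xi>::R3. complex_of_real (\<xi> \<bullet> b)) \<in> borel_measurable borel"
    by (intro borel_measurable_continuous_onI continuous_intros)
  moreover have "potential_hat t \<in> borel_measurable borel"
    using borel_measurable_integrable[OF potential_hat_integrable] by simp
  ultimately show ?thesis by (intro borel_measurable_times borel_measurable_const)
qed

lemma force_hat_bound:
  assumes "b \<in> Basis"
  shows "norm ((\<i> * of_real (\<xi> \<bullet> b)) * potential_hat t \<xi>) \<le> 2 * \<gamma> t * (1 / (norm \<xi> * (1 + \<bar>t\<bar> * norm \<xi>) ^ 7))"
proof -
  have "norm ((\<i> * of_real (\<xi> \<bullet> b)) * potential_hat t \<xi>) = \<bar>\<xi> \<bullet> b\<bar> * norm (potential_hat t \<xi>)"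
    by (simp add: norm_mult)
  also have "\<dots> \<le> norm \<xi> * norm (potential_hat t \<xi>)"
    by (intro mult_right_mono Basis_le_norm assms) simp
  finally show ?thesis using potential_hat_bound[of \<xi> t] by linarith
qed

lemma force_hat_integrable:
  assumes "t \<noteq> 0" "b \<in> Basis"
  shows "integrable lborel (\<lambda>\<xi>. (\<i> * of_real (\<xi> \<bullet> b)) * potential_hat t \<xi>)"
    and "(LINT \<xi>|lborel. norm ((\<i> * of_real (\<xi> \<bullet> b)) * potential_hat t \<xi>)) \<le> 2 * \<gamma> t * (J 7 / t\<^sup>2)"
proof -
  have i: "integrable lborel (\<lambda>\<xi>::R3. 2 * \<gamma> t * (1 / (norm \<xi> * (1 + \<bar>t\<bar> * norm \<xi>) ^ 7)))"
    by (intro integrable_mult_right scaled_kernel assms) simp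
  show h: "integrable lborel (\<lambda>\<xi>. (\<i> * of_real (\<xi> \<bullet> b)) * potential_hat t \<xi>)"
    by (rule Bochner_Integration.integrable_bound[OF i])
      (use force_hat_measurable order_trans[OF force_hat_bound[OF assms(2)] abs_ge_self] in \<open>auto intro!: AE_I2\<close>)
  have "(LINT \<xi>|lborel. norm ((\<i> * of_real (\<xi> \<bullet> b)) * potential_hat t \<xi>))
      \<le> (LINT \<xi>::R3|lborel. 2 * \<gamma> t * (1 / (norm \<xi> * (1 + \<bar>t\<bar> * norm \<xi>) ^ 7)))"
    by (rule integral_mono[OF integrable_norm[OF h] i force_hat_bound[OF assms(2)]])
  then show "(LINT \<xi>|lborel. norm ((\<i> * of_real (\<xi> \<bullet> b)) * potential_hat t \<xi>)) \<le> 2 * \<gamma> t * (J 7 / t\<^sup>2)"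
    using scaled_kernel(2)[OF assms(1), of 7] by (simp only: integral_mult_right_zero)
qed

text \<open>Differentiation under the inversion integral. Since the potential is known to be
  differentiable, a single sequence of increments identifies the derivative, and dominated
  convergence for sequences is enough. The integrability of the majorant comes from the decay in
  |t||\<xi>|, hence t \<noteq> 0.\<close>

lemma force_inversion:
  assumes t: "t \<noteq> 0" and b: "b \<in> Basis"
  shows "of_real (pd b (\<phi> t) x) = of_real (1 / (2 * pi) ^ 3) *
    (LINT \<xi>|lborel. cis (\<xi> \<bullet> x) * ((\<i> * of_real (\<xi> \<bullet> b)) * potential_hat t \<xi>))"
proof -
  define s where "s = (\<lambda>n. 1 / real (Suc n))"
  have s: "s \<longlonglongrightarrow> 0" "\<And>n. s n \<noteq> 0" "\<And>n. s n > 0"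
    using LIMSEQ_inverse_real_of_nat unfolding s_def by (simp_all add: divide_inverse)
  have quot: "(\<lambda>n. (\<phi> t (x + s n *\<^sub>R b) - \<phi> t x) / s n) \<longlonglongrightarrow> pd b (\<phi> t) x"
  proof -
    have "((\<lambda>r. \<phi> t (x + r *\<^sub>R b)) has_real_derivative pd b (\<phi> t) (x + 0 *\<^sub>R b)) (at 0)"
      by (rule has_real_derivative_line[OF potential_differentiable])
    then have D: "((\<lambda>r. (\<phi> t (x + r *\<^sub>R b) - \<phi> t x) / r) \<longlongrightarrow> pd b (\<phi> t) x) (at 0)"
      by (simp add: DERIV_def)
    have "filterlim s (at 0) sequentially"
      unfolding filterlim_at using s by (auto intro!: always_eventually)
    from filterlim_compose[OF D this] show ?thesis .
  qed
  let ?m = "potential_hat t"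
  let ?S = "\<lambda>n \<xi>. cis (\<xi> \<bullet> x) * (((cis (s n * (\<xi> \<bullet> b)) - 1) / of_real (s n)) * ?m \<xi>)"
  have m: "?m \<in> borel_measurable borel"
    using borel_measurable_integrable[OF potential_hat_integrable] by simp
  have cm: "(\<lambda>\<xi>::R3. cis (\<xi> \<bullet> y)) \<in> borel_measurable borel" for y
    by (intro cis_measurable continuous_intros)
  have i: "integrable lborel (\<lambda>\<xi>. cis (\<xi> \<bullet> y) * ?m \<xi>)" for y
    by (rule Bochner_Integration.integrable_bound[OF potential_hat_integrable])
      (use m cm in \<open>auto simp: norm_mult\<close>)
  have S_eq: "of_real ((\<phi> t (x + s n *\<^sub>R b) - \<phi> t x) / s n) = of_real (1 / (2 * pi) ^ 3) * (LINT \<xi>|lborel. ?S n \<xi>)" for n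
  proof -
    have "(LINT \<xi>|lborel. ?S n \<xi>) = (LINT \<xi>|lborel. (cis (\<xi> \<bullet> (x + s n *\<^sub>R b)) * ?m \<xi> - cis (\<xi> \<bullet> x) * ?m \<xi>) / of_real (s n))"
      by (intro Bochner_Integration.integral_cong refl)
        (simp add: inner_add_right cis_mult[symmetric] diff_divide_distrib algebra_simps)
    also have "\<dots> = ((LINT \<xi>|lborel. cis (\<xi> \<bullet> (x + s n *\<^sub>R b)) * ?m \<xi>) - (LINT \<xi>|lborel. cis (\<xi> \<bullet> x) * ?m \<xi>)) / of_real (s n)"
      using i[of "x + s n *\<^sub>R b"] i[of x] by simp
    finally show ?thesis
      by (simp add: potential_inversion right_diff_distrib diff_divide_distrib)
  qed
  have "(\<lambda>n. LINT \<xi>|lborel. ?S n \<xi>) \<longlonglongrightarrow> (LINT \<xi>|lborel. cis (\<xi> \<bullet> x) * ((\<i> * of_real (\<xi> \<bullet> b)) * ?m \<xi>))"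
  proof (rule integral_dominated_convergence)
    show "integrable lborel (\<lambda>\<xi>. norm ((\<i> * of_real (\<xi> \<bullet> b)) * ?m \<xi>))"
      by (rule integrable_norm[OF force_hat_integrable(1)[OF t b]])
    show "(\<lambda>\<xi>. cis (\<xi> \<bullet> x) * ((\<i> * of_real (\<xi> \<bullet> b)) * ?m \<xi>)) \<in> borel_measurable lborel"
      using borel_measurable_times[OF cm[of x] force_hat_measurable] by simp
    show "?S n \<in> borel_measurable lborel" for n
    proof -
      have "(\<lambda>\<xi>. (cis (s n * (\<xi> \<bullet> b)) - 1) / of_real (s n)) \<in> borel_measurable borel"
        using s(2) by (intro borel_measurable_continuous_onI continuous_intros) auto
      from borel_measurable_times[OF cm[of x] borel_measurable_times[OF this m]]
      show ?thesis by (simp only: measurable_lborel2)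
    qed
    show "AE \<xi> in lborel. (\<lambda>n. ?S n \<xi>) \<longlonglongrightarrow> cis (\<xi> \<bullet> x) * ((\<i> * of_real (\<xi> \<bullet> b)) * ?m \<xi>)"
      by (intro AE_I2 tendsto_mult tendsto_const cis_difference_quotient s)
    show "AE \<xi> in lborel. norm (?S n \<xi>) \<le> norm ((\<i> * of_real (\<xi> \<bullet> b)) * ?m \<xi>)" for n
    proof (intro AE_I2)
      fix \<xi>
      have "norm ((cis (s n * (\<xi> \<bullet> b)) - 1) / of_real (s n)) \<le> \<bar>\<xi> \<bullet> b\<bar>"
        using norm_cis_minus_1_le[of "s n * (\<xi> \<bullet> b)"] s(3)[of n]
        by (simp add: norm_divide abs_mult pos_divide_le_eq mult.commute)
      from mult_right_mono[OF this norm_ge_zero[of "?m \<xi>"]]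
      show "norm (?S n \<xi>) \<le> norm ((\<i> * of_real (\<xi> \<bullet> b)) * ?m \<xi>)"
        by (simp only: norm_mult norm_cis norm_ii norm_of_real mult_1)
    qed
  qed
  then have "(\<lambda>n. of_real ((\<phi> t (x + s n *\<^sub>R b) - \<phi> t x) / s n)) \<longlonglongrightarrow> of_real (1 / (2 * pi) ^ 3) *
      (LINT \<xi>|lborel. cis (\<xi> \<bullet> x) * ((\<i> * of_real (\<xi> \<bullet> b)) * ?m \<xi>))"
    unfolding S_eq by (intro tendsto_mult tendsto_const)
  moreover have "(\<lambda>n. complex_of_real ((\<phi> t (x + s n *\<^sub>R b) - \<phi> t x) / s n)) \<longlonglongrightarrow> of_real (pd b (\<phi> t) x)"
    by (intro tendsto_of_real quot)
  ultimately show ?thesis using LIMSEQ_unique by blast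
qed

end

section \<open>The spatial mass converges\<close>

lemma grad_inner_Basis: "b \<in> Basis \<Longrightarrow> grad u z \<bullet> b = pd b u z"
  unfolding grad_def by simp

lemma inner_grad:
  assumes "u differentiable (at z)"
  shows "h \<bullet> grad u z = pd h u z"
proof -
  have "h \<bullet> grad u z = (\<Sum>b\<in>Basis. (h \<bullet> b) * (grad u z \<bullet> b))" by (rule euclidean_inner)
  also have "\<dots> = (\<Sum>b\<in>Basis. (h \<bullet> b) * pd b u z)"
    by (rule sum.cong) (simp_all add: grad_inner_Basis)
  also have "\<dots> = pd h u z" by (rule pd_linear_combination[OF assms, symmetric])
  finally show ?thesis .
qed

text \<open>A Cauchy criterion with a rate. The limit is found along the integers; letting the later
  time in the hypothesis run through the integers then carries the rate to every real time.\<close>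

lemma powr_tail_convergent:
  fixes N :: "real \<Rightarrow> real"
  assumes N: "\<And>s t. 1 \<le> s \<Longrightarrow> s \<le> t \<Longrightarrow> \<bar>N t - N s\<bar> \<le> C * s powr (- 1 / 2)"
  obtains l where "(N \<longlongrightarrow> l) at_top"
proof -
  have C: "((\<lambda>s. C * s powr (- 1 / 2)) \<longlongrightarrow> 0) at_top"
    using tendsto_mult[OF tendsto_const tendsto_neg_powr[of "- 1 / 2" "\<lambda>x::real. x" at_top]]
    by (simp add: filterlim_ident)
  have "Cauchy (\<lambda>n. N (real n))"
  proof (rule metric_CauchyI)
    fix e :: real assume "e > 0"
    then have "\<forall>\<^sub>F s in at_top. C * s powr (- 1 / 2) < e / 2"
      using C by (intro order_tendstoD(2)) auto
    then obtain S where S: "\<And>s. s \<ge> S \<Longrightarrow> C * s powr (- 1 / 2) < e / 2"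
      unfolding eventually_at_top_linorder by blast
    obtain M where M: "real M \<ge> max 1 S" using real_arch_simple by blast
    have "dist (N (real m)) (N (real M)) < e / 2" if "m \<ge> M" for m
    proof -
      have "\<bar>N (real m) - N (real M)\<bar> \<le> C * real M powr (- 1 / 2)"
        by (rule N) (use M that in auto)
      then show ?thesis using S[of "real M"] M unfolding dist_real_def by linarith
    qed
    then have "dist (N (real m)) (N (real n)) < e" if "m \<ge> M" "n \<ge> M" for m n
      using that by (meson dist_triangle_half_l)
    then show "\<exists>M. \<forall>m\<ge>M. \<forall>n\<ge>M. dist (N (real m)) (N (real n)) < e" by blast
  qed
  then obtain l where l: "(\<lambda>n. N (real n)) \<longlonglongrightarrow> l"
    using Cauchy_convergent_iff convergent_def by blast
  have near: "\<bar>N s - l\<bar> \<le> C * s powr (- 1 / 2)" if s: "s \<ge> 1" for s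
  proof -
    have "(\<lambda>n. \<bar>N (real n) - N s\<bar>) \<longlonglongrightarrow> \<bar>l - N s\<bar>" by (intro tendsto_intros l)
    moreover obtain M where "real M \<ge> s" using real_arch_simple by blast
    then have "\<forall>n\<ge>M. \<bar>N (real n) - N s\<bar> \<le> C * s powr (- 1 / 2)"
      using N[OF s] by (meson of_nat_le_iff order_trans)
    ultimately have "\<bar>l - N s\<bar> \<le> C * s powr (- 1 / 2)"
      by (intro LIMSEQ_le_const2) blast+
    then show ?thesis by (simp add: abs_minus_commute)
  qed
  have "\<forall>\<^sub>F s in at_top. norm (N s - l) \<le> C * s powr (- 1 / 2)"
    by (rule eventually_mono[OF eventually_ge_at_top[of "1::real"]]) (use near in simp)
  then have "((\<lambda>s. N s - l) \<longlongrightarrow> 0) at_top"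
    by (rule Lim_null_comparison[OF _ C])
  then have "(N \<longlongrightarrow> l) at_top" by (simp add: LIM_zero_iff)
  then show thesis by (rule that)
qed

context vp_solution
begin

text \<open>The velocity derivative of f along \<open>b\<close> in profile coordinates: at fixed x,
  varying v moves the base point y = x - t a(v) by - t Da(v) b.\<close>

definition G :: "real \<Rightarrow> R3 \<Rightarrow> R3 \<Rightarrow> R3 \<Rightarrow> real" where
  "G t v b y = pd (- t *\<^sub>R Da v b, b) (g t) (y, v)"

text \<open>The derivative of f along free transport, which is the time derivative of the profile at
  fixed (y, v).\<close>

definition H :: "real \<Rightarrow> R3 \<Rightarrow> R3 \<Rightarrow> real" where
  "H t v y = pd (1, a v, 0) F (shear t (y, v))"

definition Dn :: "R3 \<Rightarrow> real" where
  "Dn v = (\<Sum>b\<in>Basis. norm (Da v b))"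

lemma norm_Da_le: "b \<in> Basis \<Longrightarrow> norm (Da v b) \<le> Dn v"
  unfolding Dn_def by (rule member_le_sum) auto

lemma Dn_nonneg: "Dn v \<ge> 0"
  unfolding Dn_def by (intro sum_nonneg) simp

lemma pd_F_linear: "linear (\<lambda>h. pd h F p)"
  by (rule has_derivative_linear[OF differentiable_has_derivative_pd[OF C1_differentiable[OF C1_F]]])

lemma pd_g_linear: "linear (\<lambda>h. pd h (g t) z)"
  by (rule has_derivative_linear[OF differentiable_has_derivative_pd[OF g_differentiable]])

lemma G_eq_pd_F: "G t v b y = pd (0, 0, b) F (shear t (y, v))"
  unfolding G_def pd_g by simp

text \<open>Free streaming is absorbed by the profile coordinates, so the Vlasov equation expresses
  the time derivative of the profile by the force term alone. The separate partial derivatives in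
  the equation are recovered from the jointly C^1 function \<open>F\<close> by the chain
  rule.\<close>

lemma transport: "H t v y = - \<mu> * (\<Sum>b\<in>Basis. pd b (\<phi> t) (y + t *\<^sub>R a v) * G t v b y)"
proof -
  define x where "x = y + t *\<^sub>R a v"
  have sh: "shear t (y, v) = (t, x, v)" by (simp add: shear_def x_def)
  have eq: "deriv (\<lambda>s. f s x v) t + a v \<bullet> grad (\<lambda>y. f t y v) x
      + \<mu> * (grad (\<phi> t) x \<bullet> grad (\<lambda>w. f t x w) v) = 0"
    using vp unfolding vlasov_poisson_def by blast
  have D: "(F has_derivative (\<lambda>h. pd h F (t, x, v))) (at (t, x, v))"
    by (rule differentiable_has_derivative_pd[OF C1_differentiable[OF C1_F]])
  have 1: "deriv (\<lambda>s. f s x v) t = pd (1, 0, 0) F (t, x, v)"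
  proof -
    have "((\<lambda>s. F ((0, x, v) + s *\<^sub>R (1, 0, 0))) has_real_derivative pd (1, 0, 0) F ((0, x, v) + t *\<^sub>R (1, 0, 0))) (at t)"
      by (rule has_real_derivative_line[OF C1_differentiable[OF C1_F]])
    then show ?thesis by (intro DERIV_imp_deriv) (simp add: F_def)
  qed
  have dx: "((\<lambda>y. f t y v) has_derivative (\<lambda>h. pd (0, h, 0) F (t, x, v))) (at x)"
  proof -
    have "((\<lambda>y. (t, y, v)) has_derivative (\<lambda>h. (0, h, 0))) (at x)" by (auto intro!: derivative_eq_intros)
    from has_derivative_compose[OF this D] show ?thesis by (simp add: F_def)
  qed
  have dv: "((\<lambda>w. f t x w) has_derivative (\<lambda>h. pd (0, 0, h) F (t, x, v))) (at v)"
  proof -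
    have "((\<lambda>w. (t, x, w)) has_derivative (\<lambda>h. (0, 0, h))) (at v)" by (auto intro!: derivative_eq_intros)
    from has_derivative_compose[OF this D] show ?thesis by (simp add: F_def)
  qed
  have 2: "a v \<bullet> grad (\<lambda>y. f t y v) x = pd (0, a v, 0) F (t, x, v)"
    using inner_grad[of "\<lambda>y. f t y v" x "a v"] dx pd_eqI[OF dx, of "a v"] unfolding differentiable_def by metis
  have 3: "grad (\<phi> t) x \<bullet> grad (\<lambda>w. f t x w) v = (\<Sum>b\<in>Basis. pd b (\<phi> t) x * G t v b y)"
  proof -
    have "grad (\<phi> t) x \<bullet> grad (\<lambda>w. f t x w) v
      = (\<Sum>b\<in>Basis. (grad (\<phi> t) x \<bullet> b) * (grad (\<lambda>w. f t x w) v \<bullet> b))" by (rule euclidean_inner)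
    also have "\<dots> = (\<Sum>b\<in>Basis. pd b (\<phi> t) x * G t v b y)"
      by (rule sum.cong) (simp_all add: grad_inner_Basis G_eq_pd_F sh pd_eqI[OF dv])
    finally show ?thesis .
  qed
  have "H t v y = pd (1, 0, 0) F (t, x, v) + pd (0, a v, 0) F (t, x, v)"
    using linear_add[OF pd_F_linear[of "(t, x, v)"], of "(1, 0, 0)" "(0, a v, 0)"] by (simp add: H_def sh)
  then show ?thesis using eq 1 2 3 by (simp add: x_def)
qed

lemma slice_has_derivative: "((\<lambda>y. g t (y, v)) has_derivative (\<lambda>h. pd (h, 0) (g t) (y, v))) (at y)"
proof -
  have "((\<lambda>y. (y, v)) has_derivative (\<lambda>h. (h, 0))) (at y)" by (auto intro!: derivative_eq_intros)
  from has_derivative_compose[OF this differentiable_has_derivative_pd[OF g_differentiable]] show ?thesis .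
qed

lemma cos_continuous: "continuous_on S (\<lambda>y::R3. cos (\<xi> \<bullet> y + \<sigma>))"
  by (intro continuous_intros)

lemma integrable_mult_cos:
  fixes u :: "R3 \<Rightarrow> real"
  assumes "integrable lborel u"
  shows "integrable lborel (\<lambda>y. u y * cos (\<xi> \<bullet> y + \<sigma>))"
    and "\<bar>LINT y|lborel. u y * cos (\<xi> \<bullet> y + \<sigma>)\<bar> \<le> (LINT y|lborel. \<bar>u y\<bar>)"
proof -
  have le: "\<bar>u y * cos (\<xi> \<bullet> y + \<sigma>)\<bar> \<le> \<bar>u y\<bar>" for y
    using mult_left_mono[OF abs_cos_le_one[of "\<xi> \<bullet> y + \<sigma>"], of "\<bar>u y\<bar>"] by (simp add: abs_mult)
  have "(\<lambda>y. cos (\<xi> \<bullet> y + \<sigma>)) \<in> borel_measurable borel"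
    by (rule borel_measurable_continuous_onI[OF cos_continuous])
  then show i: "integrable lborel (\<lambda>y. u y * cos (\<xi> \<bullet> y + \<sigma>))"
    by (intro Bochner_Integration.integrable_bound[OF assms]) (use assms le in auto)
  have "\<bar>LINT y|lborel. u y * cos (\<xi> \<bullet> y + \<sigma>)\<bar> \<le> (LINT y|lborel. \<bar>u y * cos (\<xi> \<bullet> y + \<sigma>)\<bar>)"
    using integral_norm_bound[of lborel "\<lambda>y. u y * cos (\<xi> \<bullet> y + \<sigma>)"] by simp
  also have "\<dots> \<le> (LINT y|lborel. \<bar>u y\<bar>)"
    by (rule integral_mono[OF integrable_abs[OF i] integrable_abs[OF assms] le])
  finally show "\<bar>LINT y|lborel. u y * cos (\<xi> \<bullet> y + \<sigma>)\<bar> \<le> (LINT y|lborel. \<bar>u y\<bar>)" .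
qed

text \<open>The growing factor \<open>t\<close> in \<open>\<nabla>\<^sub>v f\<close> multiplies an \<open>x\<close>-derivative of the profile, which becomes a factor
  \<open>\<xi>\<close> on the Fourier side; so \<open>t\<close> only enters through \<open>t |\<xi>|\<close>, and is absorbed by the decay of the density.\<close>

lemma slice_derivative_oscillation:
  "\<bar>LINT y|lborel. pd (h, 0) (g t) (y, v) * cos (\<xi> \<bullet> y + \<sigma>)\<bar> \<le> norm \<xi> * norm h * (\<gamma> t * I4)"
proof -
  let ?u = "\<lambda>y. g t (y, v)" and ?w = "\<lambda>y. cos (\<xi> \<bullet> y + \<sigma>)"
  have pdu: "pd h ?u = (\<lambda>y. pd (h, 0) (g t) (y, v))" by (rule ext, rule pd_eqI[OF slice_has_derivative])
  have W: "(?w has_derivative (\<lambda>h. - (\<xi> \<bullet> h) * sin (\<xi> \<bullet> y + \<sigma>))) (at y)" for y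
    by (auto intro!: derivative_eq_intros)
  have sin: "sin (\<xi> \<bullet> y + \<sigma>) = cos (\<xi> \<bullet> y + (\<sigma> - pi / 2))" for y
    by (simp add: cos_diff add_diff_eq)
  have pdw: "pd h ?w = (\<lambda>y. - (\<xi> \<bullet> h) * cos (\<xi> \<bullet> y + (\<sigma> - pi / 2)))"
    by (rule ext) (use pd_eqI[OF W] sin in simp)
  note i = integrable_mult_cos[OF slice_integrable(1)[of t v]]
  have uw: "(\<lambda>y. ?u y * pd h ?w y) = (\<lambda>y. - (\<xi> \<bullet> h) * (?u y * cos (\<xi> \<bullet> y + (\<sigma> - pi / 2))))"
    unfolding pdw by (rule ext) simp
  have "(LINT y|lborel. ?u y * pd h ?w y) = - (LINT y|lborel. pd h ?u y * ?w y)"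
  proof (rule integral_by_parts_pd)
    show "?u differentiable (at y)" "?w differentiable (at y)" for y
      using slice_has_derivative W unfolding differentiable_def by blast+
    show "continuous_on UNIV (pd h ?u)" unfolding pdu by (rule pd_slice_continuous)
    show "continuous_on UNIV (pd h ?w)" unfolding pdw by (intro continuous_intros)
    show "integrable lborel (\<lambda>y. ?u y * ?w y)" by (rule i(1))
    show "integrable lborel (\<lambda>y. ?u y * pd h ?w y)" unfolding uw by (intro integrable_mult_right i(1))
    show "integrable lborel (\<lambda>y. pd h ?u y * ?w y)" unfolding pdu by (rule integrable_mult_cos(1)[OF pd_slice_integrable(1)])
  qed
  then have "(LINT y|lborel. pd (h, 0) (g t) (y, v) * ?w y) = (\<xi> \<bullet> h) * (LINT y|lborel. ?u y * cos (\<xi> \<bullet> y + (\<sigma> - pi / 2)))"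
    unfolding uw integral_mult_right_zero pdu by simp
  then have "\<bar>LINT y|lborel. pd (h, 0) (g t) (y, v) * ?w y\<bar>
      = \<bar>\<xi> \<bullet> h\<bar> * \<bar>LINT y|lborel. ?u y * cos (\<xi> \<bullet> y + (\<sigma> - pi / 2))\<bar>"
    by (simp add: abs_mult)
  also have "\<dots> \<le> (norm \<xi> * norm h) * (\<gamma> t * I4)"
    by (rule mult_mono[OF Cauchy_Schwarz_ineq2 order_trans[OF i(2) slice_integrable(2)]]) auto
  finally show ?thesis .
qed

lemma G_split: "G t v b y = pd (0, b) (g t) (y, v) - t * pd (Da v b, 0) (g t) (y, v)"
proof -
  have eq: "(- t *\<^sub>R Da v b, b) = (0, b) + (- t) *\<^sub>R (Da v b, 0)" by simp
  show ?thesis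
    unfolding G_def eq linear_add[OF pd_g_linear] linear_cmul[OF pd_g_linear] by simp
qed

lemma G_continuous: "continuous_on S (G t v b)"
  unfolding G_def[abs_def] by (rule pd_slice_continuous)

lemma G_integrable: "integrable lborel (G t v b)"
  unfolding G_def[abs_def] by (rule pd_slice_integrable(1))

lemma G_oscillation:
  assumes b: "b \<in> Basis"
  shows "\<bar>LINT y|lborel. G t v b y * cos (\<xi> \<bullet> y + \<sigma>)\<bar> \<le> \<gamma> t * I4 * (6 + Dn v) * (1 + \<bar>t\<bar> * norm \<xi>)"
proof -
  let ?c = "\<lambda>y. cos (\<xi> \<bullet> y + \<sigma>)"
  let ?A = "LINT y|lborel. pd (0, b) (g t) (y, v) * ?c y" and ?B = "LINT y|lborel. pd (Da v b, 0) (g t) (y, v) * ?c y"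
  have "(\<lambda>y. G t v b y * ?c y) = (\<lambda>y. pd (0, b) (g t) (y, v) * ?c y - t * (pd (Da v b, 0) (g t) (y, v) * ?c y))"
    unfolding G_split by (rule ext) (simp add: algebra_simps)
  then have eq: "(LINT y|lborel. G t v b y * ?c y) = ?A - t * ?B"
    using integrable_mult_cos(1)[OF pd_slice_integrable(1)] by simp
  have A: "\<bar>?A\<bar> \<le> 6 * \<gamma> t * I4"
    using order_trans[OF integrable_mult_cos(2)[OF pd_slice_integrable(1)] pd_slice_integrable(2)[of "(0, b)" t v]] b by simp
  have "\<bar>?B\<bar> \<le> norm \<xi> * norm (Da v b) * (\<gamma> t * I4)" by (rule slice_derivative_oscillation)
  also have "\<dots> \<le> norm \<xi> * Dn v * (\<gamma> t * I4)"
    by (intro mult_right_mono mult_left_mono norm_Da_le b mult_nonneg_nonneg \<gamma>_nonneg I4_nonneg) simp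
  finally have "\<bar>t\<bar> * \<bar>?B\<bar> \<le> \<bar>t\<bar> * (norm \<xi> * Dn v * (\<gamma> t * I4))" by (rule mult_left_mono) simp
  then have "\<bar>?A - t * ?B\<bar> \<le> 6 * (\<gamma> t * I4) + (\<bar>t\<bar> * norm \<xi>) * Dn v * (\<gamma> t * I4)"
    using A abs_triangle_ineq4[of ?A "t * ?B"] by (simp add: abs_mult mult_ac)
  \<comment> \<open>Nonnegative cross terms are added so that the bound factors.\<close>
  also have "\<dots> \<le> 6 * (\<gamma> t * I4) + (\<bar>t\<bar> * norm \<xi>) * Dn v * (\<gamma> t * I4)
      + ((\<bar>t\<bar> * norm \<xi>) * 6 * (\<gamma> t * I4) + Dn v * (\<gamma> t * I4))"
    using \<gamma>_nonneg[of t] I4_nonneg Dn_nonneg[of v] by simp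
  also have "\<dots> = \<gamma> t * I4 * (6 + Dn v) * (1 + \<bar>t\<bar> * norm \<xi>)" by (simp add: algebra_simps)
  finally show ?thesis unfolding eq .
qed

lemma inverse_2pi_cube: "0 \<le> 1 / (2 * pi) ^ 3" "1 / (2 * pi) ^ 3 \<le> 1"
proof -
  have "1 \<le> (2 * pi) ^ 3" using pi_ge_two by (intro one_le_power) simp
  then show "1 / (2 * pi) ^ 3 \<le> 1" by (simp add: divide_le_eq_1)
qed simp

lemma norm_inverse_2pi_cube: "norm (complex_of_real (1 / (2 * pi) ^ 3)) = 1 / (2 * pi) ^ 3"
  unfolding norm_of_real by (rule abs_of_nonneg[OF inverse_2pi_cube(1)])

text \<open>A sup bound on the force, which serves as a majorant; the rate for the mass comes from
  the finer \<open>force_pairing_bound\<close>.\<close>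

lemma force_bound:
  assumes t: "t \<noteq> 0" and b: "b \<in> Basis"
  shows "\<bar>pd b (\<phi> t) x\<bar> \<le> 2 * \<gamma> t * (J 7 / t\<^sup>2)"
proof -
  let ?I = "LINT \<xi>|lborel. cis (\<xi> \<bullet> x) * ((\<i> * of_real (\<xi> \<bullet> b)) * potential_hat t \<xi>)"
  have "\<bar>pd b (\<phi> t) x\<bar> = norm (complex_of_real (pd b (\<phi> t) x))" by simp
  also have "\<dots> = (1 / (2 * pi) ^ 3) * norm ?I"
    unfolding force_inversion[OF t b] norm_mult norm_inverse_2pi_cube ..
  also have "\<dots> \<le> 1 * norm ?I" by (intro mult_right_mono inverse_2pi_cube) simp
  also have "\<dots> \<le> (LINT \<xi>|lborel. norm ((\<i> * of_real (\<xi> \<bullet> b)) * potential_hat t \<xi>))"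
    using integral_norm_bound[of lborel "\<lambda>\<xi>. cis (\<xi> \<bullet> x) * ((\<i> * of_real (\<xi> \<bullet> b)) * potential_hat t \<xi>)"]
    by (simp add: norm_mult)
  finally show ?thesis using force_hat_integrable(2)[OF t b] by linarith
qed

text \<open>Parseval by hand: insert the inversion formula for the force and exchange the integrals,
  so that its transform meets the Fourier integral of \<open>G\<close>. Bounding \<open>G\<close>
  pointwise instead would lose a factor |t| and with it integrability in time; here the loss is 1 +
  |t||\<xi>|, one of the seven available powers.\<close>

lemma force_pairing_bound:
  assumes t: "t \<noteq> 0" and b: "b \<in> Basis"
  shows "\<bar>LINT y|lborel. pd b (\<phi> t) (y + t *\<^sub>R a v) * G t v b y\<bar> \<le> 4 * (\<gamma> t)\<^sup>2 * I4 * (6 + Dn v) * (J 6 / t\<^sup>2)"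
proof -
  let ?w = "\<lambda>\<xi>. (\<i> * of_real (\<xi> \<bullet> b)) * potential_hat t \<xi>"
  let ?c = "complex_of_real (1 / (2 * pi) ^ 3)"
  let ?T = "\<lambda>y \<xi>. (cis (\<xi> \<bullet> (y + t *\<^sub>R a v)) * ?w \<xi>) * complex_of_real (G t v b y)"
  have wm: "?w \<in> borel_measurable borel" by (rule force_hat_measurable)
  have Gm: "(\<lambda>y. complex_of_real (G t v b y)) \<in> borel_measurable borel"
    by (intro borel_measurable_continuous_onI continuous_intros G_continuous)
  have int: "integrable (lborel \<Otimes>\<^sub>M lborel) (\<lambda>(y, \<xi>). ?T y \<xi>)"
  proof (rule lborel_pair.Fubini_integrable)
    have 1: "(\<lambda>p::R3 \<times> R3. cis (snd p \<bullet> (fst p + t *\<^sub>R a v))) \<in> borel_measurable (lborel \<Otimes>\<^sub>M lborel)"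
      by (intro continuous_pair_measurable continuous_intros)
    have 2: "(\<lambda>p::R3 \<times> R3. ?w (snd p)) \<in> borel_measurable (lborel \<Otimes>\<^sub>M lborel)"
      by (rule measurable_compose[OF measurable_snd]) (use wm in simp)
    have 3: "(\<lambda>p::R3 \<times> R3. complex_of_real (G t v b (fst p))) \<in> borel_measurable (lborel \<Otimes>\<^sub>M lborel)"
      by (rule measurable_compose[OF measurable_fst]) (use Gm in simp)
    from borel_measurable_times[OF borel_measurable_times[OF 1 2] 3]
    show "(\<lambda>(y, \<xi>). ?T y \<xi>) \<in> borel_measurable (lborel \<Otimes>\<^sub>M lborel)"
      unfolding case_prod_beta .
    have "(LINT \<xi>|lborel. norm (?T y \<xi>)) = (LINT \<xi>|lborel. norm (?w \<xi>)) * \<bar>G t v b y\<bar>" for y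
      by (simp add: norm_mult)
    then show "integrable lborel (\<lambda>y. LINT \<xi>|lborel. norm (case (y, \<xi>) of (y, \<xi>) \<Rightarrow> ?T y \<xi>))"
      unfolding prod.case by (simp only:) (intro integrable_mult_right integrable_abs G_integrable)
    show "AE y in lborel. integrable lborel (\<lambda>\<xi>. case (y, \<xi>) of (y, \<xi>) \<Rightarrow> ?T y \<xi>)"
      unfolding prod.case
    proof (intro AE_I2 integrable_mult_left)
      fix y
      show "integrable lborel (\<lambda>\<xi>. cis (\<xi> \<bullet> (y + t *\<^sub>R a v)) * ?w \<xi>)"
      proof (rule Bochner_Integration.integrable_bound[OF force_hat_integrable(1)[OF t b]])
        have "(\<lambda>\<xi>. cis (\<xi> \<bullet> (y + t *\<^sub>R a v))) \<in> borel_measurable borel"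
          by (intro cis_measurable continuous_intros)
        from borel_measurable_times[OF this wm]
        show "(\<lambda>\<xi>. cis (\<xi> \<bullet> (y + t *\<^sub>R a v)) * ?w \<xi>) \<in> borel_measurable lborel" by (simp only: measurable_lborel2)
      qed (simp add: norm_mult)
    qed
  qed
  let ?Gh = "\<lambda>\<xi>. LINT y|lborel. cis (\<xi> \<bullet> y) * complex_of_real (G t v b y)"
  have Gh: "norm (?Gh \<xi>) \<le> 2 * (\<gamma> t * I4 * (6 + Dn v) * (1 + \<bar>t\<bar> * norm \<xi>))" for \<xi>
    by (rule norm_integral_cis_le[OF G_integrable]) (auto intro!: continuous_intros G_oscillation b)
  have Teq: "(\<lambda>\<xi>. LINT y|lborel. ?T y \<xi>) = (\<lambda>\<xi>. (cis (\<xi> \<bullet> (t *\<^sub>R a v)) * ?w \<xi>) * ?Gh \<xi>)"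
  proof
    fix \<xi>
    have "(\<lambda>y. ?T y \<xi>) = (\<lambda>y. (cis (\<xi> \<bullet> (t *\<^sub>R a v)) * ?w \<xi>) * (cis (\<xi> \<bullet> y) * complex_of_real (G t v b y)))"
      by (rule ext) (simp add: inner_add_right cis_mult[symmetric] mult_ac)
    then show "(LINT y|lborel. ?T y \<xi>) = (cis (\<xi> \<bullet> (t *\<^sub>R a v)) * ?w \<xi>) * ?Gh \<xi>"
      by (simp only: integral_mult_right_zero)
  qed
  have "complex_of_real (LINT y|lborel. pd b (\<phi> t) (y + t *\<^sub>R a v) * G t v b y)
    = (LINT y|lborel. complex_of_real (pd b (\<phi> t) (y + t *\<^sub>R a v)) * complex_of_real (G t v b y))"
    by (simp flip: of_real_mult)
  also have "\<dots> = (LINT y|lborel. ?c * (LINT \<xi>|lborel. ?T y \<xi>))"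
    unfolding force_inversion[OF t b] integral_mult_left_zero
    by (rule Bochner_Integration.integral_cong[OF refl]) (rule mult.assoc)
  also have "\<dots> = ?c * (LINT y|lborel. LINT \<xi>|lborel. ?T y \<xi>)" by (rule integral_mult_right_zero)
  also have "(LINT y|lborel. LINT \<xi>|lborel. ?T y \<xi>) = (LINT \<xi>|lborel. LINT y|lborel. ?T y \<xi>)"
    by (rule lborel_pair.Fubini_integral[OF int, symmetric])
  also note Teq
  finally have eq: "complex_of_real (LINT y|lborel. pd b (\<phi> t) (y + t *\<^sub>R a v) * G t v b y)
    = ?c * (LINT \<xi>|lborel. (cis (\<xi> \<bullet> (t *\<^sub>R a v)) * ?w \<xi>) * ?Gh \<xi>)" .
  let ?C = "4 * (\<gamma> t)\<^sup>2 * I4 * (6 + Dn v)"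
  have C: "?C \<ge> 0" using I4_nonneg Dn_nonneg[of v] by simp
  have le: "norm ((cis (\<xi> \<bullet> (t *\<^sub>R a v)) * ?w \<xi>) * ?Gh \<xi>) \<le> ?C * (1 / (norm \<xi> * (1 + \<bar>t\<bar> * norm \<xi>) ^ 6))" for \<xi>
  proof -
    have p: "1 + \<bar>t\<bar> * norm \<xi> > 0" by (intro add_pos_nonneg) auto
    have "norm ((cis (\<xi> \<bullet> (t *\<^sub>R a v)) * ?w \<xi>) * ?Gh \<xi>) = norm (?w \<xi>) * norm (?Gh \<xi>)" by (simp add: norm_mult)
    also have "\<dots> \<le> (2 * \<gamma> t * (1 / (norm \<xi> * (1 + \<bar>t\<bar> * norm \<xi>) ^ 7))) * (2 * (\<gamma> t * I4 * (6 + Dn v) * (1 + \<bar>t\<bar> * norm \<xi>)))"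
      using p by (intro mult_mono force_hat_bound b Gh) (auto intro!: mult_nonneg_nonneg divide_nonneg_nonneg \<gamma>_nonneg)
    also have "\<dots> = ?C * (1 / (norm \<xi> * (1 + \<bar>t\<bar> * norm \<xi>) ^ 7) * (1 + \<bar>t\<bar> * norm \<xi>))"
      by (simp add: power2_eq_square mult_ac)
    \<comment> \<open>At frequency 0 both sides are 0 by the convention for division.\<close>
    also have "1 / (norm \<xi> * (1 + \<bar>t\<bar> * norm \<xi>) ^ 7) * (1 + \<bar>t\<bar> * norm \<xi>) = 1 / (norm \<xi> * (1 + \<bar>t\<bar> * norm \<xi>) ^ 6)"
      using p by (cases "\<xi> = 0") (simp_all add: power_Suc[of _ 6, simplified] divide_simps)
    finally show ?thesis .
  qed
  have k: "integrable lborel (\<lambda>\<xi>::R3. ?C * (1 / (norm \<xi> * (1 + \<bar>t\<bar> * norm \<xi>) ^ 6)))"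
    by (intro integrable_mult_right scaled_kernel t) simp
  have "\<bar>LINT y|lborel. pd b (\<phi> t) (y + t *\<^sub>R a v) * G t v b y\<bar>
    = (1 / (2 * pi) ^ 3) * norm (LINT \<xi>|lborel. (cis (\<xi> \<bullet> (t *\<^sub>R a v)) * ?w \<xi>) * ?Gh \<xi>)"
    using arg_cong[OF eq, of norm] unfolding norm_mult[of ?c] norm_inverse_2pi_cube unfolding norm_of_real .
  also have "\<dots> \<le> 1 * norm (LINT \<xi>|lborel. (cis (\<xi> \<bullet> (t *\<^sub>R a v)) * ?w \<xi>) * ?Gh \<xi>)"
    by (intro mult_right_mono inverse_2pi_cube) simp
  also have "\<dots> \<le> (LINT \<xi>::R3|lborel. ?C * (1 / (norm \<xi> * (1 + \<bar>t\<bar> * norm \<xi>) ^ 6)))"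
    unfolding mult_1 by (rule Bochner_Integration.integral_norm_bound_integral[OF _ k le])
      (use lborel_pair.integrable_snd[OF int] in \<open>simp only: Teq\<close>)
  also have "\<dots> = ?C * (J 6 / t\<^sup>2)"
    using scaled_kernel(2)[OF t, of 6] by (simp only: integral_mult_right_zero)
  finally show ?thesis .
qed

lemma H_continuous: "continuous_on S t1 \<Longrightarrow> continuous_on S y1 \<Longrightarrow> continuous_on S (\<lambda>p. H (t1 p) v (y1 p))"
  unfolding H_def shear_def by (intro C1_continuous_pd[OF C1_F] continuous_intros) auto

text \<open>Keeps the full factor |t| of the velocity gradient, so its rate is only about
  |t|^(-1/2). It is applied on bounded time intervals, to justify Fubini.\<close>

lemma H_bound:
  assumes t: "t \<noteq> 0"
  shows "\<bar>H t v y\<bar> \<le> (36 * (\<gamma> t)\<^sup>2 * (J 7 / t\<^sup>2) * (1 + \<bar>t\<bar> * Dn v)) * (1 / (1 + norm y) ^ 4)"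
proof -
  let ?D = "1 / (1 + norm y) ^ 4"
  have Gb: "\<bar>G t v b y\<bar> \<le> (6 * (1 + \<bar>t\<bar> * Dn v) * \<gamma> t) * ?D" if b: "b \<in> Basis" for b
  proof -
    have "norm (- t *\<^sub>R Da v b, b) \<le> norm (- t *\<^sub>R Da v b) + norm b" by (rule norm_Pair_le)
    also have "\<dots> \<le> \<bar>t\<bar> * Dn v + 1"
      using b norm_Da_le[OF b, of v] by (simp add: mult_left_mono)
    finally have n: "norm (- t *\<^sub>R Da v b, b) \<le> 1 + \<bar>t\<bar> * Dn v" by simp
    have "\<bar>G t v b y\<bar> \<le> (6 * norm (- t *\<^sub>R Da v b, b) * \<gamma> t) * ?D"
      unfolding G_def by (rule pd_slice_bound)
    also have "\<dots> \<le> (6 * (1 + \<bar>t\<bar> * Dn v) * \<gamma> t) * ?D"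
      by (intro mult_right_mono mult_left_mono n \<gamma>_nonneg) auto
    finally show ?thesis .
  qed
  have "\<bar>H t v y\<bar> = \<bar>\<Sum>b\<in>Basis. pd b (\<phi> t) (y + t *\<^sub>R a v) * G t v b y\<bar>"
    unfolding transport using mu by (simp add: abs_mult)
  also have "\<dots> \<le> (\<Sum>b\<in>Basis. \<bar>pd b (\<phi> t) (y + t *\<^sub>R a v) * G t v b y\<bar>)" by (rule sum_abs)
  also have "\<dots> \<le> (\<Sum>b\<in>(Basis :: R3 set). (2 * \<gamma> t * (J 7 / t\<^sup>2)) * ((6 * (1 + \<bar>t\<bar> * Dn v) * \<gamma> t) * ?D))"
    unfolding abs_mult
    by (intro sum_mono mult_mono force_bound t Gb)
      (auto intro!: mult_nonneg_nonneg divide_nonneg_nonneg \<gamma>_nonneg J_nonneg)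
  also have "\<dots> = (36 * (\<gamma> t)\<^sup>2 * (J 7 / t\<^sup>2) * (1 + \<bar>t\<bar> * Dn v)) * ?D"
    by (simp add: power2_eq_square mult_ac)
  finally show ?thesis .
qed

lemma H_integral_bound:
  assumes t: "t \<noteq> 0"
  shows "\<bar>LINT y|lborel. H t v y\<bar> \<le> 12 * (\<gamma> t)\<^sup>2 * I4 * (6 + Dn v) * (J 6 / t\<^sup>2)"
proof -
  let ?E = "\<lambda>b y. pd b (\<phi> t) (y + t *\<^sub>R a v)"
  have int: "integrable lborel (\<lambda>y. ?E b y * G t v b y)" if b: "b \<in> Basis" for b
  proof (rule Bochner_Integration.integrable_bound)
    let ?C = "2 * \<gamma> t * (J 7 / t\<^sup>2)"
    show "integrable lborel (\<lambda>y. ?C * \<bar>G t v b y\<bar>)" by (intro integrable_mult_right integrable_abs G_integrable)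
    have "\<phi> t differentiable_on UNIV" "pd b (\<phi> t) differentiable_on UNIV"
      using vp b unfolding vlasov_poisson_def twice_differentiable_def by blast+
    then have "continuous_on UNIV (pd b (\<phi> t))" by (simp add: differentiable_imp_continuous_on)
    then have "continuous_on UNIV (\<lambda>y. ?E b y)"
      by (rule continuous_on_compose2) (auto intro!: continuous_intros)
    then have "continuous_on UNIV (\<lambda>y. ?E b y * G t v b y)" by (intro continuous_on_mult G_continuous)
    then show "(\<lambda>y. ?E b y * G t v b y) \<in> borel_measurable lborel"
      using borel_measurable_continuous_onI by simp
    show "AE y in lborel. norm (?E b y * G t v b y) \<le> norm (?C * \<bar>G t v b y\<bar>)"
    proof (rule AE_I2)
      fix y
      have "\<bar>?E b y\<bar> * \<bar>G t v b y\<bar> \<le> ?C * \<bar>G t v b y\<bar>" by (intro mult_right_mono force_bound t b) simp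
      then show "norm (?E b y * G t v b y) \<le> norm (?C * \<bar>G t v b y\<bar>)"
        unfolding real_norm_def abs_mult[of "?E b y"] by (rule order_trans[OF _ abs_ge_self])
    qed
  qed
  have "(LINT y|lborel. H t v y) = - \<mu> * (LINT y|lborel. (\<Sum>b\<in>Basis. ?E b y * G t v b y))"
    unfolding transport by (rule integral_mult_right_zero)
  also have "(LINT y|lborel. (\<Sum>b\<in>Basis. ?E b y * G t v b y)) = (\<Sum>b\<in>Basis. LINT y|lborel. ?E b y * G t v b y)"
    by (rule Bochner_Integration.integral_sum[OF int])
  finally have "\<bar>LINT y|lborel. H t v y\<bar> = \<bar>\<Sum>b\<in>Basis. LINT y|lborel. ?E b y * G t v b y\<bar>"
    using mu by (simp add: abs_mult)
  also have "\<dots> \<le> (\<Sum>b\<in>Basis. \<bar>LINT y|lborel. ?E b y * G t v b y\<bar>)" by (rule sum_abs)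
  also have "\<dots> \<le> (\<Sum>b\<in>(Basis :: R3 set). 4 * (\<gamma> t)\<^sup>2 * I4 * (6 + Dn v) * (J 6 / t\<^sup>2))"
    by (intro sum_mono force_pairing_bound t)
  finally show ?thesis by simp
qed

lemma \<gamma>_square_le:
  assumes "\<bar>t\<bar> \<ge> 1"
  shows "(\<gamma> t)\<^sup>2 \<le> 2 * \<kappa>\<^sup>2 * \<bar>t\<bar> powr (1 / 2)"
proof -
  have "(growth t)\<^sup>2 = (1 + \<bar>t\<bar>) powr (1 / 2)"
    by (simp add: growth_def power2_eq_square powr_add[symmetric])
  also have "\<dots> \<le> (2 * \<bar>t\<bar>) powr (1 / 2)" by (intro powr_mono2) (use assms in auto)
  also have "\<dots> = 2 powr (1 / 2) * \<bar>t\<bar> powr (1 / 2)" by (simp add: powr_mult)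
  also have "\<dots> \<le> 2 powr 1 * \<bar>t\<bar> powr (1 / 2)" by (intro mult_right_mono powr_mono) auto
  finally have "(growth t)\<^sup>2 \<le> 2 * \<bar>t\<bar> powr (1 / 2)" by simp
  then show ?thesis
    unfolding \<gamma>_def power_mult_distrib using mult_left_mono[of "(growth t)\<^sup>2" _ "\<kappa>\<^sup>2"] by fastforce
qed

section \<open>The mass at fixed velocity as time tends to plus or minus infinity\<close>

definition mass :: "real \<Rightarrow> R3 \<Rightarrow> real" where
  "mass t v = (LINT y|lborel. g t (y, v))"

text \<open>At fixed (y, v) the sheared point moves along a straight line with direction (1, a v,
  0), so the derivative along lines applies directly.\<close>

lemma g_time_derivative: "((\<lambda>t. g t (y, v)) has_real_derivative H t v y) (at t)"
proof -
  have "shear s (y, v) = (0, y, v) + s *\<^sub>R (1, a v, 0)" for s by (simp add: shear_def)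
  then show ?thesis
    unfolding g_eq H_def using has_real_derivative_line[OF C1_differentiable[OF C1_F], where z="(0, y, v)" and h="(1, a v, 0)"]
    by simp
qed

text \<open>The fundamental theorem in time under the spatial integral, then Fubini. The sign
  \<open>s\<close> treats both time directions at once, and times start at 1, away from t = 0 where
  the force estimates do not apply. The rate |t|^(-3/2) is integrable, with a tail of order
  p^(-1/2).\<close>

lemma mass_increment:
  assumes s: "\<bar>s\<bar> = 1"
  obtains C where "\<And>p q. 1 \<le> p \<Longrightarrow> p \<le> q \<Longrightarrow> \<bar>mass (s * q) v - mass (s * p) v\<bar> \<le> C * p powr (- 1 / 2)"
proof -
  \<comment> \<open>24 is the 12 of \<open>H_integral_bound\<close> times the 2 of
    \<open>\<gamma>_square_le\<close>.\<close>
  define C where "C = 24 * \<kappa>\<^sup>2 * I4 * (6 + Dn v) * J 6"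
  have C: "C \<ge> 0" unfolding C_def using I4_nonneg Dn_nonneg[of v] J_nonneg[of 6] by simp
  have rate: "\<bar>LINT y|lborel. H (s * \<tau>) v y\<bar> \<le> C * \<tau> powr (- 3 / 2)" if \<tau>: "\<tau> \<ge> 1" for \<tau>
  proof -
    have abs: "\<bar>s * \<tau>\<bar> = \<tau>" "(s * \<tau>)\<^sup>2 = \<tau>\<^sup>2"
      using s \<tau> by (simp_all add: abs_mult power_mult_distrib abs_square_eq_1[symmetric])
    have "\<bar>LINT y|lborel. H (s * \<tau>) v y\<bar> \<le> 12 * (\<gamma> (s * \<tau>))\<^sup>2 * I4 * (6 + Dn v) * (J 6 / \<tau>\<^sup>2)"
      using H_integral_bound[of "s * \<tau>" v] abs \<tau> s by auto
    also have "\<dots> \<le> 12 * (2 * \<kappa>\<^sup>2 * \<tau> powr (1 / 2)) * I4 * (6 + Dn v) * (J 6 / \<tau>\<^sup>2)"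
      using \<gamma>_square_le[of "s * \<tau>"] abs \<tau>
      by (intro mult_right_mono mult_left_mono) (auto simp: I4_nonneg Dn_nonneg J_nonneg)
    also have "\<dots> = C * (\<tau> powr (1 / 2) / \<tau>\<^sup>2)" by (simp add: C_def)
    also have "\<tau> powr (1 / 2) / \<tau>\<^sup>2 = \<tau> powr (- 3 / 2)"
      using \<tau> by (simp add: powr_diff[symmetric] flip: powr_numeral)
    finally show ?thesis .
  qed
  have "\<bar>mass (s * q) v - mass (s * p) v\<bar> \<le> (2 * C) * p powr (- 1 / 2)" if p: "1 \<le> p" "p \<le> q" for p q
  proof -
    let ?h = "\<lambda>\<tau> y. indicator {p..q} \<tau> * (s * H (s * \<tau>) v y)"
    \<comment> \<open>Only finiteness on [p, q] counts here, so \<open>growth\<close> is bounded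
      crudely by 1 + q.\<close>
    let ?B = "36 * (\<kappa> * (1 + q))\<^sup>2 * J 7 * (1 + q * Dn v)"
    have Hb: "\<bar>s * H (s * \<tau>) v y\<bar> \<le> ?B * (1 / (1 + norm y) ^ 4)" if \<tau>: "\<tau> \<in> {p..q}" for \<tau> y
    proof -
      have \<tau>1: "1 \<le> \<tau>" "\<tau> \<le> q" using \<tau> p by auto
      have abs: "\<bar>s * \<tau>\<bar> = \<tau>" "(s * \<tau>)\<^sup>2 = \<tau>\<^sup>2" "s * \<tau> \<noteq> 0"
        using s \<tau>1 by (auto simp: abs_mult power_mult_distrib abs_square_eq_1[symmetric])
      have "growth (s * \<tau>) \<le> (1 + \<tau>) powr 1" unfolding growth_def abs by (intro powr_mono) (use \<tau>1 in auto)
      then have "\<gamma> (s * \<tau>) \<le> \<kappa> * (1 + q)" unfolding \<gamma>_def using \<tau>1 \<kappa>_nonneg by (intro mult_left_mono) auto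
      then have 1: "(\<gamma> (s * \<tau>))\<^sup>2 \<le> (\<kappa> * (1 + q))\<^sup>2" by (rule power_mono) (rule \<gamma>_nonneg)
      have 2: "J 7 / \<tau>\<^sup>2 \<le> J 7" using \<tau>1 J_nonneg[of 7] by (simp add: divide_le_eq mult_le_cancel_left1)
      have 3: "1 + \<tau> * Dn v \<le> 1 + q * Dn v" using \<tau>1 Dn_nonneg[of v] by (simp add: mult_right_mono)
      have "\<bar>s * H (s * \<tau>) v y\<bar> = \<bar>H (s * \<tau>) v y\<bar>" using s by (simp add: abs_mult)
      also have "\<dots> \<le> (36 * (\<gamma> (s * \<tau>))\<^sup>2 * (J 7 / \<tau>\<^sup>2) * (1 + \<tau> * Dn v)) * (1 / (1 + norm y) ^ 4)"
        using H_bound[OF abs(3), of v y] unfolding abs(1,2) .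
      also have "\<dots> \<le> ?B * (1 / (1 + norm y) ^ 4)"
        using \<tau>1 by (intro mult_right_mono mult_mono 1 2 3)
          (auto intro!: mult_nonneg_nonneg divide_nonneg_nonneg add_nonneg_nonneg simp: J_nonneg Dn_nonneg)
      finally show ?thesis .
    qed
    have int: "integrable (lborel \<Otimes>\<^sub>M lborel) (\<lambda>(\<tau>, y). ?h \<tau> y)"
    proof (rule lborel_pair.Fubini_integrable)
      have 1: "(\<lambda>x::real \<times> R3. indicator {p..q} (fst x) :: real) \<in> borel_measurable (lborel \<Otimes>\<^sub>M lborel)"
        by (rule measurable_compose[OF measurable_fst]) simp
      have 2: "(\<lambda>x::real \<times> R3. s * H (s * fst x) v (snd x)) \<in> borel_measurable (lborel \<Otimes>\<^sub>M lborel)"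
        by (intro continuous_pair_measurable continuous_on_mult H_continuous continuous_intros)
      from borel_measurable_times[OF 1 2]
      show meas: "(\<lambda>(\<tau>, y). ?h \<tau> y) \<in> borel_measurable (lborel \<Otimes>\<^sub>M lborel)"
        unfolding case_prod_beta .
      have hm: "(\<lambda>y. s * H (s * \<tau>) v y) \<in> borel_measurable borel" for \<tau>
        by (intro borel_measurable_continuous_onI continuous_on_mult H_continuous continuous_intros)
      have bound: "\<bar>?h \<tau> y\<bar> \<le> (indicator {p..q} \<tau> * ?B) * (1 / (1 + norm y) ^ 4)" for \<tau> y
        using Hb[of \<tau> y] by (cases "\<tau> \<in> {p..q}") auto
      have hm': "(\<lambda>y. ?h \<tau> y) \<in> borel_measurable borel" for \<tau>
        using borel_measurable_times[OF borel_measurable_const hm] by simp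
      note d = decay_dominated[OF hm' bound]
      show "AE \<tau> in lborel. integrable lborel (\<lambda>y. case (\<tau>, y) of (\<tau>, y) \<Rightarrow> ?h \<tau> y)"
        unfolding prod.case by (intro AE_I2 d(1))
      have nm: "(\<lambda>x. norm (case x of (\<tau>, y) \<Rightarrow> ?h \<tau> y)) \<in> borel_measurable (lborel \<Otimes>\<^sub>M lborel)"
        by (rule measurable_compose[OF meas borel_measurable_norm])
      show "integrable lborel (\<lambda>\<tau>. LINT y|lborel. norm (case (\<tau>, y) of (\<tau>, y) \<Rightarrow> ?h \<tau> y))"
      proof (rule Bochner_Integration.integrable_bound)
        show "integrable lborel (\<lambda>\<tau>. indicator {p..q} \<tau> * (?B * I4))"
          by (intro integrable_mult_left integrable_real_indicator) (use p in auto)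
        have "(\<lambda>\<tau>. LINT y|lborel. norm (case (\<tau>, y) of (\<tau>, y) \<Rightarrow> ?h \<tau> y)) \<in> borel_measurable lborel"
          by (rule lborel.borel_measurable_lebesgue_integral) (use nm in \<open>simp add: case_prod_beta\<close>)
        then show "(\<lambda>\<tau>. LINT y|lborel. norm (case (\<tau>, y) of (\<tau>, y) \<Rightarrow> ?h \<tau> y)) \<in> borel_measurable lborel" .
        show "AE \<tau> in lborel. norm (LINT y|lborel. norm (case (\<tau>, y) of (\<tau>, y) \<Rightarrow> ?h \<tau> y)) \<le> norm (indicator {p..q} \<tau> * (?B * I4))"
        proof (rule AE_I2)
          fix \<tau>
          have "norm (LINT y|lborel. norm (?h \<tau> y)) = (LINT y|lborel. \<bar>?h \<tau> y\<bar>)" by simp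
          also have "\<dots> \<le> (indicator {p..q} \<tau> * ?B) * I4" by (rule d(2))
          also have "\<dots> \<le> norm (indicator {p..q} \<tau> * (?B * I4))" unfolding mult.assoc real_norm_def by (rule abs_ge_self)
          finally show "norm (LINT y|lborel. norm (case (\<tau>, y) of (\<tau>, y) \<Rightarrow> ?h \<tau> y)) \<le> norm (indicator {p..q} \<tau> * (?B * I4))"
            unfolding prod.case .
        qed
      qed
    qed
    have ftc: "(LINT \<tau>|lborel. ?h \<tau> y) = g (s * q) (y, v) - g (s * p) (y, v)" for y
    proof -
      have "(LINT \<tau>|lborel. (s * H (s * \<tau>) v y) * indicator {p..q} \<tau>) = g (s * q) (y, v) - g (s * p) (y, v)"
      proof (rule integral_FTC_Icc_real[OF p(2)])
        fix \<tau>
        have "((\<lambda>\<tau>. s * \<tau>) has_real_derivative s) (at \<tau>)" by (auto intro!: derivative_eq_intros)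
        from DERIV_chain2[OF g_time_derivative this]
        show "((\<lambda>\<tau>. g (s * \<tau>) (y, v)) has_real_derivative s * H (s * \<tau>) v y) (at \<tau>)"
          by (simp add: mult.commute)
        have "continuous_on UNIV (\<lambda>\<tau>. s * H (s * \<tau>) v y)"
          by (intro continuous_on_mult H_continuous continuous_intros)
        then show "isCont (\<lambda>\<tau>. s * H (s * \<tau>) v y) \<tau>" by (simp add: continuous_on_eq_continuous_at)
      qed
      then show ?thesis by (simp only: mult.commute)
    qed
    have "mass (s * q) v - mass (s * p) v = (LINT y|lborel. g (s * q) (y, v) - g (s * p) (y, v))"
      unfolding mass_def using slice_integrable(1) by simp
    also have "\<dots> = (LINT y|lborel. LINT \<tau>|lborel. ?h \<tau> y)" unfolding ftc ..
    also have "\<dots> = (LINT \<tau>|lborel. LINT y|lborel. ?h \<tau> y)" by (rule lborel_pair.Fubini_integral[OF int])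
    finally have eq: "mass (s * q) v - mass (s * p) v = (LINT \<tau>|lborel. LINT y|lborel. ?h \<tau> y)" .
    have inner: "norm (LINT y|lborel. ?h \<tau> y) \<le> (C * \<tau> powr (- 3 / 2)) * indicator {p..q} \<tau>" for \<tau>
    proof (cases "\<tau> \<in> {p..q}")
      case True
      then have "norm (LINT y|lborel. ?h \<tau> y) = \<bar>LINT y|lborel. H (s * \<tau>) v y\<bar>"
        using s by (simp add: abs_mult)
      then show ?thesis using rate[of \<tau>] True p by simp
    qed simp
    have F1: "((\<lambda>\<tau>. (- 2 * C) * \<tau> powr (- 1 / 2)) has_real_derivative C * \<tau> powr (- 3 / 2)) (at \<tau>)" if "p \<le> \<tau>" for \<tau>
    proof -
      have "((\<lambda>\<tau>. (- 2 * C) * \<tau> powr (- 1 / 2)) has_real_derivative (- 2 * C) * ((- 1 / 2) * \<tau> powr (- 1 / 2 - 1))) (at \<tau>)"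
        using that p by (intro DERIV_cmult has_real_derivative_powr) simp
      then show ?thesis by simp
    qed
    have F2: "isCont (\<lambda>\<tau>. C * \<tau> powr (- 3 / 2)) \<tau>" if "p \<le> \<tau>" for \<tau>
      using that p by (intro continuous_intros) auto
    have ftc2: "(LINT \<tau>|lborel. (C * \<tau> powr (- 3 / 2)) * indicator {p..q} \<tau>) = (- 2 * C) * q powr (- 1 / 2) - (- 2 * C) * p powr (- 1 / 2)"
      by (rule integral_FTC_Icc_real[OF p(2)]) (use F1 F2 in auto)
    have int2: "integrable lborel (\<lambda>\<tau>. (C * \<tau> powr (- 3 / 2)) * indicator {p..q} \<tau>)"
    proof -
      have "continuous_on {p..q} (\<lambda>\<tau>. C * \<tau> powr (- 3 / 2))"
        using F2 by (auto intro!: continuous_at_imp_continuous_on)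
      then have "integrable lborel (\<lambda>\<tau>. indicator {p..q} \<tau> *\<^sub>R (C * \<tau> powr (- 3 / 2)))"
        by (intro borel_integrable_compact) auto
      then show ?thesis by (simp add: mult.commute)
    qed
    have "\<bar>mass (s * q) v - mass (s * p) v\<bar> \<le> (LINT \<tau>|lborel. (C * \<tau> powr (- 3 / 2)) * indicator {p..q} \<tau>)"
      unfolding eq real_norm_def[symmetric]
      by (rule Bochner_Integration.integral_norm_bound_integral[OF lborel_pair.integrable_fst[OF int] int2 inner])
    also have "\<dots> \<le> (2 * C) * p powr (- 1 / 2)"
      unfolding ftc2 using C by simp
    finally show ?thesis .
  qed
  then show thesis by (rule that)
qed

lemma f_slice_integrable: "integrable lborel (\<lambda>x. f t x v)"
  using integrable_translate[OF slice_integrable(1)[of t v], of "- (t *\<^sub>R a v)"] by (simp add: f_eq_g)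

lemma f_mass: "(LINT x|lborel. f t x v) = mass t v"
  using integral_translate[of "\<lambda>y. g t (y, v)" "- (t *\<^sub>R a v)"] by (simp add: f_eq_g mass_def)

lemma mass_limits:
  obtains l l' where "((\<lambda>t. mass t v) \<longlongrightarrow> l) at_top" "((\<lambda>t. mass t v) \<longlongrightarrow> l') at_bot"
proof -
  obtain C where C: "\<And>p q. 1 \<le> p \<Longrightarrow> p \<le> q \<Longrightarrow> \<bar>mass (1 * q) v - mass (1 * p) v\<bar> \<le> C * p powr (- 1 / 2)"
    using mass_increment[of 1 v] by auto
  obtain l where l: "((\<lambda>t. mass t v) \<longlongrightarrow> l) at_top"
    by (rule powr_tail_convergent[of "\<lambda>t. mass t v" C]) (use C in auto)
  obtain C' where C': "\<And>p q. 1 \<le> p \<Longrightarrow> p \<le> q \<Longrightarrow> \<bar>mass (- 1 * q) v - mass (- 1 * p) v\<bar> \<le> C' * p powr (- 1 / 2)"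
    using mass_increment[of "- 1" v] by auto
  obtain l' where l': "((\<lambda>t. mass (- t) v) \<longlongrightarrow> l') at_top"
    by (rule powr_tail_convergent[of "\<lambda>t. mass (- t) v" C']) (use C' in auto)
  show thesis by (rule that[OF l]) (use l' in \<open>simp add: filterlim_at_bot_mirror\<close>)
qed

text \<open>Only the spatial mass of the scattering data matters, so a fixed unit bump in \<open>x\<close> carries it.\<close>

lemma scatters:
  assumes "\<And>v. ((\<lambda>t. mass t v) \<longlongrightarrow> l v) A"
  shows "scatters_to a f (\<lambda>x v. l v * (\<Prod>b\<in>Basis. mollifier 1 0 b x)) A"
proof -
  let ?\<eta> = "\<lambda>x::R3. \<Prod>b\<in>Basis. mollifier 1 0 b x"
  have int: "integrable lborel (\<lambda>x. l v * ?\<eta> x)" for v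
    by (intro integrable_mult_right integral_mollifier(1)) simp
  have val: "(LINT x|lborel. l v * ?\<eta> x) = l v" for v
    unfolding integral_mult_right_zero by (subst integral_mollifier(2)) simp_all
  have lin: "(LINT x|lborel. linear_solution a (\<lambda>x v. l v * ?\<eta> x) t x v) = (LINT x|lborel. l v * ?\<eta> x)" for t v
    using integral_translate[of "\<lambda>x. l v * ?\<eta> x" "- (t *\<^sub>R a v)"] by (simp add: linear_solution_def)
  show ?thesis
    unfolding scatters_to_def
    by (intro allI conjI int f_slice_integrable lin) (simp only: f_mass val assms)
qed

lemma scatters_both:
  "\<exists>f_plus f_minus. scatters_to a f f_plus at_top \<and> scatters_to a f f_minus at_bot"
proof -
  have "\<forall>v. \<exists>l l'. ((\<lambda>t. mass t v) \<longlongrightarrow> l) at_top \<and> ((\<lambda>t. mass t v) \<longlongrightarrow> l') at_bot"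
    using mass_limits by blast
  then obtain l l' where "\<And>v. ((\<lambda>t. mass t v) \<longlongrightarrow> l v) at_top" "\<And>v. ((\<lambda>t. mass t v) \<longlongrightarrow> l' v) at_bot"
    by metis
  then show ?thesis using scatters by blast
qed

end

theorem mainTheorem2:
  shows "\<exists>(N0::nat) (\<delta>0::real). 30 \<le> N0 \<and> 0 < \<delta>0 \<and> \<delta>0 \<le> 1 / 10 ^ 9 \<and>
    (\<forall>\<delta>. 0 < \<delta> \<and> \<delta> \<le> \<delta>0 \<longrightarrow>
      (\<exists>\<epsilon>bar>0. \<forall>(a :: real^3 \<Rightarrow> real^3) (\<mu>::real) (\<epsilon>0::real) (f0 :: real^3 \<Rightarrow> real^3 \<Rightarrow> real).
        (a = (\<lambda>v. v) \<or> a = (\<lambda>v. (1 / sqrt (1 + (norm v)\<^sup>2)) *\<^sub>R v)) \<and>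
        \<mu> \<in> {1, -1} \<and> 0 < \<epsilon>0 \<and> \<epsilon>0 \<le> \<epsilon>bar \<and>
        (\<lambda>(x, v). f0 x v) \<in> weighted_sobolev N0 \<and>
        weighted_norm N0 (\<lambda>(x, v). f0 x v) \<le> \<epsilon>0 \<longrightarrow>
        (\<forall>f \<phi>. global_solution N0 \<delta> \<epsilon>0 a \<mu> f0 f \<phi> \<longrightarrow>
          (\<exists>f_plus f_minus :: real^3 \<Rightarrow> real^3 \<Rightarrow> real.
             scatters_to a f f_plus at_top \<and> scatters_to a f f_minus at_bot))))"
\<comment> \<open>30 yields the weight exponent 300 on which the budget of eight derivatives rests;
  1 / 10 ^ 9 lies below the threshold 1 / 8 of the locale.\<close>
proof (rule exI[of _ 30], rule exI[of _ "1 / 10 ^ 9"], intro conjI allI impI)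
  fix \<delta> :: real assume \<delta>: "0 < \<delta> \<and> \<delta> \<le> 1 / 10 ^ 9"
  show "\<exists>\<epsilon>bar>0. \<forall>(a :: real^3 \<Rightarrow> real^3) (\<mu>::real) (\<epsilon>0::real) (f0 :: real^3 \<Rightarrow> real^3 \<Rightarrow> real).
        (a = (\<lambda>v. v) \<or> a = (\<lambda>v. (1 / sqrt (1 + (norm v)\<^sup>2)) *\<^sub>R v)) \<and>
        \<mu> \<in> {1, -1} \<and> 0 < \<epsilon>0 \<and> \<epsilon>0 \<le> \<epsilon>bar \<and>
        (\<lambda>(x, v). f0 x v) \<in> weighted_sobolev 30 \<and>
        weighted_norm 30 (\<lambda>(x, v). f0 x v) \<le> \<epsilon>0 \<longrightarrow>
        (\<forall>f \<phi>. global_solution 30 \<delta> \<epsilon>0 a \<mu> f0 f \<phi> \<longrightarrow>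
          (\<exists>f_plus f_minus :: real^3 \<Rightarrow> real^3 \<Rightarrow> real.
             scatters_to a f f_plus at_top \<and> scatters_to a f f_minus at_bot))"
  \<comment> \<open>The size of the solution enters through the square of its norm bound, where a
    factor at most 1 is absorbed.\<close>
  proof (rule exI[of _ 1], intro conjI allI impI)
    fix a :: "R3 \<Rightarrow> R3" and \<mu> \<epsilon>0 :: real and f0 :: "R3 \<Rightarrow> R3 \<Rightarrow> real" and f \<phi>
    assume asm: "(a = (\<lambda>v. v) \<or> a = (\<lambda>v. (1 / sqrt (1 + (norm v)\<^sup>2)) *\<^sub>R v)) \<and>
        \<mu> \<in> {1, -1} \<and> 0 < \<epsilon>0 \<and> \<epsilon>0 \<le> 1 \<and>
        (\<lambda>(x, v). f0 x v) \<in> weighted_sobolev 30 \<and> weighted_norm 30 (\<lambda>(x, v). f0 x v) \<le> \<epsilon>0"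
      and sol: "global_solution 30 \<delta> \<epsilon>0 a \<mu> f0 f \<phi>"
    obtain c where c: "nondegenerate a c"
      using asm nondegenerate_identity nondegenerate_relativistic by blast
    have "vp_solution a c \<mu> \<delta> \<epsilon>0 f0 f \<phi>"
      by unfold_locales (use asm c \<delta> sol in auto)
    then show "\<exists>f_plus f_minus. scatters_to a f f_plus at_top \<and> scatters_to a f f_minus at_bot"
      by (rule vp_solution.scatters_both)
  qed simp
qed simp_all

end
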